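(* Let $x$ be large (i.e. larger than a suitable absolute constant), let $\mathcal{P}_0$ be a subset of the primes, and suppose there exists $x^{-1/10}<c\le1$ such that $$\sum_{y/2<p\le y,\ p\in\mathcal{P}_0}\log p\ \ge\ c\sum_{y/2<p\le y}\log p\qquad\text{whenever } x^{1/10}\le y\le x^{1/2}.$$ Suppose $\mathcal{S}\subseteq[1,x]$ is a non-empty set of integers none of which is divisible by any $p\in\mathcal{P}_0$, and let $\sigma:=(\#\mathcal{S})/x$. Suppose also that $\mathcal{S}_0\subseteq\mathcal{S}$ is any non-empty set, and let $\sigma_0:=(\#\mathcal{S}_0)/(\#\mathcal{S})$. Set $K:=1000(\sigma_0\sigma c^2)^{-1}(\log x)^2$ and $\mathcal{P}_0^*:=\mathcal{P}_0\cap[K^3,\infty)$, and suppose that at least one of the following holds: (1) (Sieve Controls Size) $$\sum_{\substack{1<q\le\sqrt{x}\\ p\mid q\Rightarrow p\in\mathcal{P}_0^*}}\mu^2(q)\prod_{p\mid q}\frac{2}{p}\ \ge\ 10(\sigma_0\sigma)^{-1};$$ (2) (Bombieri--Vinogradov) there exists a positive integer $Q$ such that $$\sum_{\substack{1<q\le Q\\ p\mid q\Rightarrow p\in\mathcal{P}_0^*}}\frac{\mu^2(q)}{q}\ \ge\ 10\sigma_0^{-1}$$ and also $$\sum_{\substack{d\le Q^2\\ p\mid d\Rightarrow p\in\mathcal{P}_0^*}}\mu^2(d)\,\tau_3(d)^{1+(\log K)/(\log 3)}\max_{(a,d)=1}\left|\#\{s\in\mathcal{S}: s\equiv a \bmod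 d\}-\frac{\#\mathcal{S}}{\phi(d)}\right|\ \le\ \frac{\#\mathcal{S}}{2K\sigma_0^{-1}}.$$ Then, if there is a decomposition $\mathcal{S}_0=\mathcal{A}+\mathcal{B}$ for some sets $\mathcal{A},\mathcal{B}$ of non-negative integers with $2\le\#\mathcal{A}\le\#\mathcal{B}$, one has the upper bound $$\#\mathcal{B}\ll\frac{\sqrt{x}\,(\log x)^4}{c^4},$$ and therefore also the lower bound $$\#\mathcal{A}\gg\frac{\sqrt{x}\,\sigma_0\,\sigma\,c^4}{(\log x)^4}.$$ The implied constants are absolute.
   Context: Here $p$ always denotes a prime, $q$ and $d$ denote positive integers, $\mu$ is the Möbius function, $\phi$ is Euler's totient function, and $\tau_3(d):=\#\{(u,v,w)\in\mathbb{N}^3: uvw=d\}$. The sumset is $\mathcal{A}+\mathcal{B}:=\{a+b: a\in\mathcal{A}, b\in\mathcal{B}\}$. *)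

theory Defs
  imports
    Complex_Main
    "HOL-Library.Set_Algebras"
    "HOL-Computational_Algebra.Squarefree"
    "HOL-Number_Theory.Number_Theory"
begin

definition moebius_mu :: "nat \<Rightarrow> int" where
  "moebius_mu n = (if squarefree n then (- 1) ^ card (prime_factors n) else 0)"

definition tau3 :: "nat \<Rightarrow> nat" where
  "tau3 d = card {(u, v, w). u > 0 \<and> v > 0 \<and> w > 0 \<and> u * v * w = d}"

definition composed_of :: "nat set \<Rightarrow> nat \<Rightarrow> bool" where
  "composed_of P q \<longleftrightarrow> (\<forall>p. prime p \<and> p dvd q \<longrightarrow> p \<in> P)"

definition dyadic_log_sum :: "nat set \<Rightarrow> real \<Rightarrow> real" where
  "dyadic_log_sum P y = (\<Sum>p | prime p \<and> p \<in> P \<and> y / 2 < real p \<and> real p \<le> y. ln (real p))"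

text \<open>
  The count of \<open>s \<in> S\<close> with \<open>s \<equiv> a\<close> modulo \<open>d\<close> depends only on the residue class of \<open>a\<close>, so the
  maximum over all \<open>a\<close> coprime to \<open>d\<close> is taken over the representatives \<open>totatives d\<close>
  (nonempty for \<open>d \<ge> 1\<close>; for \<open>d = 1\<close> this is \<open>{1}\<close>).
\<close>

definition max_discrepancy :: "nat set \<Rightarrow> nat \<Rightarrow> real" where
  "max_discrepancy S d =
     Max ((\<lambda>a. \<bar>real (card {s \<in> S. [s = a] (mod d)}) - real (card S) / real (totient d)\<bar>) ` totatives d)"

definition sieve_controls_size :: "real \<Rightarrow> nat set \<Rightarrow> real \<Rightarrow> real \<Rightarrow> bool" where
  "sieve_controls_size x P \<sigma> \<sigma>0 \<longleftrightarrow>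
     (\<Sum>q | 1 < q \<and> real q \<le> sqrt x \<and> composed_of P q.
        (real_of_int (moebius_mu q))\<^sup>2 * (\<Prod>p\<in>prime_factors q. 2 / real p))
     \<ge> 10 * inverse (\<sigma>0 * \<sigma>)"

definition bombieri_vinogradov :: "nat set \<Rightarrow> nat set \<Rightarrow> real \<Rightarrow> real \<Rightarrow> bool" where
  "bombieri_vinogradov S P \<sigma>0 K \<longleftrightarrow>
     (\<exists>Q::nat. Q > 0 \<and>
        (\<Sum>q | 1 < q \<and> q \<le> Q \<and> composed_of P q. (real_of_int (moebius_mu q))\<^sup>2 / real q)
          \<ge> 10 * inverse \<sigma>0 \<and>
        (\<Sum>d | 1 \<le> d \<and> d \<le> Q\<^sup>2 \<and> composed_of P d.
            (real_of_int (moebius_mu d))\<^sup>2 * real (tau3 d) powr (1 + ln K / ln 3)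
              * max_discrepancy S d)
          \<le> real (card S) / (2 * K * inverse \<sigma>0))"

end

theory Submission imports Defs begin

text \<open>
  Modulo every \<open>p \<in> P0\<close> the residues of \<open>A\<close> and \<open>-B\<close> are disjoint. If \<open>A\<close> has at most \<open>K\<close>
  elements, they are distinct modulo all but few of the primes \<open>p \<ge> K\<^sup>3\<close>, so \<open>B\<close> avoids \<open>card A\<close>
  classes modulo each of these (one of them already avoided by \<open>S\<close>). The large sieve, when the sieve
  controls the size, or Selberg's sieve on \<open>S\<close>, in the Bombieri--Vinogradov case, then gives
  \<open>card A * card B < card S0\<close>, which is absurd. Hence \<open>card A > K\<close>.

  Let now \<open>y\<close> be about \<open>x\<close> to the power \<open>1/4\<close>. Gallagher's larger sieve shows that \<open>A\<close> occupies on
  average many residues modulo the \<open>p \<in> P0\<close> near \<open>y\<close>: with \<open>n = card A\<close>, the mean proportion is at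
  least a constant times the minimum of \<open>n / y\<close> and \<open>c / ln x\<close>. The large sieve for \<open>B\<close>, with moduli
  \<open>p q\<close> where \<open>p\<close> and \<open>q\<close> lie in two adjacent dyadic ranges, then either bounds \<open>card B\<close> as claimed or
  contradicts \<open>card A * card B \<ge> card S0\<close>; it is the assumption \<open>card A > K\<close> that excludes the latter.
\<close>

section \<open>Selberg's sieve\<close>

text \<open>The shape of the bound comes from one inequality. Let \<open>n = card A\<close>, and let
  \<open>V\<close> be the sum of \<open>\<nu> / (p - \<nu>)\<close> over a dyadic range of primes,
  \<open>\<nu>\<close> being the number of residues of \<open>A\<close> modulo \<open>p\<close>. Up
  to constants, \<open>V\<close> is at least the minimum of \<open>c * n / ln x\<close> and
  \<open>c\<^sup>2 * y / (ln x)\<^sup>2\<close>. With single primes as moduli, the first alternative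
  would only bound \<open>card A * card B\<close> by a multiple of \<open>x * ln x / c\<close>,
  which contradicts nothing. Two prime factors make the sieve quadratic in \<open>V\<close>: the
  first alternative then forces \<open>n\<close> below a multiple of
  \<open>(ln x)\<^sup>2 / (\<sigma>0 * \<sigma> * c\<^sup>2)\<close>, which is the origin of
  \<open>K\<close>, and the second bounds \<open>card B\<close> by about
  \<open>x / V\<^sup>2\<close>, whence the fourth powers of \<open>ln x\<close> and
  \<open>c\<close>. The large sieve affords moduli up to \<open>sqrt x\<close>, so each prime has
  size about the fourth root of \<open>x\<close>. Summands with \<open>n <= K\<close> need a
  separate treatment, because the larger sieve says too little about such sparse sets; in exchange,
  their elements rarely collide, so \<open>\<nu>\<close> is known exactly.\<close>

text \<open>Moebius inversion on the subset lattice: once \<open>l\<close> is split off, the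
  alternating sum expands a product of factors \<open>- 1 + 1\<close>, which vanishes unless it is
  empty.\<close>

lemma sum_signs_between:
  assumes "finite q" "l \<subseteq> q"
  shows "(\<Sum>d | l \<subseteq> d \<and> d \<subseteq> q. (- 1) ^ card d) = (if l = q then (- 1) ^ card l else (0::real))"
proof -
  have "(\<Sum>d | l \<subseteq> d \<and> d \<subseteq> q. (- 1) ^ card d) = (\<Sum>e\<in>Pow (q - l). (- 1) ^ card l * (- 1::real) ^ card e)"
  proof (rule sum.reindex_bij_witness[where i = "\<lambda>e. l \<union> e" and j = "\<lambda>d. d - l"])
    fix d assume "d \<in> {d. l \<subseteq> d \<and> d \<subseteq> q}"
    then have d: "l \<subseteq> d" "finite d" "finite l" using assms finite_subset by auto
    then have "card d = card l + card (d - l)"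
      by (simp add: card_Diff_subset card_mono)
    then show "(- 1) ^ card l * (- 1::real) ^ card (d - l) = (- 1) ^ card d"
      by (simp add: power_add)
  qed (use assms in \<open>auto simp: Diff_eq\<close>)
  also have "\<dots> = (- 1) ^ card l * (\<Prod>p\<in>q - l. - 1 + 1)"
    using assms by (subst prod_add) (auto simp: sum_distrib_left)
  also have "\<dots> = (if l = q then (- 1) ^ card l else 0)"
    using assms by (auto simp: card_gt_0_iff)
  finally show ?thesis .
qed

lemma sum_rotate:
  "(\<Sum>d\<in>A. \<Sum>e\<in>B. \<Sum>l\<in>C. f d e l) = (\<Sum>l\<in>C. \<Sum>d\<in>A. \<Sum>e\<in>B. f d e l)"
proof -
  have "(\<Sum>d\<in>A. \<Sum>e\<in>B. \<Sum>l\<in>C. f d e l) = (\<Sum>d\<in>A. \<Sum>l\<in>C. \<Sum>e\<in>B. f d e l)"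
    by (intro sum.cong refl sum.swap)
  also have "\<dots> = (\<Sum>l\<in>C. \<Sum>d\<in>A. \<Sum>e\<in>B. f d e l)"
    by (rule sum.swap)
  finally show ?thesis .
qed

text \<open>Squarefree moduli are modelled as finite sets of primes: divisibility becomes inclusion,
  the least common multiple becomes union, and the Moebius sign becomes
  \<open>(- 1) ^ card d\<close>.\<close>

locale selberg_sieve =
  fixes D :: "'a set set" and h :: "'a \<Rightarrow> real"
  assumes finite_D: "finite D"
    and finite_mem: "T \<in> D \<Longrightarrow> finite T"
    and down_closed: "T \<in> D \<Longrightarrow> T' \<subseteq> T \<Longrightarrow> T' \<in> D"
    and h_pos: "T \<in> D \<Longrightarrow> p \<in> T \<Longrightarrow> h p > 0"
begin

definition total :: real where
  "total = (\<Sum>q\<in>D. \<Prod>p\<in>q. h p)"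

text \<open>Up to the factor \<open>total\<close>, these are Selberg's optimal coefficients, which
  minimise the form of \<open>quadratic_form_weight\<close> for a fixed value at \<open>{}\<close>.
  The scaling avoids a division and makes that value \<open>total\<close>.\<close>

definition weight :: "'a set \<Rightarrow> real" where
  "weight d = (- 1) ^ card d * (\<Sum>q | q \<in> D \<and> d \<subseteq> q. (\<Prod>p\<in>d. 1 + h p) * (\<Prod>p\<in>q - d. h p))"

text \<open>The expected proportion of elements caught by \<open>p\<close>; \<open>h p\<close> is
  the corresponding odds \<open>density p / (1 - density p)\<close>.\<close>

definition density :: "'a \<Rightarrow> real" where
  "density p = h p / (1 + h p)"

lemma prod_h_pos: "T \<in> D \<Longrightarrow> T' \<subseteq> T \<Longrightarrow> (\<Prod>p\<in>T'. h p) > 0"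
  using h_pos by (intro prod_pos) auto

lemma weight_empty: "weight {} = total"
  by (simp add: weight_def total_def)

text \<open>
  Expanding \<open>\<Prod>p\<in>d. 1 + h p\<close> over subsets \<open>l\<close> of \<open>d\<close>, the pair \<open>(l, q)\<close> contributes the term of
  \<open>total\<close> indexed by \<open>l \<union> (q - d)\<close>, and distinct pairs give distinct index sets.
\<close>
lemma abs_weight_le:
  assumes "d \<in> D"
  shows "\<bar>weight d\<bar> \<le> total"
proof -
  let ?I = "Pow d \<times> {q \<in> D. d \<subseteq> q}"
  let ?m = "\<lambda>(l, q). l \<union> (q - d)"
  have fd: "finite d" using assms finite_mem by auto
  have term_nonneg: "(\<Prod>p\<in>q. h p) \<ge> 0" if "q \<in> D" for q
    using prod_h_pos[OF that, of q] by simp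
  have inj: "inj_on ?m ?I"
  proof (rule inj_onI, clarify)
    fix l q l' q'
    assume *: "l \<subseteq> d" "l' \<subseteq> d" "d \<subseteq> q" "d \<subseteq> q'" "l \<union> (q - d) = l' \<union> (q' - d)"
    from * have "l = l'" by blast
    moreover from * have "q = q'" by blast
    ultimately show "l = l' \<and> q = q'" by blast
  qed
  have img: "?m ` ?I \<subseteq> D"
  proof clarsimp
    fix l q assume "l \<subseteq> d" "q \<in> D" "d \<subseteq> q"
    then show "l \<union> (q - d) \<in> D" using down_closed[of q "l \<union> (q - d)"] by auto
  qed
  have "0 \<le> (\<Sum>q | q \<in> D \<and> d \<subseteq> q. (\<Prod>p\<in>d. 1 + h p) * (\<Prod>p\<in>q - d. h p))"
  proof (intro sum_nonneg mult_nonneg_nonneg)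
    show "0 \<le> (\<Prod>p\<in>d. 1 + h p)"
      using h_pos[OF assms] by (intro prod_nonneg) (simp add: add_nonneg_nonneg less_imp_le)
    show "0 \<le> (\<Prod>p\<in>q - d. h p)" if "q \<in> {q. q \<in> D \<and> d \<subseteq> q}" for q
      using prod_h_pos[of q "q - d"] that by auto
  qed
  then have "\<bar>weight d\<bar> = (\<Sum>q | q \<in> D \<and> d \<subseteq> q. (\<Prod>p\<in>d. 1 + h p) * (\<Prod>p\<in>q - d. h p))"
    by (simp add: weight_def abs_mult power_abs)
  also have "\<dots> = (\<Sum>q | q \<in> D \<and> d \<subseteq> q. \<Sum>l\<in>Pow d. (\<Prod>p\<in>l. h p) * (\<Prod>p\<in>q - d. h p))"
    using prod_add[OF fd, of h "\<lambda>_. 1"] by (simp add: sum_distrib_right add.commute)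
  also have "\<dots> = (\<Sum>(l, q)\<in>?I. (\<Prod>p\<in>l. h p) * (\<Prod>p\<in>q - d. h p))"
    by (subst sum.swap) (simp add: sum.cartesian_product)
  also have "\<dots> = (\<Sum>t\<in>?I. \<Prod>p\<in>?m t. h p)"
  proof (rule sum.cong[OF refl], clarify)
    fix l q assume "l \<subseteq> d" "q \<in> D" "d \<subseteq> q"
    then show "(\<Prod>p\<in>l. h p) * (\<Prod>p\<in>q - d. h p) = (\<Prod>p\<in>l \<union> (q - d). h p)"
      using fd finite_mem by (intro prod.union_disjoint[symmetric]) (auto intro: finite_subset)
  qed
  also have "\<dots> = (\<Sum>q\<in>?m ` ?I. \<Prod>p\<in>q. h p)"
    using inj by (subst sum.reindex) auto
  also have "\<dots> \<le> total"
    unfolding total_def using img finite_D term_nonneg by (intro sum_mono2) auto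
  finally show ?thesis .
qed

lemma prod_inverse_density:
  assumes "T \<in> D" "T' \<subseteq> T"
  shows "(\<Prod>p\<in>T'. inverse (density p)) = (\<Sum>l\<in>Pow T'. \<Prod>p\<in>l. inverse (h p))"
proof -
  have "(\<Prod>p\<in>T'. inverse (density p)) = (\<Prod>p\<in>T'. inverse (h p) + 1)"
  proof (rule prod.cong[OF refl])
    fix p assume "p \<in> T'"
    then have "h p > 0" using assms h_pos by blast
    then show "inverse (density p) = inverse (h p) + 1"
      by (simp add: density_def field_simps)
  qed
  also have "\<dots> = (\<Sum>l\<in>Pow T'. \<Prod>p\<in>l. inverse (h p))"
    using assms finite_mem by (subst prod_add) (auto intro: finite_subset)
  finally show ?thesis .
qed

text \<open>The union couples \<open>d\<close> and \<open>e\<close> only through their intersection.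
  Expanding the inverse density there over common subsets \<open>l\<close> leaves, for each
  \<open>l\<close>, a factor depending on \<open>d\<close> times one depending on \<open>e\<close>;
  this diagonalises the quadratic form.\<close>

lemma prod_density_union:
  assumes "d \<in> D" "e \<in> D"
  shows "(\<Prod>p\<in>d \<union> e. density p) =
    (\<Prod>p\<in>d. density p) * (\<Prod>p\<in>e. density p) * (\<Sum>l\<in>Pow (d \<inter> e). \<Prod>p\<in>l. inverse (h p))"
proof -
  have fin: "finite d" "finite e" using assms finite_mem by auto
  have nz: "density p \<noteq> 0" if "p \<in> d" for p
    using h_pos[OF assms(1) that] by (simp add: density_def)
  have "(\<Prod>p\<in>d \<union> e. density p) * (\<Prod>p\<in>d \<inter> e. density p) = (\<Prod>p\<in>d. density p) * (\<Prod>p\<in>e. density p)"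
    using fin by (rule prod.union_inter)
  moreover have "(\<Prod>p\<in>d \<inter> e. density p) * (\<Prod>p\<in>d \<inter> e. inverse (density p)) = 1"
    using nz by (simp add: prod.distrib[symmetric])
  ultimately have "(\<Prod>p\<in>d \<union> e. density p) =
      (\<Prod>p\<in>d. density p) * (\<Prod>p\<in>e. density p) * (\<Prod>p\<in>d \<inter> e. inverse (density p))"
    by (metis mult.assoc mult.right_neutral)
  then show ?thesis using prod_inverse_density[of d "d \<inter> e"] assms by simp
qed

text \<open>These are the diagonal variables of the quadratic form. Unfolding \<open>weight\<close>
  and swapping sums leaves, for each \<open>q\<close>, an alternating sum over \<open>d\<close>
  between \<open>l\<close> and \<open>q\<close>, so only \<open>q = l\<close> survives.\<close>

lemma sum_weight_density:
  assumes "l \<in> D"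
  shows "(\<Sum>d | d \<in> D \<and> l \<subseteq> d. weight d * (\<Prod>p\<in>d. density p)) = (- 1) ^ card l * (\<Prod>p\<in>l. h p)"
proof -
  have "(\<Sum>d | d \<in> D \<and> l \<subseteq> d. weight d * (\<Prod>p\<in>d. density p)) =
    (\<Sum>d | d \<in> D \<and> l \<subseteq> d. \<Sum>q | q \<in> D \<and> d \<subseteq> q. (- 1) ^ card d * (\<Prod>p\<in>q. h p))"
  proof (rule sum.cong[OF refl])
    fix d assume d: "d \<in> {d \<in> D. l \<subseteq> d}"
    have e: "(\<Prod>p\<in>d. 1 + h p) * (\<Prod>p\<in>q - d. h p) * (\<Prod>p\<in>d. density p) = (\<Prod>p\<in>q. h p)"
      if "q \<in> D" "d \<subseteq> q" for q
    proof -
      have "(\<Prod>p\<in>d. 1 + h p) * (\<Prod>p\<in>d. density p) = (\<Prod>p\<in>d. h p)"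
      proof (subst prod.distrib[symmetric], rule prod.cong[OF refl])
        fix p assume "p \<in> d"
        then have "h p > 0" using that h_pos by blast
        then show "(1 + h p) * density p = h p" by (simp add: density_def)
      qed
      moreover have "(\<Prod>p\<in>q - d. h p) * (\<Prod>p\<in>d. h p) = (\<Prod>p\<in>q. h p)"
        using that finite_mem by (subst prod.subset_diff[of d q]) auto
      ultimately show ?thesis by (metis mult.assoc mult.commute)
    qed
    show "weight d * (\<Prod>p\<in>d. density p) = (\<Sum>q | q \<in> D \<and> d \<subseteq> q. (- 1) ^ card d * (\<Prod>p\<in>q. h p))"
      unfolding weight_def sum_distrib_left sum_distrib_right
    proof (rule sum.cong[OF refl])
      fix q assume "q \<in> {q \<in> D. d \<subseteq> q}"
      then have "q \<in> D" "d \<subseteq> q" by auto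
      from e[OF this] show "(- 1) ^ card d * ((\<Prod>p\<in>d. 1 + h p) * (\<Prod>p\<in>q - d. h p)) * (\<Prod>p\<in>d. density p) =
          (- 1) ^ card d * (\<Prod>p\<in>q. h p)"
        by (simp add: mult.assoc)
    qed
  qed
  also have "\<dots> = (\<Sum>d\<in>D. \<Sum>q\<in>D. of_bool (l \<subseteq> d \<and> d \<subseteq> q) * ((- 1) ^ card d * (\<Prod>p\<in>q. h p)))"
  proof -
    have "(\<Sum>q | q \<in> D \<and> d \<subseteq> q. (- 1) ^ card d * (\<Prod>p\<in>q. h p)) =
        (\<Sum>q\<in>D. of_bool (d \<subseteq> q) * ((- 1) ^ card d * (\<Prod>p\<in>q. h p)))" for d
      using finite_D by (intro sum.mono_neutral_cong_left) auto
    then have "(\<Sum>d | d \<in> D \<and> l \<subseteq> d. \<Sum>q | q \<in> D \<and> d \<subseteq> q. (- 1) ^ card d * (\<Prod>p\<in>q. h p)) =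
        (\<Sum>d | d \<in> D \<and> l \<subseteq> d. \<Sum>q\<in>D. of_bool (d \<subseteq> q) * ((- 1) ^ card d * (\<Prod>p\<in>q. h p)))"
      by simp
    also have "\<dots> = (\<Sum>d\<in>D. \<Sum>q\<in>D. of_bool (l \<subseteq> d \<and> d \<subseteq> q) * ((- 1) ^ card d * (\<Prod>p\<in>q. h p)))"
      using finite_D by (intro sum.mono_neutral_cong_left) auto
    finally show ?thesis .
  qed
  also have "\<dots> = (\<Sum>q\<in>D. (\<Sum>d\<in>D. of_bool (l \<subseteq> d \<and> d \<subseteq> q) * (- 1) ^ card d) * (\<Prod>p\<in>q. h p))"
    by (subst sum.swap) (simp add: sum_distrib_right mult.assoc)
  also have "\<dots> = (\<Sum>q\<in>D. (if l = q then (- 1) ^ card l * (\<Prod>p\<in>q. h p) else 0))"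
  proof (rule sum.cong[OF refl])
    fix q assume q: "q \<in> D"
    have "(\<Sum>d\<in>D. of_bool (l \<subseteq> d \<and> d \<subseteq> q) * (- 1) ^ card d) = (\<Sum>d | l \<subseteq> d \<and> d \<subseteq> q. (- 1::real) ^ card d)"
      using finite_D down_closed[OF q] by (intro sum.mono_neutral_cong_right) auto
    also have "\<dots> = (if l = q then (- 1) ^ card l else 0)"
    proof (cases "l \<subseteq> q")
      case True
      then show ?thesis using sum_signs_between[of q l] finite_mem q by auto
    next
      case False
      then have e: "{d. l \<subseteq> d \<and> d \<subseteq> q} = {}" and ne: "l \<noteq> q" by auto
      show ?thesis unfolding e using ne by simp
    qed
    finally show "(\<Sum>d\<in>D. of_bool (l \<subseteq> d \<and> d \<subseteq> q) * (- 1) ^ card d) * (\<Prod>p\<in>q. h p) =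
        (if l = q then (- 1) ^ card l * (\<Prod>p\<in>q. h p) else 0)" by simp
  qed
  also have "\<dots> = (- 1) ^ card l * (\<Prod>p\<in>l. h p)"
    using assms finite_D by simp
  finally show ?thesis .
qed

text \<open>By \<open>prod_density_union\<close> the form is a sum over \<open>l\<close> of squared
  diagonal variables, each divided by the product of \<open>h\<close> over \<open>l\<close>. Each
  square is that product squared, so one copy remains.\<close>

lemma quadratic_form_weight:
  "(\<Sum>d\<in>D. \<Sum>e\<in>D. weight d * weight e * (\<Prod>p\<in>d \<union> e. density p)) = total"
proof -
  let ?g = "\<lambda>d. \<Prod>p\<in>d. density p"
  have "(\<Sum>d\<in>D. \<Sum>e\<in>D. weight d * weight e * ?g (d \<union> e)) =
    (\<Sum>d\<in>D. \<Sum>e\<in>D. \<Sum>l\<in>D. of_bool (l \<subseteq> d) * of_bool (l \<subseteq> e) *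
       ((weight d * ?g d) * (weight e * ?g e) * (\<Prod>p\<in>l. inverse (h p))))"
  proof (intro sum.cong refl)
    fix d e assume de: "d \<in> D" "e \<in> D"
    have "(\<Sum>l\<in>Pow (d \<inter> e). \<Prod>p\<in>l. inverse (h p)) =
        (\<Sum>l\<in>D. of_bool (l \<subseteq> d) * of_bool (l \<subseteq> e) * (\<Prod>p\<in>l. inverse (h p)))"
      using finite_D down_closed[OF de(1)] by (intro sum.mono_neutral_cong_left) auto
    then show "weight d * weight e * ?g (d \<union> e) =
      (\<Sum>l\<in>D. of_bool (l \<subseteq> d) * of_bool (l \<subseteq> e) *
       ((weight d * ?g d) * (weight e * ?g e) * (\<Prod>p\<in>l. inverse (h p))))"
      by (simp add: prod_density_union[OF de] sum_distrib_left mult_ac)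
  qed
  also have "\<dots> = (\<Sum>l\<in>D. \<Sum>d\<in>D. \<Sum>e\<in>D. of_bool (l \<subseteq> d) * of_bool (l \<subseteq> e) *
       ((weight d * ?g d) * (weight e * ?g e) * (\<Prod>p\<in>l. inverse (h p))))"
    by (rule sum_rotate)
  also have "\<dots> = (\<Sum>l\<in>D. (\<Prod>p\<in>l. inverse (h p)) * (\<Sum>d\<in>D. of_bool (l \<subseteq> d) * (weight d * ?g d))\<^sup>2)"
    by (simp add: power2_eq_square sum_product sum_distrib_left mult_ac)
  also have "\<dots> = (\<Sum>l\<in>D. \<Prod>p\<in>l. h p)"
  proof (rule sum.cong[OF refl])
    fix l assume l: "l \<in> D"
    have "(\<Sum>d\<in>D. of_bool (l \<subseteq> d) * (weight d * ?g d)) = (\<Sum>d | d \<in> D \<and> l \<subseteq> d. weight d * ?g d)"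
      using finite_D by (intro sum.mono_neutral_cong_right) auto
    also have "\<dots> = (- 1) ^ card l * (\<Prod>p\<in>l. h p)" by (rule sum_weight_density[OF l])
    finally show "(\<Prod>p\<in>l. inverse (h p)) * (\<Sum>d\<in>D. of_bool (l \<subseteq> d) * (weight d * ?g d))\<^sup>2 = (\<Prod>p\<in>l. h p)"
      using prod_h_pos[OF l subset_refl] prod_inversef[of h l]
      by (simp add: power_mult_distrib power2_eq_square comp_def field_simps flip: power_add)
  qed
  finally show ?thesis by (simp add: total_def)
qed

text \<open>The square of \<open>F\<close> is the majorant: on \<open>S'\<close> only
  \<open>d = {}\<close> contributes, so \<open>F\<close> equals \<open>total\<close> there, while
  over all of \<open>S\<close> the squares sum to \<open>X\<close> times the quadratic form plus
  remainders. As the weights are bounded by \<open>total\<close>, division by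
  \<open>total\<^sup>2\<close> leaves the remainders with coefficient one.\<close>

theorem card_unsifted_le:
  fixes S :: "'b set" and E :: "'a \<Rightarrow> 'b set" and X :: real
  assumes "finite S" "{} \<in> D"
  defines "R \<equiv> \<lambda>d. real (card {s \<in> S. \<forall>p\<in>d. s \<in> E p}) - X * (\<Prod>p\<in>d. density p)"
  assumes "S' \<subseteq> S" and unsifted: "\<And>s T p. s \<in> S' \<Longrightarrow> T \<in> D \<Longrightarrow> p \<in> T \<Longrightarrow> s \<notin> E p"
  shows "real (card S') \<le> X / total + (\<Sum>d\<in>D. \<Sum>e\<in>D. \<bar>R (d \<union> e)\<bar>)"
proof -
  define F where "F s = (\<Sum>d\<in>D. weight d * of_bool (\<forall>p\<in>d. s \<in> E p))" for s
  have card_Int: "(\<Sum>s\<in>S. of_bool (P s)) = real (card {s \<in> S. P s})" for P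
    using assms(1) by (simp add: Int_def)
  have total_pos: "total > 0"
    unfolding total_def using prod_h_pos assms(2) finite_D by (intro sum_pos) auto
  have F_unsifted: "F s = total" if "s \<in> S'" for s
  proof -
    have "F s = (\<Sum>d\<in>D. if d = {} then total else 0)"
      unfolding F_def using unsifted[OF that] by (intro sum.cong) (auto simp: weight_empty)
    then show ?thesis using finite_D assms(2) by simp
  qed
  have "total\<^sup>2 * real (card S') = (\<Sum>s\<in>S'. (F s)\<^sup>2)"
    by (simp add: F_unsifted)
  also have "\<dots> \<le> (\<Sum>s\<in>S. (F s)\<^sup>2)"
    using assms by (intro sum_mono2) auto
  also have "\<dots> = (\<Sum>s\<in>S. \<Sum>d\<in>D. \<Sum>e\<in>D. weight d * weight e * of_bool (\<forall>p\<in>d \<union> e. s \<in> E p))"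
    unfolding F_def power2_eq_square sum_product
    by (intro sum.cong refl) (simp add: ball_Un)
  also have "\<dots> = (\<Sum>d\<in>D. \<Sum>e\<in>D. weight d * weight e * real (card {s \<in> S. \<forall>p\<in>d \<union> e. s \<in> E p}))"
    by (subst sum_rotate[symmetric]) (simp add: assms(1) card_Int sum_distrib_left[symmetric])
  also have "\<dots> = X * (\<Sum>d\<in>D. \<Sum>e\<in>D. weight d * weight e * (\<Prod>p\<in>d \<union> e. density p)) +
      (\<Sum>d\<in>D. \<Sum>e\<in>D. weight d * weight e * R (d \<union> e))"
    by (simp add: R_def sum_distrib_left algebra_simps sum_subtractf)
  also have "\<dots> \<le> X * total + (\<Sum>d\<in>D. \<Sum>e\<in>D. total\<^sup>2 * \<bar>R (d \<union> e)\<bar>)"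
    unfolding quadratic_form_weight
  proof (intro add_left_mono sum_mono)
    fix d e assume "d \<in> D" "e \<in> D"
    then have "\<bar>weight d\<bar> * \<bar>weight e\<bar> \<le> total\<^sup>2"
      unfolding power2_eq_square using abs_weight_le total_pos by (intro mult_mono) auto
    then have "\<bar>weight d * weight e\<bar> * \<bar>R (d \<union> e)\<bar> \<le> total\<^sup>2 * \<bar>R (d \<union> e)\<bar>"
      by (intro mult_right_mono) (auto simp: abs_mult)
    moreover have "weight d * weight e * R (d \<union> e) \<le> \<bar>weight d * weight e\<bar> * \<bar>R (d \<union> e)\<bar>"
      by (metis abs_ge_self abs_mult)
    ultimately show "weight d * weight e * R (d \<union> e) \<le> total\<^sup>2 * \<bar>R (d \<union> e)\<bar>"
      by linarith
  qed
  also have "\<dots> = total\<^sup>2 * (X / total + (\<Sum>d\<in>D. \<Sum>e\<in>D. \<bar>R (d \<union> e)\<bar>))"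
    using total_pos by (simp add: sum_distrib_left power2_eq_square field_simps)
  finally show ?thesis using total_pos by simp
qed

end

section \<open>The large sieve\<close>

text \<open>Jordan's inequality. The chord meets the sine at both ends; if the sine fell below it at
  \<open>t\<close>, the mean value theorem would give the difference a negative slope somewhere
  before \<open>t\<close> and a positive one after, although the cosine decreases.\<close>

lemma sin_ge_chord:
  fixes t :: real
  assumes "0 \<le> t" "t \<le> pi / 2"
  shows "sin t \<ge> 2 / pi * t"
proof (rule ccontr)
  assume neg: "\<not> ?thesis"
  define g where "g s = sin s - 2 / pi * s" for s :: real
  have deriv: "(g has_real_derivative cos s - 2 / pi) (at s)" for s
    unfolding g_def by (auto intro!: derivative_eq_intros)
  have "t \<noteq> 0" using neg by auto
  moreover have "t \<noteq> pi / 2" 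
  proof
    assume "t = pi / 2"
    with neg have "\<not> 2 / pi * (pi / 2) \<le> sin (pi / 2)" by (simp only: not_False_eq_True)
    then show False by simp
  qed
  ultimately have t: "0 < t" "t < pi / 2" using assms by auto
  obtain r where r: "0 < r" "r < t" "g t - g 0 = (t - 0) * (cos r - 2 / pi)"
    using MVT2[OF t(1), of g "\<lambda>s. cos s - 2 / pi"] deriv by blast
  obtain s where s: "t < s" "s < pi / 2" "g (pi / 2) - g t = (pi / 2 - t) * (cos s - 2 / pi)"
    using MVT2[OF t(2), of g "\<lambda>s. cos s - 2 / pi"] deriv by blast
  have "g t < 0" "g 0 = 0" "g (pi / 2) = 0" using neg by (auto simp: g_def)
  then have "t * (cos r - 2 / pi) < 0" "(pi / 2 - t) * (cos s - 2 / pi) > 0"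
    using r(3) s(3) by auto
  then have "cos r < cos s" using t by (auto simp: mult_less_0_iff zero_less_mult_iff)
  moreover have "cos s < cos r" using r s t by (intro cos_monotone_0_pi) auto
  ultimately show False by simp
qed

lemma norm_cis_minus_1_ge:
  assumes "\<bar>\<theta>\<bar> \<le> 1 / 2"
  shows "norm (cis (2 * pi * \<theta>) - 1) \<ge> 4 * \<bar>\<theta>\<bar>"
proof -
  have "(norm (cis (2 * pi * \<theta>) - 1))\<^sup>2 = (2 * sin (pi * \<bar>\<theta>\<bar>))\<^sup>2"
  proof -
    have "(norm (cis (2 * pi * \<theta>) - 1))\<^sup>2 = (cos (2 * (pi * \<theta>)) - 1)\<^sup>2 + (sin (2 * (pi * \<theta>)))\<^sup>2"
      by (simp add: cmod_power2 mult.assoc)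
    also have "\<dots> = 2 - 2 * cos (2 * (pi * \<theta>))"
      using sin_cos_squared_add[of "2 * (pi * \<theta>)"] by (simp add: power2_eq_square algebra_simps)
    also have "\<dots> = (2 * sin (pi * \<theta>))\<^sup>2"
      by (simp add: cos_double_sin power_mult_distrib)
    also have "\<dots> = (2 * sin (pi * \<bar>\<theta>\<bar>))\<^sup>2" by (auto simp: abs_if)
    finally show ?thesis .
  qed
  moreover have "2 / pi * (pi * \<bar>\<theta>\<bar>) \<le> sin (pi * \<bar>\<theta>\<bar>)"
  proof (rule sin_ge_chord)
    show "pi * \<bar>\<theta>\<bar> \<le> pi / 2"
      using mult_left_mono[OF assms, of pi] by simp
  qed simp
  then have s: "2 * \<bar>\<theta>\<bar> \<le> sin (pi * \<bar>\<theta>\<bar>)" by simp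
  ultimately have "norm (cis (2 * pi * \<theta>) - 1) = 2 * sin (pi * \<bar>\<theta>\<bar>)"
    by (smt (verit) norm_ge_zero power2_eq_imp_eq abs_ge_zero)
  then show ?thesis using s by simp
qed

lemma norm_geometric_cis_le:
  assumes "\<bar>\<theta>\<bar> \<le> 1 / 2" "\<theta> \<noteq> 0"
  shows "norm (\<Sum>u<M. cis (2 * pi * \<theta> * real u)) \<le> 1 / (2 * \<bar>\<theta>\<bar>)"
proof -
  let ?z = "cis (2 * pi * \<theta>)"
  have z: "norm (?z - 1) \<ge> 4 * \<bar>\<theta>\<bar>" by (rule norm_cis_minus_1_ge[OF assms(1)])
  then have "?z \<noteq> 1" using assms(2) by auto
  have "(\<Sum>u<M. cis (2 * pi * \<theta> * real u)) = (\<Sum>u<M. ?z ^ u)"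
    by (simp add: DeMoivre mult.commute)
  also have "\<dots> = (?z ^ M - 1) / (?z - 1)"
    using \<open>?z \<noteq> 1\<close> by (rule geometric_sum)
  finally have "norm (\<Sum>u<M. cis (2 * pi * \<theta> * real u)) = norm (?z ^ M - 1) / norm (?z - 1)"
    by (simp add: norm_divide)
  also have "\<dots> \<le> 2 / (4 * \<bar>\<theta>\<bar>)"
  proof (rule frac_le)
    show "norm (?z ^ M - 1) \<le> 2"
      using norm_triangle_ineq4[of "?z ^ M" 1] by (simp add: norm_power)
  qed (use z assms in auto)
  finally show ?thesis by simp
qed

lemma sum_inverse_squares_le:
  fixes K :: "nat set"
  assumes "finite K" "0 \<notin> K"
  shows "(\<Sum>k\<in>K. 1 / (real k)\<^sup>2) \<le> 2"
proof -
  \<comment> \<open>The subtracted \<open>1 / n\<close> is what lets the induction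
    telescope.\<close>
  have *: "(\<Sum>k=1..n. 1 / (real k)\<^sup>2) \<le> 2 - 1 / real n" if "n \<ge> 1" for n
    using that
  proof (induction n rule: dec_induct)
    case (step n)
    have "1 / (real (Suc n))\<^sup>2 \<le> 1 / real n - 1 / real (Suc n)"
    proof -
      have "1 / (real (Suc n))\<^sup>2 \<le> 1 / (real n * real (Suc n))"
        using step by (intro divide_left_mono) (auto simp: power2_eq_square)
      also have "\<dots> = 1 / real n - 1 / real (Suc n)"
        using step by (simp add: divide_simps)
      finally show ?thesis .
    qed
    then show ?case using step by simp
  qed simp
  obtain n where n: "K \<subseteq> {..n}" using assms(1) finite_nat_iff_bounded_le by blast
  have "K \<subseteq> {1..Suc n}"
  proof
    fix k assume "k \<in> K"
    then show "k \<in> {1..Suc n}" using n assms(2) by (cases k) auto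
  qed
  then have "(\<Sum>k\<in>K. 1 / (real k)\<^sup>2) \<le> (\<Sum>k=1..Suc n. 1 / (real k)\<^sup>2)"
    by (intro sum_mono2) auto
  also have "\<dots> \<le> 2 - 1 / real (Suc n)" by (rule *) simp
  also have "\<dots> \<le> 2" by simp
  finally show ?thesis .
qed

text \<open>Dividing by \<open>\<delta>\<close> and rounding down sends the points injectively to
  positive integers, since two points with the same integer part would be less than
  \<open>\<delta>\<close> apart.\<close>

lemma sum_inverse_squares_separated_le:
  fixes t :: "'a \<Rightarrow> real"
  assumes "finite T" "\<delta> > 0"
    and lower: "\<And>s. s \<in> T \<Longrightarrow> t s \<ge> \<delta>"
    and sep: "\<And>s s'. s \<in> T \<Longrightarrow> s' \<in> T \<Longrightarrow> s \<noteq> s' \<Longrightarrow> \<bar>t s - t s'\<bar> \<ge> \<delta>"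
  shows "(\<Sum>s\<in>T. 1 / (t s)\<^sup>2) \<le> 2 / \<delta>\<^sup>2"
proof -
  define k where "k s = nat \<lfloor>t s / \<delta>\<rfloor>" for s
  have k1: "k s \<ge> 1" if "s \<in> T" for s
    using lower[OF that] assms(2) by (simp add: k_def le_nat_iff le_floor_iff)
  have kle: "real (k s) \<le> t s / \<delta>" "t s / \<delta> < real (k s) + 1" if "s \<in> T" for s
    using lower[OF that] assms(2) by (auto simp: k_def)
  have inj: "inj_on k T"
  proof (rule inj_onI, rule ccontr)
    fix s s' assume *: "s \<in> T" "s' \<in> T" "k s = k s'" "s \<noteq> s'"
    have "\<bar>t s / \<delta> - t s' / \<delta>\<bar> < 1"
      using kle[OF *(1)] kle[OF *(2)] *(3) by linarith
    then have "\<bar>t s - t s'\<bar> < \<delta>"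
      using assms(2) by (simp add: field_simps flip: diff_divide_distrib)
    then show False using sep[OF *(1,2,4)] by simp
  qed
  have "(\<Sum>s\<in>T. 1 / (t s)\<^sup>2) \<le> (\<Sum>s\<in>T. 1 / \<delta>\<^sup>2 * (1 / (real (k s))\<^sup>2))"
  proof (rule sum_mono)
    fix s assume s: "s \<in> T"
    have "real (k s) * \<delta> \<le> t s" using kle(1)[OF s] assms(2) by (simp add: field_simps)
    then have "(real (k s) * \<delta>)\<^sup>2 \<le> (t s)\<^sup>2" using assms(2) by (intro power_mono) auto
    moreover have "real (k s) * \<delta> > 0" using k1[OF s] assms(2) by simp
    ultimately have "1 / (t s)\<^sup>2 \<le> 1 / (real (k s) * \<delta>)\<^sup>2"
      by (smt (verit) frac_le zero_less_power)
    then show "1 / (t s)\<^sup>2 \<le> 1 / \<delta>\<^sup>2 * (1 / (real (k s))\<^sup>2)"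
      by (simp add: power_mult_distrib mult.commute)
  qed
  also have "\<dots> = 1 / \<delta>\<^sup>2 * (\<Sum>j\<in>k ` T. 1 / (real j)\<^sup>2)"
    using inj by (simp add: sum.reindex sum_distrib_left)
  also have "\<dots> \<le> 1 / \<delta>\<^sup>2 * 2"
    using assms(1) k1 by (intro mult_left_mono sum_inverse_squares_le) (auto, fastforce)
  finally show ?thesis by simp
qed

definition fejer_sum :: "nat \<Rightarrow> real \<Rightarrow> real" where
  "fejer_sum M \<theta> = (norm (\<Sum>u<M. cis (2 * pi * \<theta> * real u)))\<^sup>2"

lemma fejer_sum_nonneg: "fejer_sum M \<theta> \<ge> 0"
  by (simp add: fejer_sum_def)

lemma cis_2pi_int: "cis (2 * pi * of_int k) = 1"
  by (metis cis_multiple_2pi Ints_of_int mult.commute mult.left_commute mult.assoc)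

lemma fejer_sum_shift: "fejer_sum M (\<theta> - of_int z) = fejer_sum M \<theta>"
proof -
  have "cis (2 * pi * (\<theta> - of_int z) * real u) = cis (2 * pi * \<theta> * real u)" for u
  proof -
    have "cis (2 * pi * (\<theta> - of_int z) * real u) =
        cis (2 * pi * \<theta> * real u) * cis (2 * pi * of_int (- (z * int u)))"
      by (simp add: cis_mult algebra_simps)
    then show ?thesis by (simp only: cis_2pi_int mult_1_right)
  qed
  then show ?thesis by (simp add: fejer_sum_def)
qed

lemma fejer_sum_uminus: "fejer_sum M (- \<theta>) = fejer_sum M \<theta>"
proof -
  have "(\<Sum>u<M. cis (2 * pi * - \<theta> * real u)) = cnj (\<Sum>u<M. cis (2 * pi * \<theta> * real u))"
    by (simp add: cis_cnj)
  then show ?thesis by (simp only: fejer_sum_def complex_mod_cnj)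
qed

lemma fejer_sum_0: "fejer_sum M 0 = (real M)\<^sup>2"
  by (simp add: fejer_sum_def)

lemma fejer_sum_le:
  assumes "\<bar>\<theta>\<bar> \<le> 1 / 2" "\<theta> \<noteq> 0"
  shows "fejer_sum M \<theta> \<le> 1 / 4 * (1 / \<theta>\<^sup>2)"
proof -
  have "fejer_sum M \<theta> \<le> (1 / (2 * \<bar>\<theta>\<bar>))\<^sup>2"
    unfolding fejer_sum_def by (intro power_mono norm_geometric_cis_le assms) auto
  then show ?thesis by (simp add: power_divide power_mult_distrib)
qed

lemma double_sum_cis:
  "(\<Sum>u<M. \<Sum>v<M. cis (2 * pi * \<theta> * (real u - real v))) = of_real (fejer_sum M \<theta>)"
proof -
  let ?s = "\<Sum>u<M. cis (2 * pi * \<theta> * real u)"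
  have "complex_of_real (fejer_sum M \<theta>) = ?s * cnj ?s"
    by (simp only: fejer_sum_def complex_norm_square)
  also have "\<dots> = (\<Sum>u<M. \<Sum>v<M. cis (2 * pi * \<theta> * real u) * cis (- (2 * pi * \<theta> * real v)))"
    by (simp add: cis_cnj sum_product)
  also have "\<dots> = (\<Sum>u<M. \<Sum>v<M. cis (2 * pi * \<theta> * (real u - real v)))"
    by (simp add: cis_mult algebra_simps)
  finally show ?thesis by simp
qed

text \<open>Differences are first reduced to the nearest integer. On either side of zero they form a
  separated set at distance at least \<open>\<delta>\<close> and contribute
  \<open>2 / \<delta>\<^sup>2\<close>; the factor \<open>1 / 4\<close> of
  \<open>fejer_sum_le\<close> turns the total into \<open>1 / \<delta>\<^sup>2\<close>.\<close>

lemma sum_fejer_separated_le: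
  assumes "finite R" "\<delta> > 0" "r \<in> R"
    and sep: "\<And>r s z. r \<in> R \<Longrightarrow> s \<in> R \<Longrightarrow> r \<noteq> s \<Longrightarrow> \<bar>\<alpha> r - \<alpha> s - of_int z\<bar> \<ge> \<delta>"
  shows "(\<Sum>s\<in>R. fejer_sum M (\<alpha> r - \<alpha> s)) \<le> (real M)\<^sup>2 + 1 / \<delta>\<^sup>2"
proof -
  define t where "t s = \<alpha> r - \<alpha> s - of_int (round (\<alpha> r - \<alpha> s))" for s
  have t_abs: "\<bar>t s\<bar> \<le> 1 / 2" for s
    unfolding t_def using of_int_round_abs_le[of "\<alpha> r - \<alpha> s"] by linarith
  have t_ge: "\<bar>t s\<bar> \<ge> \<delta>" if "s \<in> R - {r}" for s
    unfolding t_def using that assms(3) by (intro sep) auto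
  have t_sep: "\<bar>t s - t s'\<bar> \<ge> \<delta>" if "s \<in> R" "s' \<in> R" "s \<noteq> s'" for s s'
  proof -
    have "t s - t s' = \<alpha> s' - \<alpha> s - of_int (round (\<alpha> r - \<alpha> s) - round (\<alpha> r - \<alpha> s'))"
      by (simp add: t_def)
    then show ?thesis using sep[of s' s] that by metis
  qed
  have fej: "fejer_sum M (\<alpha> r - \<alpha> s) \<le> 1 / 4 * (1 / (t s)\<^sup>2)" if "s \<in> R - {r}" for s
  proof -
    have "fejer_sum M (\<alpha> r - \<alpha> s) = fejer_sum M (t s)" by (simp add: t_def fejer_sum_shift)
    also have "\<dots> \<le> 1 / 4 * (1 / (t s)\<^sup>2)"
      using t_abs t_ge[OF that] assms(2) by (intro fejer_sum_le) auto
    finally show ?thesis .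
  qed
  let ?P = "{s \<in> R - {r}. t s > 0}" and ?N = "{s \<in> R - {r}. t s < 0}"
  have pos: "(\<Sum>s\<in>?P. 1 / (t s)\<^sup>2) \<le> 2 / \<delta>\<^sup>2"
    using assms(1,2) t_ge t_sep by (intro sum_inverse_squares_separated_le) fastforce+
  have "(\<Sum>s\<in>?N. 1 / (- t s)\<^sup>2) \<le> 2 / \<delta>\<^sup>2"
  proof (rule sum_inverse_squares_separated_le)
    show "\<bar>- t s - - t s'\<bar> \<ge> \<delta>" if "s \<in> ?N" "s' \<in> ?N" "s \<noteq> s'" for s s'
      using t_sep[of s s'] that by auto
    show "- t s \<ge> \<delta>" if "s \<in> ?N" for s using t_ge[of s] that by auto
  qed (use assms in auto)
  moreover have "(\<Sum>s\<in>R - {r}. 1 / (t s)\<^sup>2) = (\<Sum>s\<in>?P. 1 / (t s)\<^sup>2) + (\<Sum>s\<in>?N. 1 / (t s)\<^sup>2)"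
  proof -
    have "R - {r} = ?P \<union> ?N" using t_ge assms(2) by force
    then have "(\<Sum>s\<in>R - {r}. 1 / (t s)\<^sup>2) = (\<Sum>s\<in>?P \<union> ?N. 1 / (t s)\<^sup>2)" by (rule arg_cong)
    also have "\<dots> = (\<Sum>s\<in>?P. 1 / (t s)\<^sup>2) + (\<Sum>s\<in>?N. 1 / (t s)\<^sup>2)"
      using assms(1) by (intro sum.union_disjoint) auto
    finally show ?thesis .
  qed
  ultimately have "(\<Sum>s\<in>R - {r}. 1 / (t s)\<^sup>2) \<le> 4 / \<delta>\<^sup>2" using pos by simp
  moreover have "(\<Sum>s\<in>R - {r}. fejer_sum M (\<alpha> r - \<alpha> s)) \<le> 1 / 4 * (\<Sum>s\<in>R - {r}. 1 / (t s)\<^sup>2)"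
    unfolding sum_distrib_left by (rule sum_mono) (rule fej)
  ultimately have "(\<Sum>s\<in>R - {r}. fejer_sum M (\<alpha> r - \<alpha> s)) \<le> 1 / \<delta>\<^sup>2" by simp
  then show ?thesis
    using assms(1,3) by (subst sum.remove[of R r]) (auto simp: fejer_sum_0)
qed

text \<open>
  Averaging over \<open>m + u - v\<close> weights the integers near \<open>m\<close> by Fejer's kernel, whose transform
  \<open>fejer_sum\<close> is nonnegative and decays quadratically, so that \<open>\<delta>\<close>-separated frequencies are almost
  orthogonal.
\<close>
theorem dual_large_sieve:
  fixes c :: "'a \<Rightarrow> complex" and m :: int
  assumes "finite R" "\<delta> > 0"
    and sep: "\<And>r s z. r \<in> R \<Longrightarrow> s \<in> R \<Longrightarrow> r \<noteq> s \<Longrightarrow> \<bar>\<alpha> r - \<alpha> s - of_int z\<bar> \<ge> \<delta>"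
  shows "(\<Sum>u<M. \<Sum>v<M. (norm (\<Sum>r\<in>R. c r * cis (2 * pi * \<alpha> r * of_int (m + int u - int v))))\<^sup>2)
    \<le> ((real M)\<^sup>2 + 1 / \<delta>\<^sup>2) * (\<Sum>r\<in>R. (norm (c r))\<^sup>2)"
proof -
  let ?K = "\<lambda>r s. fejer_sum M (\<alpha> r - \<alpha> s)"
  let ?b = "\<lambda>r s. c r * cnj (c s) * cis (2 * pi * (\<alpha> r - \<alpha> s) * of_int m)"
  let ?L = "\<Sum>u<M. \<Sum>v<M. (norm (\<Sum>r\<in>R. c r * cis (2 * pi * \<alpha> r * of_int (m + int u - int v))))\<^sup>2"
  have sq: "of_real ((norm (\<Sum>r\<in>R. c r * cis (2 * pi * \<alpha> r * of_int (m + int u - int v))))\<^sup>2) =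
      (\<Sum>r\<in>R. \<Sum>s\<in>R. ?b r s * cis (2 * pi * (\<alpha> r - \<alpha> s) * (real u - real v)))" for u v
  proof -
    have "of_real ((norm (\<Sum>r\<in>R. c r * cis (2 * pi * \<alpha> r * of_int (m + int u - int v))))\<^sup>2) =
      (\<Sum>r\<in>R. c r * cis (2 * pi * \<alpha> r * of_int (m + int u - int v))) *
      cnj (\<Sum>s\<in>R. c s * cis (2 * pi * \<alpha> s * of_int (m + int u - int v)))"
      by (rule complex_norm_square)
    also have "\<dots> = (\<Sum>r\<in>R. \<Sum>s\<in>R. c r * cnj (c s) * (cis (2 * pi * \<alpha> r * of_int (m + int u - int v)) *
        cis (- (2 * pi * \<alpha> s * of_int (m + int u - int v)))))"
      by (simp add: sum_product cis_cnj mult_ac)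
    also have "\<dots> = (\<Sum>r\<in>R. \<Sum>s\<in>R. ?b r s * cis (2 * pi * (\<alpha> r - \<alpha> s) * (real u - real v)))"
      by (intro sum.cong refl) (simp add: cis_mult mult.assoc algebra_simps)
    finally show ?thesis .
  qed
  have "complex_of_real ?L =
      (\<Sum>u<M. \<Sum>v<M. \<Sum>r\<in>R. \<Sum>s\<in>R. ?b r s * cis (2 * pi * (\<alpha> r - \<alpha> s) * (real u - real v)))"
    by (simp only: of_real_sum sq)
  also have "\<dots> = (\<Sum>r\<in>R. \<Sum>s\<in>R. \<Sum>u<M. \<Sum>v<M. ?b r s * cis (2 * pi * (\<alpha> r - \<alpha> s) * (real u - real v)))"
  proof -
    have "(\<Sum>u\<in>A. \<Sum>v\<in>A. \<Sum>r\<in>R. \<Sum>s\<in>R. f u v r s) = (\<Sum>r\<in>R. \<Sum>s\<in>R. \<Sum>u\<in>A. \<Sum>v\<in>A. f u v r s)"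
      for f :: "nat \<Rightarrow> nat \<Rightarrow> 'a \<Rightarrow> 'a \<Rightarrow> complex" and A
    proof -
      have "(\<Sum>a\<in>A\<times>A. \<Sum>b\<in>R\<times>R. f (fst a) (snd a) (fst b) (snd b)) =
          (\<Sum>b\<in>R\<times>R. \<Sum>a\<in>A\<times>A. f (fst a) (snd a) (fst b) (snd b))"
        by (rule sum.swap)
      then show ?thesis by (simp add: sum.cartesian_product' )
    qed
    then show ?thesis .
  qed
  also have "\<dots> = (\<Sum>r\<in>R. \<Sum>s\<in>R. ?b r s * of_real (?K r s))"
    by (simp only: sum_distrib_left[symmetric] double_sum_cis)
  finally have "norm (complex_of_real ?L) = norm (\<Sum>r\<in>R. \<Sum>s\<in>R. ?b r s * of_real (?K r s))"
    by (rule arg_cong)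
  then have "?L \<le> norm (\<Sum>r\<in>R. \<Sum>s\<in>R. ?b r s * of_real (?K r s))"
    unfolding norm_of_real by (rule order_trans[OF abs_ge_self eq_refl])
  also have "\<dots> \<le> (\<Sum>r\<in>R. \<Sum>s\<in>R. norm (c r) * norm (c s) * ?K r s)"
    by (intro sum_norm_le) (simp add: norm_mult fejer_sum_nonneg)
  \<comment> \<open>Schur's test: the arithmetic-geometric mean inequality and the symmetry of the
    kernel reduce the form to row sums of the kernel.\<close>
  also have "\<dots> \<le> (\<Sum>r\<in>R. \<Sum>s\<in>R. ((norm (c r))\<^sup>2 / 2 + (norm (c s))\<^sup>2 / 2) * ?K r s)"
  proof (intro sum_mono mult_right_mono fejer_sum_nonneg)
    fix r s
    have "0 \<le> (norm (c r) - norm (c s))\<^sup>2" by simp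
    then show "norm (c r) * norm (c s) \<le> (norm (c r))\<^sup>2 / 2 + (norm (c s))\<^sup>2 / 2"
      by (simp add: power2_eq_square algebra_simps)
  qed
  also have "\<dots> = (\<Sum>r\<in>R. \<Sum>s\<in>R. (norm (c r))\<^sup>2 / 2 * ?K r s) + (\<Sum>r\<in>R. \<Sum>s\<in>R. (norm (c s))\<^sup>2 / 2 * ?K r s)"
    by (simp add: distrib_right sum.distrib)
  also have "(\<Sum>r\<in>R. \<Sum>s\<in>R. (norm (c s))\<^sup>2 / 2 * ?K r s) = (\<Sum>r\<in>R. \<Sum>s\<in>R. (norm (c r))\<^sup>2 / 2 * ?K r s)"
  proof (subst sum.swap, intro sum.cong refl)
    fix r s
    have "?K r s = ?K s r" using fejer_sum_uminus[of M "\<alpha> s - \<alpha> r"] by simp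
    then show "(norm (c s))\<^sup>2 / 2 * ?K r s = (norm (c s))\<^sup>2 / 2 * ?K s r" by simp
  qed
  also have "(\<Sum>r\<in>R. \<Sum>s\<in>R. (norm (c r))\<^sup>2 / 2 * ?K r s) + (\<Sum>r\<in>R. \<Sum>s\<in>R. (norm (c r))\<^sup>2 / 2 * ?K r s) =
      (\<Sum>r\<in>R. (norm (c r))\<^sup>2 * (\<Sum>s\<in>R. ?K r s))"
    unfolding sum.distrib[symmetric] sum_distrib_left by (intro sum.cong refl) simp
  also have "\<dots> \<le> (\<Sum>r\<in>R. (norm (c r))\<^sup>2 * ((real M)\<^sup>2 + 1 / \<delta>\<^sup>2))"
    using sum_fejer_separated_le[OF assms(1,2) _ sep] by (intro sum_mono mult_left_mono) auto
  finally show ?thesis by (simp add: sum_distrib_right mult.commute)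
qed

section \<open>Fourier analysis on the residues modulo p\<close>

definition dft :: "nat \<Rightarrow> (nat \<Rightarrow> real) \<Rightarrow> nat \<Rightarrow> complex" where
  "dft p f a = (\<Sum>n<p. of_real (f n) * cis (- (2 * pi * (real a / real p) * real n))) / of_nat p"

lemma sum_cis_residues:
  fixes k :: int
  assumes "p > 0"
  shows "(\<Sum>a<p. cis (2 * pi * (real a / real p) * of_int k)) = (if int p dvd k then of_nat p else 0)"
proof (cases "int p dvd k")
  case True
  then obtain j where j: "k = int p * j" by auto
  have "cis (2 * pi * (real a / real p) * of_int k) = 1" for a
  proof -
    have "2 * pi * (real a / real p) * of_int k = 2 * pi * of_int (int a * j)"
      using assms by (simp add: j)
    then show ?thesis by (simp only: cis_2pi_int)
  qed
  then show ?thesis using True by simp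
next
  case False
  let ?z = "cis (2 * pi * of_int k / real p)"
  have "?z \<noteq> 1"
  proof
    assume "?z = 1"
    then obtain n where "2 * pi * of_int k / real p = of_int n * (2 * pi)"
      by (auto simp: complex_eq_iff cos_one_2pi_int mult.commute)
    then have "real_of_int k = of_int (n * int p)" using assms by (simp add: field_simps)
    then have "k = n * int p" by (simp only: of_int_eq_iff)
    then show False using False by simp
  qed
  moreover have "?z ^ p = 1"
  proof -
    have "?z ^ p = cis (2 * pi * of_int k)" using assms by (simp add: DeMoivre)
    then show ?thesis by (simp only: cis_2pi_int)
  qed
  moreover have "(\<Sum>a<p. cis (2 * pi * (real a / real p) * of_int k)) = (\<Sum>a<p. ?z ^ a)"
    by (simp add: DeMoivre algebra_simps)
  ultimately show ?thesis using False by (simp add: geometric_sum)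
qed

lemma dft_inversion:
  fixes n :: int
  assumes "p > 0"
  shows "(\<Sum>a<p. dft p f a * cis (2 * pi * (real a / real p) * of_int n)) = of_real (f (nat (n mod int p)))"
proof -
  let ?e = "\<lambda>a k. cis (2 * pi * (real a / real p) * of_int k)"
  have "(\<Sum>a<p. dft p f a * ?e a n) = (\<Sum>a<p. \<Sum>j<p. of_real (f j) / of_nat p * ?e a (n - int j))"
    unfolding dft_def sum_divide_distrib sum_distrib_right
    by (intro sum.cong refl) (simp add: cis_mult algebra_simps flip: diff_divide_distrib)
  also have "\<dots> = (\<Sum>j<p. of_real (f j) / of_nat p * (\<Sum>a<p. ?e a (n - int j)))"
    by (subst sum.swap) (simp add: sum_distrib_left)
  also have "\<dots> = (\<Sum>j<p. if j = nat (n mod int p) then of_real (f j) else 0)"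
  proof (intro sum.cong refl)
    fix j assume j: "j \<in> {..<p}"
    have "int p dvd n - int j \<longleftrightarrow> n mod int p = int j mod int p"
      by (simp add: mod_eq_dvd_iff)
    also have "\<dots> \<longleftrightarrow> j = nat (n mod int p)" using j assms by auto
    finally have "int p dvd n - int j \<longleftrightarrow> j = nat (n mod int p)" .
    then show "of_real (f j) / of_nat p * (\<Sum>a<p. ?e a (n - int j)) =
        (if j = nat (n mod int p) then of_real (f j) else 0)"
      using assms by (simp only: sum_cis_residues[OF assms]) simp
  qed
  also have "\<dots> = of_real (f (nat (n mod int p)))"
    using assms by (simp add: nat_less_iff)
  finally show ?thesis .
qed

lemma dft_parseval:
  assumes "p > 0"
  shows "(\<Sum>a<p. (norm (dft p f a))\<^sup>2) = (\<Sum>n<p. (f n)\<^sup>2) / real p"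
proof -
  let ?e = "\<lambda>a k. cis (2 * pi * (real a / real p) * of_int k)"
  have "complex_of_real (\<Sum>a<p. (norm (dft p f a))\<^sup>2) = (\<Sum>a<p. dft p f a * cnj (dft p f a))"
    by (simp only: of_real_sum complex_norm_square)
  also have "\<dots> = (\<Sum>a<p. \<Sum>n<p. dft p f a * (of_real (f n) / of_nat p * ?e a (int n)))"
    by (intro sum.cong refl) (simp add: dft_def cis_cnj sum_divide_distrib sum_distrib_left)
  also have "\<dots> = (\<Sum>n<p. of_real (f n) / of_nat p * (\<Sum>a<p. dft p f a * ?e a (int n)))"
    by (subst sum.swap) (simp add: sum_distrib_left mult_ac)
  also have "\<dots> = (\<Sum>n<p. of_real (f n) / of_nat p * of_real (f n))"
    by (simp only: dft_inversion[OF assms]) (simp add: nat_mod_as_int[symmetric])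
  also have "\<dots> = complex_of_real ((\<Sum>n<p. (f n)\<^sup>2) / real p)"
    by (simp add: power2_eq_square sum_divide_distrib)
  finally show ?thesis by (simp only: of_real_eq_iff)
qed

text \<open>Uniqueness of partial fractions modulo one. After multiplication by the product of
  \<open>U\<close>, every term but that of \<open>p\<close> is divisible by \<open>p\<close>; so
  \<open>p\<close> divides \<open>e p\<close> times a product of other primes, hence
  \<open>e p\<close> itself, which is too small for a nonzero multiple.\<close>

lemma sum_fractions_int_imp_zero:
  fixes U :: "nat set" and e :: "nat \<Rightarrow> int"
  assumes "finite U" and primes: "\<And>p. p \<in> U \<Longrightarrow> prime p"
    and small: "\<And>p. p \<in> U \<Longrightarrow> \<bar>e p\<bar> < int p"
    and int: "(\<Sum>p\<in>U. real_of_int (e p) / real p) = of_int z"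
    and p: "p \<in> U"
  shows "e p = 0"
proof -
  let ?L = "\<Prod>q\<in>U - {p}. q"
  have pos: "\<And>q. q \<in> U \<Longrightarrow> real q > 0" using primes prime_gt_0_nat by fastforce
  have split: "(\<Prod>q\<in>U. q) = p * ?L" using assms(1) p by (rule prod.remove)
  have other: "\<exists>w::int. real_of_int (e q) / real q * real (\<Prod>q\<in>U. q) = of_int w \<and> int p dvd w"
    if "q \<in> U - {p}" for q
  proof (intro exI conjI)
    let ?w = "e q * (int p * int (\<Prod>r\<in>U - {p} - {q}. r))"
    have "(\<Prod>q\<in>U. q) = p * (q * (\<Prod>r\<in>U - {p} - {q}. r))"
      unfolding split using assms(1) that by (subst prod.remove[of "U - {p}" q]) auto
    then show "real_of_int (e q) / real q * real (\<Prod>q\<in>U. q) = of_int ?w"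
      using pos[of q] that by simp
  qed simp
  then obtain w where w: "\<And>q. q \<in> U - {p} \<Longrightarrow>
      real_of_int (e q) / real q * real (\<Prod>q\<in>U. q) = of_int (w q :: int) \<and> int p dvd w q"
    by metis
  have "of_int (z * int (\<Prod>q\<in>U. q)) = (\<Sum>q\<in>U. real_of_int (e q) / real q * real (\<Prod>q\<in>U. q))"
    unfolding sum_distrib_right[symmetric] int by simp
  also have "\<dots> = real_of_int (e p) / real p * real (\<Prod>q\<in>U. q) +
      (\<Sum>q\<in>U - {p}. real_of_int (e q) / real q * real (\<Prod>q\<in>U. q))"
    using assms(1) p by (rule sum.remove)
  also have "real_of_int (e p) / real p * real (\<Prod>q\<in>U. q) = of_int (e p * int ?L)"
    using pos[OF p] by (simp add: split)
  also have "(\<Sum>q\<in>U - {p}. real_of_int (e q) / real q * real (\<Prod>q\<in>U. q)) = of_int (\<Sum>q\<in>U - {p}. w q)"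
    using w by simp
  finally have "z * int (\<Prod>q\<in>U. q) = e p * int ?L + (\<Sum>q\<in>U - {p}. w q)"
    by (simp only: of_int_add[symmetric] of_int_eq_iff)
  then have "e p * int ?L = z * int (\<Prod>q\<in>U. q) - (\<Sum>q\<in>U - {p}. w q)" by simp
  moreover have "int p dvd z * int (\<Prod>q\<in>U. q)" unfolding split by simp
  moreover have "int p dvd (\<Sum>q\<in>U - {p}. w q)" using w by (intro dvd_sum) auto
  ultimately have "int p dvd e p * int ?L" by simp
  moreover have "coprime p ?L"
    using primes p by (intro prod_coprime_right) (auto intro: primes_coprime)
  then have "coprime (int p) (int ?L)" by (simp only: coprime_int_iff)
  ultimately have "int p dvd e p" by (simp add: coprime_dvd_mult_left_iff)
  then show ?thesis using small[OF p] by (metis dvd_imp_le_int not_less abs_of_nat)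
qed

text \<open>The offset \<open>b - N div 2\<close> is at most \<open>(N + 1) / 2\<close> in absolute
  value, so the diagonal \<open>u - v = b - N div 2\<close> keeps at least half of its
  \<open>N + 1\<close> positions inside the square.\<close>

lemma card_shift_pairs_ge:
  assumes "b \<le> N"
  shows "2 * card {(u, v) \<in> {..<N + 1} \<times> {..<N + 1}. int (N div 2) + int u - int v = int b} \<ge> N + 1"
proof -
  let ?X = "{(u, v) \<in> {..<N + 1} \<times> {..<N + 1}. int (N div 2) + int u - int v = int b}"
  have fin: "finite ?X" by (rule finite_subset[of _ "{..<N + 1} \<times> {..<N + 1}"]) auto
  show ?thesis
  proof (cases "b \<ge> N div 2")
    case True
    define j where "j = b - N div 2"
    have j: "2 * j \<le> N + 1" using assms True by (simp add: j_def)
    have "(\<lambda>v. (v + j, v)) ` {..<N + 1 - j} \<subseteq> ?X" using True by (auto simp: j_def)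
    then have "card ((\<lambda>v. (v + j, v)) ` {..<N + 1 - j}) \<le> card ?X" using fin by (rule card_mono[rotated])
    then show ?thesis using j by (simp add: card_image inj_on_def)
  next
    case False
    define j where "j = N div 2 - b"
    have j: "2 * j \<le> N + 1" using assms False by (simp add: j_def)
    have "(\<lambda>u. (u, u + j)) ` {..<N + 1 - j} \<subseteq> ?X" using False by (auto simp: j_def)
    then have "card ((\<lambda>u. (u, u + j)) ` {..<N + 1 - j}) \<le> card ?X" using fin by (rule card_mono[rotated])
    then show ?thesis using j by (simp add: card_image inj_on_def)
  qed
qed

text \<open>This passes from Fejer averages back to \<open>B\<close>: every element of
  \<open>B\<close> is hit by at least \<open>(N + 1) / 2\<close> shifts, and the shifts that miss
  \<open>B\<close> are dropped by nonnegativity.\<close>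

lemma sum_le_sum_shifts:
  fixes f :: "int \<Rightarrow> real"
  assumes "B \<subseteq> {..N}" "\<And>n. f n \<ge> 0"
  shows "real (N + 1) / 2 * (\<Sum>b\<in>B. f (int b)) \<le> (\<Sum>u<N + 1. \<Sum>v<N + 1. f (int (N div 2) + int u - int v))"
proof -
  let ?s = "\<lambda>u v. int (N div 2) + int u - int v"
  let ?I = "{..<N + 1} \<times> {..<N + 1}"
  have finB: "finite B" using assms(1) finite_subset by blast
  have "real (N + 1) / 2 * (\<Sum>b\<in>B. f (int b)) =
      (\<Sum>b\<in>B. real (N + 1) / 2 * f (int b))" by (rule sum_distrib_left)
  also have "\<dots> \<le> (\<Sum>b\<in>B. real (card {(u, v) \<in> ?I. ?s u v = int b}) * f (int b))"
  proof (intro sum_mono mult_right_mono assms(2))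
    fix b assume "b \<in> B"
    then have "b \<le> N" using assms(1) by auto
    from card_shift_pairs_ge[OF this]
    have "real (N + 1) \<le> real (2 * card {(u, v) \<in> ?I. ?s u v = int b})"
      by (simp only: of_nat_le_iff)
    then show "real (N + 1) / 2 \<le> real (card {(u, v) \<in> ?I. ?s u v = int b})" by simp
  qed
  also have "\<dots> = (\<Sum>b\<in>B. \<Sum>t\<in>?I. if ?s (fst t) (snd t) = int b then f (int b) else 0)"
    by (intro sum.cong refl) (simp add: sum.If_cases Int_def split_def mem_Times_iff conj_assoc)
  also have "\<dots> = (\<Sum>t\<in>?I. \<Sum>b\<in>B. if ?s (fst t) (snd t) = int b then f (int b) else 0)"
    by (rule sum.swap)
  also have "\<dots> \<le> (\<Sum>t\<in>?I. f (?s (fst t) (snd t)))"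
  proof (rule sum_mono)
    fix t
    let ?j = "?s (fst t) (snd t)"
    have "(\<Sum>b\<in>B. if ?j = int b then f (int b) else 0) = (\<Sum>b\<in>B. if nat ?j = b then (if ?j \<ge> 0 then f ?j else 0) else 0)"
      by (intro sum.cong refl) auto
    also have "\<dots> = (if nat ?j \<in> B \<and> ?j \<ge> 0 then f ?j else 0)"
      using finB by (subst sum.delta'[OF finB]) simp
    also have "\<dots> \<le> f ?j" using assms(2) by simp
    finally show "(\<Sum>b\<in>B. if ?j = int b then f (int b) else 0) \<le> f ?j" .
  qed
  also have "\<dots> = (\<Sum>u<N + 1. \<Sum>v<N + 1. f (?s u v))"
    by (simp only: sum.cartesian_product split_def)
  finally show ?thesis .
qed

section \<open>From sieve functions to the large sieve inequality\<close>

text \<open>The odds of a random residue being sifted, the counterpart of \<open>h\<close> in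
  Selberg's sieve.\<close>

definition sieve_ratio :: "(nat \<Rightarrow> nat set) \<Rightarrow> nat \<Rightarrow> real" where
  "sieve_ratio \<Omega> p = real (card (\<Omega> p)) / (real p - real (card (\<Omega> p)))"

text \<open>
  The mean-zero function on the residues modulo \<open>p\<close> that is \<open>-1\<close> on the sifted classes and constant
  on the others. Expanded in additive characters, products of these over \<open>p \<in> T\<close> involve only
  fractions whose denominator is exactly \<open>\<Prod>T\<close>.
\<close>
definition sieve_function :: "(nat \<Rightarrow> nat set) \<Rightarrow> nat \<Rightarrow> nat \<Rightarrow> real" where
  "sieve_function \<Omega> p n = (if n \<in> \<Omega> p then - 1 else sieve_ratio \<Omega> p)"

context
  fixes \<Omega> :: "nat \<Rightarrow> nat set" and p :: nat
  assumes \<Omega>: "\<Omega> p \<subseteq> {..<p}" "card (\<Omega> p) < p"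
begin

text \<open>The exponent one gives mean zero, the exponent two the sum of squares for
  Parseval.\<close>

lemma sum_sieve_function_power:
  "(\<Sum>n<p. sieve_function \<Omega> p n ^ k) =
    real (card (\<Omega> p)) * (- 1) ^ k + (real p - real (card (\<Omega> p))) * sieve_ratio \<Omega> p ^ k"
proof -
  have "(\<Sum>n<p. sieve_function \<Omega> p n ^ k) =
      (\<Sum>n\<in>{..<p} - \<Omega> p. sieve_function \<Omega> p n ^ k) + (\<Sum>n\<in>\<Omega> p. sieve_function \<Omega> p n ^ k)"
    using \<Omega>(1) by (intro sum.subset_diff) auto
  then show ?thesis
    using \<Omega> by (simp add: sieve_function_def card_Diff_subset finite_subset of_nat_diff)
qed

lemma dft_sieve_function_0: "dft p (sieve_function \<Omega> p) 0 = 0"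
proof -
  have "(\<Sum>n<p. sieve_function \<Omega> p n) = 0"
    using sum_sieve_function_power[of 1] \<Omega> by (simp add: sieve_ratio_def)
  then show ?thesis by (simp add: dft_def flip: of_real_sum)
qed

lemma dft_sieve_function_parseval:
  "(\<Sum>a\<in>{1..<p}. (norm (dft p (sieve_function \<Omega> p) a))\<^sup>2) = sieve_ratio \<Omega> p"
proof -
  have p: "{..<p} = insert 0 {1..<p}" using \<Omega> by auto
  have "(\<Sum>a\<in>{1..<p}. (norm (dft p (sieve_function \<Omega> p) a))\<^sup>2) =
      (\<Sum>a<p. (norm (dft p (sieve_function \<Omega> p) a))\<^sup>2)"
    unfolding p by (simp add: dft_sieve_function_0)
  also have "\<dots> = (\<Sum>n<p. (sieve_function \<Omega> p n)\<^sup>2) / real p"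
    using \<Omega> by (intro dft_parseval) auto
  also have "\<dots> = sieve_ratio \<Omega> p"
  proof -
    define w d where "w = real (card (\<Omega> p))" and "d = real p - w"
    have d: "d > 0" "real p = w + d" using \<Omega> by (auto simp: w_def d_def)
    have "w + d * (w / d)\<^sup>2 = (w / d) * (w + d)"
      using d by (simp add: field_simps power2_eq_square)
    moreover have "w + d > 0" using d by (simp add: w_def add_nonneg_pos)
    ultimately show ?thesis
      unfolding sum_sieve_function_power sieve_ratio_def using d
      by (simp flip: w_def)
  qed
  finally show ?thesis .
qed

lemma sieve_function_expansion:
  fixes n :: int
  shows "of_real (sieve_function \<Omega> p (nat (n mod int p))) =
    (\<Sum>a\<in>{1..<p}. dft p (sieve_function \<Omega> p) a * cis (2 * pi * (real a / real p) * of_int n))"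
proof -
  have p: "{..<p} = insert 0 {1..<p}" using \<Omega> by auto
  have "(\<Sum>a<p. dft p (sieve_function \<Omega> p) a * cis (2 * pi * (real a / real p) * of_int n)) =
    (\<Sum>a\<in>{1..<p}. dft p (sieve_function \<Omega> p) a * cis (2 * pi * (real a / real p) * of_int n))"
    unfolding p by (simp add: dft_sieve_function_0)
  then show ?thesis using dft_inversion[of p "sieve_function \<Omega> p" n] \<Omega> by simp
qed

end

lemma prod_cis: "finite A \<Longrightarrow> (\<Prod>x\<in>A. cis (f x)) = cis (\<Sum>x\<in>A. f x)"
  by (induction A rule: finite_induct) (auto simp: cis_mult)

text \<open>On every unsifted \<open>b\<close> the function \<open>F\<close> takes the constant
  value \<open>G\<close>, and by Parseval its Fourier coefficients have squared norms adding up to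
  \<open>G\<close> as well. The dual inequality thus compares \<open>card B * G\<^sup>2\<close> with
  a multiple of \<open>N * G\<close>, and one factor \<open>G\<close> cancels.\<close>

theorem large_sieve:
  fixes B :: "nat set" and D :: "nat set set" and \<Omega> :: "nat \<Rightarrow> nat set"
  assumes finD: "finite D" and finT: "\<And>T. T \<in> D \<Longrightarrow> finite T"
    and primes: "\<And>T p. T \<in> D \<Longrightarrow> p \<in> T \<Longrightarrow> prime p"
    and level: "\<And>T. T \<in> D \<Longrightarrow> (\<Prod>p\<in>T. p)\<^sup>2 \<le> N"
    and \<Omega>: "\<And>T p. T \<in> D \<Longrightarrow> p \<in> T \<Longrightarrow> \<Omega> p \<subseteq> {..<p} \<and> card (\<Omega> p) < p"
    and B: "B \<subseteq> {..N}"
    and unsifted: "\<And>b T p. b \<in> B \<Longrightarrow> T \<in> D \<Longrightarrow> p \<in> T \<Longrightarrow> b mod p \<notin> \<Omega> p"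
  shows "real (card B) * (\<Sum>T\<in>D. \<Prod>p\<in>T. sieve_ratio \<Omega> p) \<le> 4 * real N + 2"
proof (cases "D = {}")
  case False
  define G where "G = (\<Sum>T\<in>D. \<Prod>p\<in>T. sieve_ratio \<Omega> p)"
  define R where "R = (SIGMA T:D. PiE T (\<lambda>p. {1..<p}))"
  define \<alpha> where "\<alpha> r = (\<Sum>p\<in>fst r. real (snd r p) / real p)" for r :: "nat set \<times> (nat \<Rightarrow> nat)"
  define c where "c r = (\<Prod>p\<in>fst r. dft p (sieve_function \<Omega> p) (snd r p))" for r :: "nat set \<times> (nat \<Rightarrow> nat)"
  define F where "F n = (\<Sum>T\<in>D. \<Prod>p\<in>T. sieve_function \<Omega> p (nat (n mod int p)))" for n :: int
  have prod_pos: "(\<Prod>p\<in>T. p) > 0" if "T \<in> D" for T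
    using primes[OF that] by (intro prod_pos) (auto simp: prime_gt_0_nat)
  have "N > 0"
  proof -
    obtain T where T: "T \<in> D" using False by auto
    have "0 < (\<Prod>p\<in>T. p)\<^sup>2" using prod_pos[OF T] by simp
    then show ?thesis using level[OF T] by linarith
  qed
  have ratio_nonneg: "sieve_ratio \<Omega> p \<ge> 0" if "T \<in> D" "p \<in> T" for T p
    using \<Omega>[OF that] by (auto simp: sieve_ratio_def)
  have G_nonneg: "G \<ge> 0" unfolding G_def using ratio_nonneg by (intro sum_nonneg prod_nonneg) auto
  have finR: "finite R" unfolding R_def using finD finT by (auto intro!: finite_PiE)
  have norm_c: "(\<Sum>r\<in>R. (norm (c r))\<^sup>2) = G"
  proof -
    have c_sq: "(norm (c (T, g)))\<^sup>2 = (\<Prod>p\<in>T. (norm (dft p (sieve_function \<Omega> p) (g p)))\<^sup>2)" for T g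
      by (simp add: c_def flip: prod_norm prod_power_distrib)
    have "(\<Sum>r\<in>R. (norm (c r))\<^sup>2) = (\<Sum>T\<in>D. \<Sum>g\<in>PiE T (\<lambda>p. {1..<p}). \<Prod>p\<in>T. (norm (dft p (sieve_function \<Omega> p) (g p)))\<^sup>2)"
      unfolding R_def using finD finT
      by (subst sum.Sigma) (auto intro!: finite_PiE sum.cong simp: c_sq)
    also have "\<dots> = (\<Sum>T\<in>D. \<Prod>p\<in>T. \<Sum>a\<in>{1..<p}. (norm (dft p (sieve_function \<Omega> p) a))\<^sup>2)"
      using finT by (intro sum.cong refl prod_sum_PiE[symmetric]) auto
    also have "\<dots> = G" unfolding G_def
      using \<Omega> by (intro sum.cong prod.cong refl dft_sieve_function_parseval) auto
    finally show ?thesis .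
  qed
  have expansion: "of_real (F n) = (\<Sum>r\<in>R. c r * cis (2 * pi * \<alpha> r * of_int n))" for n
  proof -
    have "complex_of_real (F n) = (\<Sum>T\<in>D. \<Prod>p\<in>T. \<Sum>a\<in>{1..<p}.
        dft p (sieve_function \<Omega> p) a * cis (2 * pi * (real a / real p) * of_int n))"
      unfolding F_def of_real_sum of_real_prod
      using \<Omega> by (intro sum.cong prod.cong refl sieve_function_expansion) auto
    also have "\<dots> = (\<Sum>T\<in>D. \<Sum>g\<in>PiE T (\<lambda>p. {1..<p}). \<Prod>p\<in>T.
        dft p (sieve_function \<Omega> p) (g p) * cis (2 * pi * (real (g p) / real p) * of_int n))"
      using finT by (intro sum.cong refl prod_sum_PiE) auto
    also have "\<dots> = (\<Sum>T\<in>D. \<Sum>g\<in>PiE T (\<lambda>p. {1..<p}). c (T, g) * cis (2 * pi * \<alpha> (T, g) * of_int n))"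
      using finT by (intro sum.cong refl)
        (simp add: prod.distrib c_def \<alpha>_def prod_cis sum_distrib_left sum_distrib_right)
    also have "\<dots> = (\<Sum>r\<in>R. c r * cis (2 * pi * \<alpha> r * of_int n))"
      unfolding R_def using finD finT by (subst sum.Sigma) (auto intro!: finite_PiE simp: split_def)
    finally show ?thesis .
  qed
  \<comment> \<open>Distinct indices give fractions that differ modulo one, by
    \<open>sum_fractions_int_imp_zero\<close>. Their denominators have product at most
    \<open>N\<close>, and a nonzero integer over such a denominator is at least \<open>1 / N\<close>
    in absolute value.\<close>
  have sep: "\<bar>\<alpha> r - \<alpha> s - of_int z\<bar> \<ge> 1 / real N" if rs: "r \<in> R" "s \<in> R" "r \<noteq> s" for r s z
  proof -
    obtain T g where r: "r = (T, g)" "T \<in> D" "g \<in> PiE T (\<lambda>p. {1..<p})" using rs unfolding R_def by auto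
    obtain T' g' where s: "s = (T', g')" "T' \<in> D" "g' \<in> PiE T' (\<lambda>p. {1..<p})" using rs unfolding R_def by auto
    define e where "e p = (if p \<in> T then int (g p) else 0) - (if p \<in> T' then int (g' p) else 0)" for p
    let ?U = "T \<union> T'"
    have fin: "finite T" "finite T'" using finT r s by auto
    have gr: "0 < g p" "g p < p" if "p \<in> T" for p using r(3) that by (fastforce dest: PiE_mem)+
    have gs: "0 < g' p" "g' p < p" if "p \<in> T'" for p using s(3) that by (fastforce dest: PiE_mem)+
    have \<alpha>_diff: "\<alpha> r - \<alpha> s = (\<Sum>p\<in>?U. real_of_int (e p) / real p)"
    proof -
      have "\<alpha> r = (\<Sum>p\<in>?U. (if p \<in> T then real (g p) else 0) / real p)"
        unfolding \<alpha>_def r using fin by (intro sum.mono_neutral_cong_left) auto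
      moreover have "\<alpha> s = (\<Sum>p\<in>?U. (if p \<in> T' then real (g' p) else 0) / real p)"
        unfolding \<alpha>_def s using fin by (intro sum.mono_neutral_cong_left) auto
      ultimately show ?thesis
        by (auto simp: sum_subtractf[symmetric] e_def diff_divide_distrib intro!: sum.cong)
    qed
    have nonint: "\<alpha> r - \<alpha> s \<noteq> of_int z"
    proof
      assume "\<alpha> r - \<alpha> s = of_int z"
      then have int: "(\<Sum>p\<in>?U. real_of_int (e p) / real p) = of_int z" using \<alpha>_diff by simp
      have zero: "e p = 0" if "p \<in> ?U" for p
      proof (rule sum_fractions_int_imp_zero[OF _ _ _ int that])
        show "\<bar>e p\<bar> < int p" if "p \<in> ?U" for p
          using that gr[of p] gs[of p] by (auto simp: e_def)
      qed (use fin primes r s in auto)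
      have "T = T'"
      proof (intro equalityI subsetI)
        fix p assume "p \<in> T"
        then show "p \<in> T'" using zero[of p] gr[of p] by (auto simp: e_def split: if_splits)
      next
        fix p assume "p \<in> T'"
        then show "p \<in> T" using zero[of p] gs[of p] by (auto simp: e_def split: if_splits)
      qed
      moreover have "g = g'"
      proof (rule PiE_ext[OF r(3)])
        show "g' \<in> PiE T (\<lambda>p. {1..<p})" using s(3) \<open>T = T'\<close> by simp
        show "g p = g' p" if "p \<in> T" for p using zero[of p] that \<open>T = T'\<close> by (auto simp: e_def)
      qed
      ultimately show False using rs r s by simp
    qed
    have frac: "\<exists>w::int. (\<Sum>p\<in>T. real (g p) / real p) * real (\<Prod>p\<in>T. p) = of_int w"
      if "T \<in> D" for T and g :: "nat \<Rightarrow> nat"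
    proof -
      have "(\<Sum>p\<in>T. real (g p) / real p) * real (\<Prod>p\<in>T. p) = (\<Sum>p\<in>T. real_of_int (int (g p) * int (\<Prod>q\<in>T - {p}. q)))"
        unfolding sum_distrib_right
      proof (intro sum.cong refl)
        fix p assume p: "p \<in> T"
        then have "(\<Prod>q\<in>T. q) = p * (\<Prod>q\<in>T - {p}. q)" using finT[OF that] by (intro prod.remove) auto
        moreover have "p > 0" using primes[OF that p] by (rule prime_gt_0_nat)
        ultimately show "real (g p) / real p * real (\<Prod>p\<in>T. p) = real_of_int (int (g p) * int (\<Prod>q\<in>T - {p}. q))"
          by simp
      qed
      then show ?thesis unfolding of_int_sum[symmetric] by (rule exI)
    qed
    let ?q = "\<Prod>p\<in>T. p" and ?q' = "\<Prod>p\<in>T'. p"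
    obtain w where w: "\<alpha> r * real ?q = of_int w" using frac[OF r(2), of g] by (auto simp: \<alpha>_def r)
    obtain w' where w': "\<alpha> s * real ?q' = of_int w'" using frac[OF s(2), of g'] by (auto simp: \<alpha>_def s)
    have "(\<alpha> r - \<alpha> s - of_int z) * (real ?q * real ?q') =
        (\<alpha> r * real ?q) * real ?q' - (\<alpha> s * real ?q') * real ?q - of_int z * (real ?q * real ?q')"
      by (simp only: algebra_simps)
    also have "\<dots> = of_int (w * int ?q' - w' * int ?q - z * (int ?q * int ?q'))"
      unfolding w w' by simp
    finally have eq: "(\<alpha> r - \<alpha> s - of_int z) * (real ?q * real ?q') =
        of_int (w * int ?q' - w' * int ?q - z * (int ?q * int ?q'))" (is "_ = of_int ?k") .
    have qpos: "real ?q > 0" "real ?q' > 0" using prod_pos r s by (simp_all only: of_nat_0_less_iff)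
    then have "(\<alpha> r - \<alpha> s - of_int z) * (real ?q * real ?q') \<noteq> 0" using nonint by simp
    then have "?k \<noteq> 0" unfolding eq of_int_eq_0_iff .
    then have "1 \<le> \<bar>real_of_int ?k\<bar>" by linarith
    also have "\<dots> = \<bar>\<alpha> r - \<alpha> s - of_int z\<bar> * (real ?q * real ?q')"
      unfolding eq[symmetric] abs_mult using qpos by simp
    also have "\<dots> \<le> \<bar>\<alpha> r - \<alpha> s - of_int z\<bar> * real N"
    proof (rule mult_left_mono)
      have "?q\<^sup>2 * ?q'\<^sup>2 \<le> N * N" using level r s by (intro mult_mono) auto
      then have "(?q * ?q')\<^sup>2 \<le> N\<^sup>2" by (simp add: power_mult_distrib power2_eq_square mult_ac)
      then have "?q * ?q' \<le> N" by (rule power2_le_imp_le) simp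
      then show "real ?q * real ?q' \<le> real N" by (simp only: of_nat_mult[symmetric] of_nat_le_iff)
    qed simp
    finally show ?thesis using \<open>N > 0\<close> by (simp add: field_simps)
  qed
  have F_unsifted: "F (int b) = G" if "b \<in> B" for b
    unfolding F_def G_def
  proof (intro sum.cong prod.cong refl)
    fix T p assume "T \<in> D" "p \<in> T"
    then have "b mod p \<notin> \<Omega> p" using unsifted that by blast
    then show "sieve_function \<Omega> p (nat (int b mod int p)) = sieve_ratio \<Omega> p"
      by (simp add: sieve_function_def flip: zmod_int)
  qed
  have "real (N + 1) / 2 * (real (card B) * G\<^sup>2) = real (N + 1) / 2 * (\<Sum>b\<in>B. (F (int b))\<^sup>2)"
    by (simp add: F_unsifted)
  also have "\<dots> \<le> (\<Sum>u<N + 1. \<Sum>v<N + 1. (F (int (N div 2) + int u - int v))\<^sup>2)"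
    using B by (intro sum_le_sum_shifts) auto
  also have "\<dots> = (\<Sum>u<N + 1. \<Sum>v<N + 1.
      (norm (\<Sum>r\<in>R. c r * cis (2 * pi * \<alpha> r * of_int (int (N div 2) + int u - int v))))\<^sup>2)"
    by (simp only: expansion[symmetric] norm_of_real power2_abs)
  also have "\<dots> \<le> ((real (N + 1))\<^sup>2 + 1 / (1 / real N)\<^sup>2) * (\<Sum>r\<in>R. (norm (c r))\<^sup>2)"
    using finR \<open>N > 0\<close> sep by (intro dual_large_sieve) auto
  also have "\<dots> = ((real (N + 1))\<^sup>2 + (real N)\<^sup>2) * G"
    by (simp add: norm_c power_divide)
  finally have main: "real (N + 1) / 2 * (real (card B) * G\<^sup>2) \<le> ((real (N + 1))\<^sup>2 + (real N)\<^sup>2) * G" .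
  show ?thesis
  proof (cases "G = 0")
    case True
    then show ?thesis by (simp add: G_def[symmetric])
  next
    case False
    then have "G > 0" using G_nonneg by simp
    have "real (N + 1) / 2 * (real (card B) * G) * G \<le> ((real (N + 1))\<^sup>2 + (real N)\<^sup>2) * G"
      using main by (simp add: power2_eq_square mult_ac)
    then have "real (N + 1) / 2 * (real (card B) * G) \<le> (real (N + 1))\<^sup>2 + (real N)\<^sup>2"
      using \<open>G > 0\<close> by (rule mult_right_le_imp_le)
    also have "\<dots> \<le> real (N + 1) / 2 * (4 * real N + 2)"
      by (simp add: power2_eq_square field_simps)
    finally have "real (card B) * G \<le> 4 * real N + 2"
      by (rule mult_left_le_imp_le) simp
    then show ?thesis by (simp add: G_def)
  qed
qed simp

section \<open>Primes in dyadic intervals\<close>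

definition primorial :: "nat \<Rightarrow> nat" where
  "primorial n = \<Prod>{p. prime p \<and> p \<le> n}"

lemma finite_primes_le: "finite {p::nat. prime p \<and> p \<le> n}"
  by (rule finite_subset[of _ "{..n}"]) auto

lemma prod_primes_dvd:
  fixes n :: nat
  assumes "finite P" "\<And>p. p \<in> P \<Longrightarrow> prime p \<and> p dvd n"
  shows "\<Prod>P dvd n"
  using assms
proof (induction P rule: finite_induct)
  case (insert p P)
  have "coprime p (\<Prod>P)"
    using insert by (intro prod_coprime_right primes_coprime) auto
  then show ?case using insert by (simp add: divides_mult)
qed simp

text \<open>Such a prime divides the factorial of \<open>n\<close> but neither factorial in the
  denominator, so it survives in the quotient.\<close>

lemma prod_primes_between_dvd_binomial:
  assumes "k \<le> n" "n \<le> 2 * k + 1"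
  shows "\<Prod>{p. prime p \<and> k < p \<and> n - k < p \<and> p \<le> n} dvd (n choose k)"
proof (rule prod_primes_dvd)
  show "finite {p. prime p \<and> k < p \<and> n - k < p \<and> p \<le> n}"
    by (rule finite_subset[OF _ finite_primes_le[of n]]) auto
  fix p assume p: "p \<in> {p. prime p \<and> k < p \<and> n - k < p \<and> p \<le> n}"
  then have "p dvd fact n" by (simp add: prime_dvd_fact_iff)
  also have "fact n = fact k * fact (n - k) * (n choose k)"
    using assms by (simp add: binomial_fact_lemma)
  finally have "p dvd fact k * fact (n - k) * (n choose k)" .
  then show "prime p \<and> p dvd (n choose k)"
    using p by (simp add: prime_dvd_mult_iff prime_dvd_fact_iff)
qed

text \<open>The two equal middle entries of the row are together at most the row sum
  \<open>2 * 4 ^ m\<close>.\<close>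

lemma odd_central_binomial_le: "(2 * m + 1) choose m \<le> 4 ^ m"
proof -
  have "2 * ((2 * m + 1) choose m) = ((2 * m + 1) choose m) + ((2 * m + 1) choose (m + 1))"
    using binomial_symmetric[of m "2 * m + 1"] by simp
  also have "\<dots> = (\<Sum>k\<in>{m, m + 1}. (2 * m + 1) choose k)" by simp
  also have "\<dots> \<le> (\<Sum>k\<le>2 * m + 1. (2 * m + 1) choose k)" by (intro sum_mono2) auto
  also have "\<dots> = 2 * 4 ^ m" unfolding choose_row_sum by (simp add: power_mult)
  finally show ?thesis by simp
qed

text \<open>Erdos's induction: an even \<open>n > 2\<close> adds no prime, and for
  \<open>n = 2 * m + 1\<close> the primes above \<open>m + 1\<close> divide the middle binomial
  coefficient, so they cost \<open>4 ^ m\<close> on top of \<open>4 ^ (m + 1)\<close>.\<close>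

lemma primorial_le: "primorial n \<le> 4 ^ n"
proof (induction n rule: less_induct)
  case (less n)
  consider "n \<le> 1" | "n = 2" | "n > 2" "even n" | m where "n = 2 * m + 1" "m \<ge> 1"
    by (cases "n \<le> 2"; cases "even n") (auto elim!: oddE, linarith)
  then show ?case
  proof cases
    case 1
    then have "{p. prime p \<and> p \<le> n} = {}" by (auto dest!: prime_ge_2_nat)
    then show ?thesis by (simp only: primorial_def) simp
  next
    case 2
    then have "{p. prime p \<and> p \<le> n} = {2}" by (auto dest: prime_ge_2_nat)
    then show ?thesis using 2 by (simp only: primorial_def) simp
  next
    case 3
    then have "\<not> prime n" using primes_dvd_imp_eq two_is_prime_nat by blast
    then have "{p. prime p \<and> p \<le> n} = {p. prime p \<and> p \<le> n - 1}"
      using 3 by (auto simp: le_less less_diff_conv intro: Suc_leI)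
    then have "primorial n = primorial (n - 1)" by (simp only: primorial_def)
    also have "\<dots> \<le> 4 ^ (n - 1)" using 3 by (intro less) auto
    also have "\<dots> \<le> 4 ^ n" by (intro power_increasing) auto
    finally show ?thesis .
  next
    case 4
    let ?M = "{p. prime p \<and> m < p \<and> n - m < p \<and> p \<le> n}"
    have split: "{p. prime p \<and> p \<le> n} = {p. prime p \<and> p \<le> m + 1} \<union> ?M" using 4 by auto
    have "primorial n = primorial (m + 1) * \<Prod>?M"
      unfolding primorial_def split using 4
      by (intro prod.union_disjoint) (auto intro: finite_subset[OF _ finite_primes_le[of n]])
    also have "\<dots> \<le> 4 ^ (m + 1) * 4 ^ m"
    proof (rule mult_mono)
      have "\<Prod>?M \<le> n choose m"
        using 4 by (intro dvd_imp_le[OF prod_primes_between_dvd_binomial]) auto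
      also have "\<dots> \<le> 4 ^ m" using odd_central_binomial_le[of m] 4 by simp
      finally show "\<Prod>?M \<le> 4 ^ m" .
      show "primorial (m + 1) \<le> 4 ^ (m + 1)" using 4 by (intro less) auto
    qed auto
    also have "\<dots> = 4 ^ n" using 4 by (simp add: power_add[symmetric] mult_2)
    finally show ?thesis .
  qed
qed

lemma sum_ln_primes_le: "(\<Sum>p | prime p \<and> p \<le> n. ln (real p)) \<le> real n * ln 4"
proof -
  have "(\<Sum>p | prime p \<and> p \<le> n. ln (real p)) = ln (real (primorial n))"
    unfolding primorial_def of_nat_prod
    by (intro ln_prod[symmetric] finite_primes_le) (auto simp: prime_gt_0_nat)
  also have "\<dots> \<le> ln (4 ^ n)"
  proof (rule ln_mono)
    show "real (primorial n) > 0"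
      unfolding primorial_def by (auto intro!: prod_pos simp: prime_gt_0_nat)
    show "real (primorial n) \<le> 4 ^ n"
      using primorial_le[of n] by (metis of_nat_le_iff of_nat_numeral of_nat_power)
  qed
  also have "\<dots> = real n * ln 4" by (simp add: ln_realpow)
  finally show ?thesis .
qed

section \<open>Erdos's lower bound for primes between n and 2n\<close>

lemma multiplicity_eq_card_powers:
  fixes p n N :: nat
  assumes "prime p" "n > 0" "n < p ^ N"
  shows "multiplicity p n = card {k \<in> {1..N}. p ^ k dvd n}"
proof -
  have "{k \<in> {1..N}. p ^ k dvd n} = {1..multiplicity p n}"
  proof -
    have "p ^ k dvd n \<longleftrightarrow> k \<le> multiplicity p n" for k
      by (rule power_dvd_iff_le_multiplicity) (use assms in \<open>auto simp: not_prime_unit\<close>)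
    moreover have "multiplicity p n \<le> N"
    proof -
      have "p ^ multiplicity p n \<le> n" using assms by (intro dvd_imp_le multiplicity_dvd) auto
      then have "p ^ multiplicity p n < p ^ N" using assms by simp
      then show ?thesis using power_less_imp_less_exp[OF prime_gt_1_nat[OF assms(1)]] less_imp_le by blast
    qed
    ultimately show ?thesis by (auto intro: order_trans)
  qed
  then show ?thesis by simp
qed

text \<open>Legendre's formula, cut at any \<open>N\<close> beyond which the quotients vanish.
  Passing from \<open>n\<close> to \<open>n + 1\<close>, a quotient grows by one exactly when
  \<open>p ^ k\<close> divides \<open>n + 1\<close>.\<close>

lemma multiplicity_fact:
  fixes p :: nat
  assumes "prime p" "n < p ^ N"
  shows "multiplicity p (fact n :: nat) = (\<Sum>k=1..N. n div p ^ k)"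
  using assms(2)
proof (induction n)
  case (Suc n)
  have "multiplicity p (fact (Suc n) :: nat) = multiplicity p (Suc n) + multiplicity p (fact n :: nat)"
    using assms(1) by (simp add: prime_elem_multiplicity_mult_distrib del: mult_Suc)
  also have "multiplicity p (Suc n) = (\<Sum>k=1..N. of_bool (p ^ k dvd Suc n))"
    using multiplicity_eq_card_powers[OF assms(1) _ Suc.prems] by (simp add: Int_def)
  also have "multiplicity p (fact n :: nat) = (\<Sum>k=1..N. n div p ^ k)"
    using Suc by simp
  also have "(\<Sum>k=1..N. of_bool (p ^ k dvd Suc n)) + (\<Sum>k=1..N. n div p ^ k) = (\<Sum>k=1..N. Suc n div p ^ k)"
    unfolding sum.distrib[symmetric] by (intro sum.cong refl) (simp add: div_Suc dvd_eq_mod_eq_0)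
  finally show ?case .
qed simp

text \<open>Hence each term of Legendre's formula for the central binomial coefficient is 0 or
  1.\<close>

lemma div_double_bounds:
  fixes n q :: nat
  shows "2 * (n div q) \<le> 2 * n div q" "2 * n div q \<le> 2 * (n div q) + 1"
proof -
  show "2 * (n div q) \<le> 2 * n div q"
    by (cases "q = 0") (auto simp: less_eq_div_iff_mult_less_eq div_times_less_eq_dividend)
  show "2 * n div q \<le> 2 * (n div q) + 1"
  proof (cases "q = 0")
    case False
    then have "n < q * (n div q) + q"
      by (metis add_less_cancel_left mod_less_divisor mult_div_mod_eq neq0_conv)
    then have "2 * n < (2 * (n div q) + 2) * q" by (simp add: algebra_simps)
    then have "2 * n div q < 2 * (n div q) + 2" using False by (simp add: div_less_iff_less_mult)
    then show ?thesis by simp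
  qed simp
qed

lemma multiplicity_central_binomial:
  fixes p :: nat
  assumes "prime p"
  shows "multiplicity p (2 * n choose n) = (\<Sum>k=1..2*n. 2 * n div p ^ k - 2 * (n div p ^ k))"
proof -
  have p: "2 ^ (2 * n) \<le> p ^ (2 * n)" using prime_ge_2_nat[OF assms] by (intro power_mono) auto
  have lt: "2 * n < p ^ (2 * n)" using less_exp[of "2 * n"] p by linarith
  have "fact n * fact n * (2 * n choose n) = (fact (2 * n) :: nat)"
    using binomial_fact_lemma[of n "2 * n"] by (simp add: mult_2)
  then have "multiplicity p (fact (2 * n) :: nat) = 2 * multiplicity p (fact n :: nat) + multiplicity p (2 * n choose n)"
    using assms by (simp add: prime_elem_multiplicity_mult_distrib flip: \<open>fact n * fact n * (2 * n choose n) = (fact (2 * n) :: nat)\<close>)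
  moreover have "multiplicity p (fact (2 * n) :: nat) = (\<Sum>k=1..2*n. 2 * n div p ^ k)"
    by (rule multiplicity_fact[OF assms lt])
  moreover have "multiplicity p (fact n :: nat) = (\<Sum>k=1..2*n. n div p ^ k)"
    using lt by (intro multiplicity_fact[OF assms]) auto
  ultimately have "multiplicity p (2 * n choose n) = (\<Sum>k=1..2*n. 2 * n div p ^ k) - (\<Sum>k=1..2*n. 2 * (n div p ^ k))"
    by (simp add: sum_distrib_left)
  also have "\<dots> = (\<Sum>k=1..2*n. 2 * n div p ^ k - 2 * (n div p ^ k))"
    using div_double_bounds(1) by (intro sum_subtractf_nat[symmetric]) auto
  finally show ?thesis .
qed

lemma multiplicity_central_binomial_le_card:
  fixes p :: nat
  assumes "prime p"
  shows "multiplicity p (2 * n choose n) \<le> card {k \<in> {1..2*n}. p ^ k \<le> 2 * n}"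
proof -
  have "multiplicity p (2 * n choose n) \<le> (\<Sum>k=1..2*n. of_bool (p ^ k \<le> 2 * n))"
    unfolding multiplicity_central_binomial[OF assms]
  proof (rule sum_mono)
    fix k
    show "2 * n div p ^ k - 2 * (n div p ^ k) \<le> of_bool (p ^ k \<le> 2 * n)"
      using div_double_bounds(2)[of n "p ^ k"] by (cases "p ^ k \<le> 2 * n") auto
  qed
  also have "\<dots> = card {k \<in> {1..2*n}. p ^ k \<le> 2 * n}" by (simp add: Int_def)
  finally show ?thesis .
qed

text \<open>The admissible exponents lie between 1 and the largest one, so their number, which
  bounds the multiplicity, is at most that largest exponent.\<close>

lemma prime_power_central_binomial_le:
  fixes p :: nat
  assumes "prime p" "n > 0"
  shows "p ^ multiplicity p (2 * n choose n) \<le> 2 * n"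
proof -
  let ?S = "{k \<in> {1..2*n}. p ^ k \<le> 2 * n}"
  show ?thesis
  proof (cases "?S = {}")
    case True
    then have "multiplicity p (2 * n choose n) = 0"
      using multiplicity_central_binomial_le_card[OF assms(1), of n] by (simp only: card.empty le_zero_eq)
    then show ?thesis using assms by simp
  next
    case False
    have "card ?S \<le> card {1..Max ?S}" by (intro card_mono) auto
    then have "multiplicity p (2 * n choose n) \<le> Max ?S"
      using multiplicity_central_binomial_le_card[OF assms(1), of n] by simp
    then have "p ^ multiplicity p (2 * n choose n) \<le> p ^ Max ?S"
      using prime_gt_0_nat[OF assms(1)] by (intro power_increasing) auto
    also have "Max ?S \<in> ?S" using False by (intro Max_in) auto
    then have "p ^ Max ?S \<le> 2 * n" by simp
    finally show ?thesis .
  qed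
qed

lemma multiplicity_central_binomial_le_1:
  fixes p :: nat
  assumes "prime p" "p\<^sup>2 > 2 * n"
  shows "multiplicity p (2 * n choose n) \<le> 1"
proof -
  have "{k \<in> {1..2*n}. p ^ k \<le> 2 * n} \<subseteq> {1}"
  proof clarsimp
    fix k assume k: "Suc 0 \<le> k" "p ^ k \<le> 2 * n"
    have "k < 2"
    proof (rule ccontr)
      assume "\<not> k < 2"
      then have "p\<^sup>2 \<le> p ^ k" using prime_gt_0_nat[OF assms(1)] by (intro power_increasing) auto
      then show False using k assms by simp
    qed
    then show "k = Suc 0" using k by simp
  qed
  then have "card {k \<in> {1..2*n}. p ^ k \<le> 2 * n} \<le> card {1::nat}" by (intro card_mono) auto
  then show ?thesis using multiplicity_central_binomial_le_card[OF assms(1), of n] by simp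
qed

text \<open>Such a prime occurs twice in the factorial of \<open>2 * n\<close> and once in each
  factorial of \<open>n\<close>; \<open>p >= 3\<close> puts its higher powers beyond
  \<open>2 * n\<close>.\<close>

lemma multiplicity_central_binomial_eq_0:
  fixes p :: nat
  assumes "prime p" "p \<ge> 3" "2 * n < 3 * p" "p \<le> n"
  shows "multiplicity p (2 * n choose n) = 0"
proof -
  have "2 * n div p ^ k - 2 * (n div p ^ k) = 0" if "k \<ge> 1" for k
  proof (cases "k = 1")
    case True
    have "2 * n div p = 2" "n div p = 1"
      using assms by (auto intro!: div_nat_eqI)
    then show ?thesis using True by simp
  next
    case False
    then have "p\<^sup>2 \<le> p ^ k" using that prime_gt_0_nat[OF assms(1)] by (intro power_increasing) auto
    moreover have "3 * p \<le> p\<^sup>2" using assms(2) by (simp add: power2_eq_square)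
    ultimately have "2 * n < p ^ k" using assms by linarith
    then show ?thesis by simp
  qed
  then show ?thesis unfolding multiplicity_central_binomial[OF assms(1)] by simp
qed

text \<open>Primes up to \<open>sqrt (2 * n)\<close> cost at most \<open>ln (2 * n)\<close> each;
  larger ones up to \<open>2 * n / 3\<close> cost at most \<open>2 * n / 3 * ln 4\<close> by
  Chebyshev's bound; those from there to \<open>n\<close> cost nothing. The binomial coefficient has
  logarithm at least \<open>n * ln 4 - ln (2 * n)\<close>, so a third of \<open>n * ln 4\<close> is
  left for the primes above \<open>n\<close>.\<close>

lemma sum_ln_primes_double_ge:
  assumes "n \<ge> 5"
  shows "(\<Sum>p | prime p \<and> n < p \<and> p \<le> 2 * n. ln (real p)) \<ge>
    real n * ln 4 / 3 - (sqrt (2 * real n) + 1) * ln (2 * real n)"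
proof -
  let ?C = "2 * n choose n"
  let ?P = "{p::nat. prime p \<and> p \<le> 2 * n}"
  have C: "?C > 0" by simp
  have "?C = (\<Prod>p\<in>prime_factors ?C. p ^ multiplicity p ?C)"
    using prod_prime_factors[of ?C] by simp
  also have "\<dots> = (\<Prod>p\<in>?P. p ^ multiplicity p ?C)"
  proof (intro prod.mono_neutral_left finite_primes_le ballI subsetI)
    fix p assume p: "p \<in> prime_factors ?C"
    then have "prime p" "p dvd ?C" by auto
    then have "p dvd fact (2 * n)"
      using binomial_fact_lemma[of n "2 * n"] by (metis dvd_mult le_add1 mult_2)
    then show "p \<in> ?P" using \<open>prime p\<close> by (simp add: prime_dvd_fact_iff)
  next
    fix p assume "p \<in> ?P - prime_factors ?C"
    then have "\<not> p dvd ?C" by (auto simp: prime_factors_dvd)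
    then show "p ^ multiplicity p ?C = 1" by (simp add: not_dvd_imp_multiplicity_0)
  qed
  finally have "real ?C = (\<Prod>p\<in>?P. real p ^ multiplicity p ?C)"
    by (metis (no_types, lifting) of_nat_power of_nat_prod prod.cong)
  then have "ln (real ?C) = (\<Sum>p\<in>?P. ln (real p ^ multiplicity p ?C))"
    by (simp only:) (intro ln_prod finite_primes_le; auto simp: prime_gt_0_nat)
  also have "\<dots> \<le> (\<Sum>p\<in>?P. of_bool (p\<^sup>2 \<le> 2 * n) * ln (2 * real n) + of_bool (3 * p \<le> 2 * n) * ln (real p) +
      of_bool (n < p) * ln (real p))"
  proof (rule sum_mono)
    fix p assume p: "p \<in> ?P"
    then have pr: "prime p" and p2: "p \<ge> 2" by (auto simp: prime_ge_2_nat)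
    let ?v = "multiplicity p ?C"
    have ln_nonneg: "ln (real p) \<ge> 0" "ln (2 * real n) \<ge> 0" using p2 assms by auto
    consider "p\<^sup>2 \<le> 2 * n" | "p\<^sup>2 > 2 * n" "3 * p \<le> 2 * n \<or> n < p"
      | "p\<^sup>2 > 2 * n" "2 * n < 3 * p" "p \<le> n" by linarith
    then show "ln (real p ^ ?v) \<le> of_bool (p\<^sup>2 \<le> 2 * n) * ln (2 * real n) +
        of_bool (3 * p \<le> 2 * n) * ln (real p) + of_bool (n < p) * ln (real p)"
    proof cases
      case 1
      have "p ^ ?v \<le> 2 * n" using assms by (intro prime_power_central_binomial_le pr) auto
      then have "real p ^ ?v \<le> 2 * real n" by (metis of_nat_le_iff of_nat_mult of_nat_numeral of_nat_power)
      then have "ln (real p ^ ?v) \<le> ln (2 * real n)" using p2 by (intro ln_mono) auto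
      then show ?thesis using 1 ln_nonneg by (auto intro!: add_increasing2)
    next
      case 2
      have "?v \<le> 1" using 2 by (intro multiplicity_central_binomial_le_1 pr)
      then have "real ?v * ln (real p) \<le> 1 * ln (real p)" using ln_nonneg by (intro mult_right_mono) auto
      then have "ln (real p ^ ?v) \<le> ln (real p)" using p2 by (simp add: ln_realpow)
      then show ?thesis using 2 ln_nonneg by auto
    next
      case 3
      then have "?v = 0" using assms by (intro multiplicity_central_binomial_eq_0 pr) auto
      then show ?thesis using ln_nonneg by simp
    qed
  qed
  also have "\<dots> = (\<Sum>p\<in>{p\<in>?P. p\<^sup>2 \<le> 2 * n}. ln (2 * real n)) + (\<Sum>p\<in>{p\<in>?P. 3 * p \<le> 2 * n}. ln (real p)) +
      (\<Sum>p\<in>{p\<in>?P. n < p}. ln (real p))"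
  proof -
    have "(\<Sum>p\<in>?P. of_bool (Q p) * f p) = (\<Sum>p\<in>{p\<in>?P. Q p}. f p)" for Q and f :: "nat \<Rightarrow> real"
      by (intro sum.mono_neutral_cong_right finite_primes_le) auto
    then show ?thesis by (simp only: sum.distrib)
  qed
  also have "{p\<in>?P. n < p} = {p. prime p \<and> n < p \<and> p \<le> 2 * n}" by auto
  also have "(\<Sum>p\<in>{p\<in>?P. p\<^sup>2 \<le> 2 * n}. ln (2 * real n)) \<le> sqrt (2 * real n) * ln (2 * real n)"
  proof -
    have "{p\<in>?P. p\<^sup>2 \<le> 2 * n} \<subseteq> {1..nat \<lfloor>sqrt (2 * real n)\<rfloor>}"
    proof
      fix p assume p: "p \<in> {p\<in>?P. p\<^sup>2 \<le> 2 * n}"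
      then have "real (p\<^sup>2) \<le> real (2 * n)" by (simp only: of_nat_le_iff) simp
      then have "real p \<le> sqrt (2 * real n)" by (intro real_le_rsqrt) simp
      then show "p \<in> {1..nat \<lfloor>sqrt (2 * real n)\<rfloor>}" using p prime_ge_1_nat by (auto simp: le_nat_floor)
    qed
    then have "card {p\<in>?P. p\<^sup>2 \<le> 2 * n} \<le> nat \<lfloor>sqrt (2 * real n)\<rfloor>"
      by (rule order_trans[OF card_mono[OF finite_atLeastAtMost]]) simp
    then have "real (card {p\<in>?P. p\<^sup>2 \<le> 2 * n}) \<le> real (nat \<lfloor>sqrt (2 * real n)\<rfloor>)"
      by (simp only: of_nat_le_iff)
    also have "\<dots> \<le> sqrt (2 * real n)" by (intro of_nat_floor) simp
    finally have "real (card {p\<in>?P. p\<^sup>2 \<le> 2 * n}) \<le> sqrt (2 * real n)" .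
    then show ?thesis using assms by (simp add: mult_right_mono)
  qed
  also have "(\<Sum>p\<in>{p\<in>?P. 3 * p \<le> 2 * n}. ln (real p)) \<le> 2 * real n / 3 * ln 4"
  proof -
    have "{p\<in>?P. 3 * p \<le> 2 * n} = {p. prime p \<and> p \<le> 2 * n div 3}" by auto
    then have "(\<Sum>p\<in>{p\<in>?P. 3 * p \<le> 2 * n}. ln (real p)) \<le> real (2 * n div 3) * ln 4"
      using sum_ln_primes_le[of "2 * n div 3"] by simp
    also have "\<dots> \<le> 2 * real n / 3 * ln 4"
      using of_nat_div_le_of_nat[of "2 * n" 3, where 'a = real] by (intro mult_right_mono) auto
    finally show ?thesis .
  qed
  finally have upper: "ln (real ?C) \<le> sqrt (2 * real n) * ln (2 * real n) + 2 * real n / 3 * ln 4 +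
      (\<Sum>p | prime p \<and> n < p \<and> p \<le> 2 * n. ln (real p))" by simp
  have "ln (4 ^ n / (2 * real n)) \<le> ln (real ?C)"
    using central_binomial_lower_bound[of n] assms by (intro ln_mono) auto
  then have "real n * ln 4 - ln (2 * real n) \<le> ln (real ?C)"
    using assms by (simp add: ln_div ln_realpow)
  with upper show ?thesis by (simp add: algebra_simps)
qed

text \<open>With \<open>t\<close> the fourth root of \<open>y\<close>, the main term is at least
  \<open>y / 6 - 1 / 3\<close> and the error at most \<open>4 * t ^ 3 + 4 * t\<close>;
  \<open>t >= 100\<close> makes the latter fit into the gap between \<open>y / 6\<close> and
  \<open>y / 10\<close>.\<close>

lemma dyadic_log_sum_ge:
  assumes "y \<ge> 100 ^ 4"
  shows "dyadic_log_sum UNIV y \<ge> y / 10"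
proof -
  define n where "n = nat \<lfloor>y / 2\<rfloor>"
  define t where "t = root 4 y"
  have y: "y \<ge> 100000000" using assms by simp
  have t: "t ^ 4 = y" "t \<ge> 100"
  proof -
    show "t ^ 4 = y" unfolding t_def by (rule real_root_pow_pos2) (use y in auto)
    have "root 4 (100 ^ 4) \<le> root 4 y" by (rule real_root_le_mono[OF _ assms]) simp
    moreover have "root 4 (100 ^ 4) = 100" by (rule real_root_power_cancel) auto
    ultimately show "t \<ge> 100" unfolding t_def by linarith
  qed
  have "real n = of_int \<lfloor>y / 2\<rfloor>" unfolding n_def using y by simp
  then have n: "real n \<le> y / 2" "y / 2 - 1 < real n" by linarith+
  have "n \<ge> 5" using n y by linarith
  have sub: "{p. prime p \<and> n < p \<and> p \<le> 2 * n} \<subseteq> {p. prime p \<and> p \<in> UNIV \<and> y / 2 < real p \<and> real p \<le> y}"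
    using n by auto
  have "finite {p. prime p \<and> p \<in> UNIV \<and> y / 2 < real p \<and> real p \<le> y}"
    by (rule finite_subset[of _ "{..nat \<lfloor>y\<rfloor>}"]) (auto simp: le_nat_floor)
  then have le: "(\<Sum>p | prime p \<and> n < p \<and> p \<le> 2 * n. ln (real p)) \<le> dyadic_log_sum UNIV y"
    unfolding dyadic_log_sum_def using sub prime_ge_1_nat
    by (intro sum_mono2) auto
  have "exp 1 \<le> (4::real)" using exp_le by simp
  then have ln4: "ln (4::real) \<ge> 1" by (simp add: ln_ge_iff)
  have ln_le: "ln (2 * real n) \<le> 4 * t"
  proof -
    have "ln (2 * real n) \<le> ln (t ^ 4)" using n \<open>n \<ge> 5\<close> t by (intro ln_mono) auto
    also have "\<dots> = 4 * ln t" using t(2) by (simp add: ln_realpow)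
    also have "\<dots> \<le> 4 * t" using ln_le_minus_one[of t] t by simp
    finally show ?thesis .
  qed
  have sqrt_le: "sqrt (2 * real n) \<le> t\<^sup>2"
    using n t by (intro real_le_lsqrt) (auto simp: power_mult[symmetric])
  have "(sqrt (2 * real n) + 1) * ln (2 * real n) \<le> (t\<^sup>2 + 1) * (4 * t)"
    using ln_le sqrt_le \<open>n \<ge> 5\<close> by (intro mult_mono) auto
  moreover have "real n * ln 4 / 3 \<ge> (y / 2 - 1) / 3"
  proof (rule divide_right_mono)
    have "y / 2 - 1 \<le> real n * 1" using n by simp
    also have "\<dots> \<le> real n * ln 4" using ln4 by (intro mult_left_mono) auto
    finally show "y / 2 - 1 \<le> real n * ln 4" .
  qed simp
  moreover have "(y / 2 - 1) / 3 - (t\<^sup>2 + 1) * (4 * t) \<ge> y / 10"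
  proof -
    have "100 * t ^ 3 \<le> t * t ^ 3" using t(2) by (intro mult_right_mono) auto
    then have "100 * t ^ 3 \<le> t ^ 4" by (simp add: eval_nat_numeral)
    moreover have "10000 * t \<le> t ^ 3"
      using mult_right_mono[OF power_mono[OF t(2), of 2], of t] t(2) by (simp add: eval_nat_numeral)
    moreover have eq: "(t\<^sup>2 + 1) * (4 * t) = 4 * t ^ 3 + 4 * t" by (simp add: algebra_simps eval_nat_numeral)
    moreover have eq': "(t ^ 4 / 2 - 1) / 3 = t ^ 4 / 6 - 1 / 3" by (simp add: field_simps)
    ultimately show ?thesis unfolding t(1)[symmetric] eq eq' using t(2) by linarith
  qed
  ultimately show ?thesis using sum_ln_primes_double_ge[OF \<open>n \<ge> 5\<close>] le by linarith
qed

section \<open>Squarefree moduli as sets of primes\<close>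

lemma prime_factors_prod_primes:
  fixes T :: "nat set"
  assumes "finite T" "\<And>p. p \<in> T \<Longrightarrow> prime p"
  shows "prime_factors (\<Prod>T) = T"
  using assms
proof (induction T rule: finite_induct)
  case (insert p T)
  have "p > 0" "\<Prod>T > 0" using insert.prems prime_gt_0_nat by (auto intro!: prod_pos)
  then have "p \<noteq> 0" "\<Prod>T \<noteq> 0" by auto
  then have "prime_factors (p * \<Prod>T) = prime_factors p \<union> prime_factors (\<Prod>T)"
    by (rule prime_factors_product)
  then show ?case using insert by (simp add: prime_prime_factors)
qed simp

lemma squarefree_prod_primes:
  fixes T :: "nat set"
  assumes "finite T" "\<And>p. p \<in> T \<Longrightarrow> prime p"
  shows "squarefree (\<Prod>T)"
  using assms
proof (induction T rule: finite_induct)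
  case (insert p T)
  have "coprime p (\<Prod>T)"
    using insert by (intro prod_coprime_right primes_coprime) auto
  then show ?case using insert by (simp add: squarefree_mult_coprime squarefree_prime)
qed simp

lemma prod_prime_factors_squarefree:
  fixes q :: nat
  assumes "squarefree q"
  shows "\<Prod>(prime_factors q) = q"
proof -
  have "q \<noteq> 0" using assms by (auto intro: ccontr)
  then have "q = (\<Prod>p\<in>prime_factors q. p ^ multiplicity p q)"
    using prod_prime_factors[of q] by simp
  also have "\<dots> = \<Prod>(prime_factors q)"
    using assms \<open>q \<noteq> 0\<close> by (intro prod.cong) (auto simp: squarefree_factorial_semiring')
  finally show ?thesis by simp
qed

text \<open>A set in the family stands for the squarefree number \<open>\<Prod>T\<close>, the empty
  set for 1, so that sums over squarefree moduli fit both sieves.\<close>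

definition prime_family :: "nat set \<Rightarrow> real \<Rightarrow> nat set set" where
  "prime_family P Q = {T. finite T \<and> T \<subseteq> P \<and> (\<forall>p\<in>T. prime p) \<and> real (\<Prod>T) \<le> Q}"

lemma prime_familyD:
  assumes "T \<in> prime_family P Q"
  shows "finite T" "T \<subseteq> P" "p \<in> T \<Longrightarrow> prime p" "real (\<Prod>T) \<le> Q" "\<Prod>T > 0"
  using assms prime_gt_0_nat by (auto simp: prime_family_def intro!: prod_pos)

lemma prime_family_down_closed:
  assumes "T \<in> prime_family P Q" "T' \<subseteq> T"
  shows "T' \<in> prime_family P Q"
proof -
  note T = prime_familyD[OF assms(1)]
  have "\<Prod>T' \<le> \<Prod>T"
    using T(1,5) assms(2) by (intro dvd_imp_le prod_dvd_prod_subset) auto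
  then have "real (\<Prod>T') \<le> Q" using T(4) by linarith
  then show ?thesis using assms T finite_subset by (auto simp: prime_family_def)
qed

lemma finite_prime_family: "finite (prime_family P Q)"
proof -
  have "prime_family P Q \<subseteq> Pow {..nat \<lfloor>Q\<rfloor>}"
  proof (intro subsetI PowI)
    fix T p assume T: "T \<in> prime_family P Q" "p \<in> T"
    note D = prime_familyD[OF T(1)]
    have "p dvd \<Prod>T" using D(1) T(2) by (rule dvd_prodI)
    then have "p \<le> \<Prod>T" using D(5) by (rule dvd_imp_le)
    then have "real p \<le> Q" using D(4) by linarith
    then show "p \<in> {..nat \<lfloor>Q\<rfloor>}" by (simp add: le_nat_floor)
  qed
  then show ?thesis by (rule finite_subset) simp
qed

lemma empty_in_prime_family: "Q \<ge> 1 \<Longrightarrow> {} \<in> prime_family P Q"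
  by (simp add: prime_family_def)

lemma prod_in_prime_family:
  assumes "T \<in> prime_family P Q"
  shows "composed_of P (\<Prod>T)" "prime_factors (\<Prod>T) = T" "squarefree (\<Prod>T)"
proof -
  note T = prime_familyD[OF assms]
  show pf: "prime_factors (\<Prod>T) = T" using T by (intro prime_factors_prod_primes) auto
  show "squarefree (\<Prod>T)" using T by (intro squarefree_prod_primes) auto
  have "p \<in> prime_factors (\<Prod>T)" if "prime p" "p dvd \<Prod>T" for p
    using that T(5) by (intro prime_factorsI) auto
  then show "composed_of P (\<Prod>T)" using T(2) unfolding composed_of_def pf by auto
qed

text \<open>Squarefree numbers correspond to their sets of prime factors. The predicate
  \<open>R\<close> lets one bijection serve both the full range and the range
  \<open>q > 1\<close>.\<close>

lemma sum_moebius_mu_sq: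
  fixes g :: "nat \<Rightarrow> real"
  shows "(\<Sum>q | 1 \<le> q \<and> real q \<le> Q \<and> composed_of P q \<and> R q. (real_of_int (moebius_mu q))\<^sup>2 * g q) =
    (\<Sum>T | T \<in> prime_family P Q \<and> R (\<Prod>T). g (\<Prod>T))"
proof -
  let ?A = "{q. 1 \<le> q \<and> real q \<le> Q \<and> composed_of P q \<and> R q}"
  have fin: "finite ?A"
    by (rule finite_subset[of _ "{..nat \<lfloor>Q\<rfloor>}"]) (auto simp: le_nat_floor)
  have mu: "(real_of_int (moebius_mu q))\<^sup>2 = of_bool (squarefree q)" for q
    by (simp add: moebius_mu_def flip: power_mult)
  have "(\<Sum>q\<in>?A. (real_of_int (moebius_mu q))\<^sup>2 * g q) = (\<Sum>q | q \<in> ?A \<and> squarefree q. g q)"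
    unfolding mu using fin by (intro sum.mono_neutral_cong_right) auto
  also have "\<dots> = (\<Sum>T | T \<in> prime_family P Q \<and> R (\<Prod>T). g (\<Prod>T))"
  proof (rule sum.reindex_bij_witness[where i = "\<lambda>T. \<Prod>T" and j = prime_factors])
    fix q assume q: "q \<in> {q. q \<in> ?A \<and> squarefree q}"
    then show e: "\<Prod>(prime_factors q) = q" by (intro prod_prime_factors_squarefree) auto
    from q have "prime_factors q \<subseteq> P" by (auto simp: composed_of_def)
    then show "prime_factors q \<in> {T \<in> prime_family P Q. R (\<Prod>T)}"
      unfolding prime_family_def mem_Collect_eq e using q by auto
    show "g (\<Prod>(prime_factors q)) = g q" by (simp only: e)
  next
    fix T assume T: "T \<in> {T \<in> prime_family P Q. R (\<Prod>T)}"
    then have T': "T \<in> prime_family P Q" by simp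
    show "prime_factors (\<Prod>T) = T" by (rule prod_in_prime_family[OF T'])
    show "\<Prod>T \<in> {q. q \<in> ?A \<and> squarefree q}"
      using prod_in_prime_family[OF T'] prime_familyD(4,5)[OF T'] T by (auto simp: Suc_le_eq)
  qed
  finally show ?thesis .
qed

lemma prod_gt_1_iff_in_prime_family:
  assumes "T \<in> prime_family P Q"
  shows "\<Prod>T > 1 \<longleftrightarrow> T \<noteq> {}"
proof
  note T = prime_familyD[OF assms]
  assume "T \<noteq> {}"
  then obtain p where p: "p \<in> T" by auto
  then have "p dvd \<Prod>T" using T(1) by (intro dvd_prodI)
  then have "p \<le> \<Prod>T" using T(5) by (rule dvd_imp_le)
  then show "\<Prod>T > 1" using prime_gt_1_nat[OF T(3)[OF p]] by linarith
qed auto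

lemma sum_moebius_mu_sq_gt_1:
  fixes g :: "nat \<Rightarrow> real"
  shows "(\<Sum>q | 1 < q \<and> real q \<le> Q \<and> composed_of P q. (real_of_int (moebius_mu q))\<^sup>2 * g q) =
    (\<Sum>T\<in>prime_family P Q - {{}}. g (\<Prod>T))"
proof -
  have "{q. 1 < q \<and> real q \<le> Q \<and> composed_of P q} =
      {q. 1 \<le> q \<and> real q \<le> Q \<and> composed_of P q \<and> 1 < q}" by auto
  moreover have "prime_family P Q - {{}} = {T. T \<in> prime_family P Q \<and> 1 < \<Prod>T}"
    using prod_gt_1_iff_in_prime_family by blast
  ultimately show ?thesis using sum_moebius_mu_sq[where Q = Q and P = P and R = "\<lambda>q. 1 < q" and g = g] by simp
qed

text \<open>Removing from a set that meets \<open>Z\<close> a common element \<open>p\<close> costs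
  the factor \<open>f p\<close> and stays in \<open>D\<close>, so these sets contribute at most the
  sum of \<open>f\<close> over \<open>Z\<close> times the full sum. The summand 1 accounts for the
  empty set.\<close>

lemma sum_prod_avoiding_ge:
  fixes f :: "'a \<Rightarrow> real"
  assumes finD: "finite D" and finT: "\<And>T. T \<in> D \<Longrightarrow> finite T"
    and down: "\<And>T T'. T \<in> D \<Longrightarrow> T' \<subseteq> T \<Longrightarrow> T' \<in> D"
    and "finite Z" and nonneg: "\<And>p. f p \<ge> 0"
  shows "(\<Sum>T\<in>{T \<in> D. T \<inter> Z = {}} - {{}}. \<Prod>p\<in>T. f p) \<ge>
    (\<Sum>T\<in>D - {{}}. \<Prod>p\<in>T. f p) - (\<Sum>p\<in>Z. f p) * (1 + (\<Sum>T\<in>D - {{}}. \<Prod>p\<in>T. f p))"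
proof -
  let ?F = "\<lambda>T. \<Prod>p\<in>T. f p"
  have F: "?F T \<ge> 0" for T using nonneg by (intro prod_nonneg) auto
  have "sum ?F (D - {{}}) = sum ?F ({T \<in> D. T \<inter> Z = {}} - {{}}) + sum ?F {T \<in> D. T \<inter> Z \<noteq> {}}"
    using finD by (subst sum.union_disjoint[symmetric]) (auto intro!: sum.cong)
  moreover have "sum ?F {T \<in> D. T \<inter> Z \<noteq> {}} \<le> (\<Sum>p\<in>Z. f p * sum ?F D)"
  proof -
    have "sum ?F {T \<in> D. T \<inter> Z \<noteq> {}} \<le> (\<Sum>T\<in>D. \<Sum>p\<in>Z. of_bool (p \<in> T) * ?F T)"
    proof -
      have "sum ?F {T \<in> D. T \<inter> Z \<noteq> {}} \<le> (\<Sum>T | T \<in> D \<and> T \<inter> Z \<noteq> {}. \<Sum>p\<in>Z. of_bool (p \<in> T) * ?F T)"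
      proof (rule sum_mono)
        fix T assume "T \<in> {T \<in> D. T \<inter> Z \<noteq> {}}"
        then obtain p where p: "p \<in> T" "p \<in> Z" by auto
        have "of_bool (p \<in> T) * ?F T \<le> (\<Sum>p\<in>Z. of_bool (p \<in> T) * ?F T)"
          using F \<open>finite Z\<close> p by (intro member_le_sum) auto
        then show "?F T \<le> (\<Sum>p\<in>Z. of_bool (p \<in> T) * ?F T)" using p by simp
      qed
      also have "\<dots> \<le> (\<Sum>T\<in>D. \<Sum>p\<in>Z. of_bool (p \<in> T) * ?F T)"
        using finD F by (intro sum_mono2 sum_nonneg) auto
      finally show ?thesis .
    qed
    also have "\<dots> = (\<Sum>p\<in>Z. \<Sum>T\<in>D. of_bool (p \<in> T) * ?F T)"
      by (rule sum.swap)
    also have "\<dots> = (\<Sum>p\<in>Z. sum ?F {T \<in> D. p \<in> T})"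
      using finD by (intro sum.cong refl sum.mono_neutral_cong_right) auto
    also have "\<dots> \<le> (\<Sum>p\<in>Z. f p * sum ?F D)"
    proof (rule sum_mono)
      fix p assume "p \<in> Z"
      have "sum ?F {T \<in> D. p \<in> T} = (\<Sum>T | T \<in> D \<and> p \<in> T. f p * ?F (T - {p}))"
        using finT by (intro sum.cong refl prod.remove) auto
      also have "\<dots> = f p * sum ?F ((\<lambda>T. T - {p}) ` {T \<in> D. p \<in> T})"
        by (subst sum.reindex) (auto simp: sum_distrib_left inj_on_def)
      also have "\<dots> \<le> f p * sum ?F D"
        using finD F nonneg down by (intro mult_left_mono sum_mono2) auto
      finally show "sum ?F {T \<in> D. p \<in> T} \<le> f p * sum ?F D" .
    qed
    finally show ?thesis .
  qed
  moreover have "sum ?F D \<le> 1 + sum ?F (D - {{}})"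
    using finD by (cases "{} \<in> D") (auto simp: sum.remove[of D "{}"])
  then have "(\<Sum>p\<in>Z. f p * sum ?F D) \<le> (\<Sum>p\<in>Z. f p) * (1 + sum ?F (D - {{}}))"
    unfolding sum_distrib_right using nonneg by (intro sum_mono mult_left_mono) auto
  ultimately show ?thesis by linarith
qed

text \<open>A colouring of \<open>E\<close> with three colours splits its product into three
  factors, whose prime factors recover the colouring.\<close>

lemma three_power_le_tau3:
  fixes E :: "nat set"
  assumes "finite E" and primes: "\<And>p. p \<in> E \<Longrightarrow> prime p"
  shows "3 ^ card E \<le> tau3 (\<Prod>E)"
proof -
  let ?X = "{(u, v, w). u > 0 \<and> v > 0 \<and> w > 0 \<and> u * v * w = \<Prod>E}"
  let ?part = "\<lambda>g i. {p \<in> E. g p = (i::nat)}"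
  let ?m = "\<lambda>g. (\<Prod>(?part g 0), \<Prod>(?part g 1), \<Prod>(?part g 2))"
  have pos: "\<Prod>E > 0" using primes prime_gt_0_nat by (intro prod_pos) auto
  have "?X \<subseteq> {..\<Prod>E} \<times> {..\<Prod>E} \<times> {..\<Prod>E}"
  proof clarify
    fix u v w assume *: "u > 0" "v > 0" "w > 0" "u * v * w = \<Prod>E"
    have "u dvd u * v * w" "v dvd u * v * w" "w dvd u * v * w" by auto
    then show "u \<in> {..\<Prod>E} \<and> (v, w) \<in> {..\<Prod>E} \<times> {..\<Prod>E}"
      unfolding *(4) using pos by (auto intro: dvd_imp_le)
  qed
  then have fin: "finite ?X" by (rule finite_subset) auto
  have factors: "prime_factors (\<Prod>(?part g i)) = ?part g i" for g i
    using assms by (intro prime_factors_prod_primes) auto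
  have "inj_on ?m (PiE E (\<lambda>_. {..<3}))"
  proof (rule inj_onI)
    fix g g' assume g: "g \<in> PiE E (\<lambda>_. {..<3})" and g': "g' \<in> PiE E (\<lambda>_. {..<3})" and eq: "?m g = ?m g'"
    have prods: "\<Prod>(?part g 0) = \<Prod>(?part g' 0)" "\<Prod>(?part g 1) = \<Prod>(?part g' 1)"
        "\<Prod>(?part g 2) = \<Prod>(?part g' 2)"
      using eq by (simp_all only: prod.inject)
    have parts: "?part g 0 = ?part g' 0" "?part g 1 = ?part g' 1" "?part g 2 = ?part g' 2"
      using prods[THEN arg_cong, of prime_factors] unfolding factors .
    show "g = g'"
    proof (rule PiE_ext[OF g g'])
      fix p assume p: "p \<in> E"
      then have "g p < 3" using g by auto
      then consider "p \<in> ?part g 0" | "p \<in> ?part g 1" | "p \<in> ?part g 2" using p by force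
      then show "g p = g' p"
      proof cases
        case 1
        then have "p \<in> ?part g' 0" by (simp only: parts)
        then show ?thesis using 1 by simp
      next
        case 2
        then have "p \<in> ?part g' 1" by (simp only: parts)
        then show ?thesis using 2 by simp
      next
        case 3
        then have "p \<in> ?part g' 2" by (simp only: parts)
        then show ?thesis using 3 by simp
      qed
    qed
  qed
  moreover have "?m ` PiE E (\<lambda>_. {..<3}) \<subseteq> ?X"
  proof (rule image_subsetI)
    fix g assume g: "g \<in> PiE E (\<lambda>_. {..<3::nat})"
    have cover: "E = ?part g 0 \<union> ?part g 1 \<union> ?part g 2"
    proof -
      have "g p = 0 \<or> g p = 1 \<or> g p = 2" if "p \<in> E" for p
        using PiE_mem[OF g that] by auto
      then show ?thesis by blast
    qed
    have "\<Prod>(?part g 0) * \<Prod>(?part g 1) * \<Prod>(?part g 2) = \<Prod>(?part g 0 \<union> ?part g 1 \<union> ?part g 2)"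
    proof -
      have "\<Prod>(?part g 0 \<union> ?part g 1 \<union> ?part g 2) = \<Prod>(?part g 0 \<union> ?part g 1) * \<Prod>(?part g 2)"
        using assms(1) by (intro prod.union_disjoint) auto
      also have "\<Prod>(?part g 0 \<union> ?part g 1) = \<Prod>(?part g 0) * \<Prod>(?part g 1)"
        using assms(1) by (intro prod.union_disjoint) auto
      finally show ?thesis by simp
    qed
    also have "\<dots> = \<Prod>E" using cover by simp
    finally show "?m g \<in> ?X"
      using primes prime_gt_0_nat by (auto intro!: prod_pos)
  qed
  ultimately have "card (PiE E (\<lambda>_. {..<3::nat})) \<le> card ?X" using fin by (intro card_inj_on_le)
  then show ?thesis using assms(1) by (simp add: tau3_def card_PiE)
qed

text \<open>The colours 0, 1, 2 mark elements lying only in \<open>e\<close>, in both sets, and only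
  in \<open>d\<close>.\<close>

lemma card_pairs_with_union_le:
  assumes "finite E"
  shows "card {(d, e). d \<union> e = E} \<le> 3 ^ card E"
proof -
  have "{(d, e). d \<union> e = E} \<subseteq> (\<lambda>g. ({p \<in> E. g p \<ge> 1}, {p \<in> E. g p \<le> (1::nat)})) ` PiE E (\<lambda>_. {..<3})"
  proof clarify
    fix d e :: "'a set" assume "E = d \<union> e"
    let ?g = "restrict (\<lambda>p. if p \<in> d then if p \<in> e then 1 else 2 else (0::nat)) E"
    show "(d, e) \<in> (\<lambda>g. ({p \<in> d \<union> e. g p \<ge> 1}, {p \<in> d \<union> e. g p \<le> (1::nat)})) ` PiE (d \<union> e) (\<lambda>_. {..<3})"
      by (rule image_eqI[of _ _ ?g]) (auto simp: \<open>E = d \<union> e\<close>)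
  qed
  then have "card {(d, e). d \<union> e = E} \<le> card (PiE E (\<lambda>_. {..<3::nat}))"
    using assms by (intro surj_card_le) (auto intro!: finite_PiE)
  then show ?thesis using assms by (simp add: card_PiE)
qed

section \<open>The larger sieve\<close>

definition residues_mod :: "nat set \<Rightarrow> nat \<Rightarrow> nat" where
  "residues_mod A p = card ((\<lambda>a. a mod p) ` A)"

lemma residues_mod_pos: "finite A \<Longrightarrow> A \<noteq> {} \<Longrightarrow> residues_mod A p > 0"
  by (simp add: residues_mod_def card_gt_0_iff)

definition dist_nat :: "nat \<Rightarrow> nat \<Rightarrow> nat" where
  "dist_nat a b = nat \<bar>int a - int b\<bar>"

lemma mod_eq_iff_dvd_dist_nat: "a mod p = b mod p \<longleftrightarrow> p dvd dist_nat a b"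
proof -
  have "a mod p = b mod p \<longleftrightarrow> int a mod int p = int b mod int p"
    by (metis of_nat_eq_iff zmod_int)
  also have "\<dots> \<longleftrightarrow> int p dvd int a - int b" by (rule mod_eq_dvd_iff)
  also have "\<dots> \<longleftrightarrow> p dvd dist_nat a b"
  proof -
    have "int (dist_nat a b) = \<bar>int a - int b\<bar>" by (simp add: dist_nat_def)
    then show ?thesis by (metis dvd_abs_iff int_dvd_int_iff)
  qed
  finally show ?thesis .
qed

lemma dist_nat_pos: "a \<noteq> b \<Longrightarrow> dist_nat a b > 0"
  by (auto simp: dist_nat_def)

lemma sum_ln_prime_divisors_le:
  assumes "m > 0" "finite P" "\<And>p. p \<in> P \<Longrightarrow> prime p \<and> p dvd m"
  shows "(\<Sum>p\<in>P. ln (real p)) \<le> ln (real m)"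
proof -
  have "(\<Sum>p\<in>P. ln (real p)) = ln (real (\<Prod>P))"
    unfolding of_nat_prod using assms prime_gt_0_nat by (intro ln_prod[symmetric]) auto
  also have "\<dots> \<le> ln (real m)"
  proof (rule ln_mono)
    have "P \<subseteq> prime_factors m" using assms by (auto simp: prime_factors_dvd)
    then have "\<Prod>P dvd \<Prod>(prime_factors m)" by (intro prod_dvd_prod_subset) auto
    also have "\<dots> dvd (\<Prod>p\<in>prime_factors m. p ^ multiplicity p m)"
      by (intro prod_dvd_prod) (auto simp: prime_factors_multiplicity intro: dvd_power)
    also have "\<dots> = m" using prod_prime_factors[of m] assms(1) by simp
    finally show "real (\<Prod>P) \<le> real m" using assms(1) by (simp only: of_nat_le_iff) (rule dvd_imp_le)
    show "real (\<Prod>P) > 0" using assms prime_gt_0_nat by (simp only: of_nat_0_less_iff) (intro prod_pos; auto)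
  qed
  finally show ?thesis .
qed

text \<open>Cauchy-Schwarz, written as nonnegativity of the variance of the class sizes around their
  mean \<open>t\<close>.\<close>

lemma card_congruent_pairs_ge:
  assumes "finite A" "A \<noteq> {}"
  shows "(real (card A))\<^sup>2 / real (residues_mod A p) \<le> real (card {(a, b) \<in> A \<times> A. a mod p = b mod p})"
proof -
  let ?R = "(\<lambda>a. a mod p) ` A" and ?c = "\<lambda>r. card {a \<in> A. a mod p = r}"
  have "{(a, b) \<in> A \<times> A. a mod p = b mod p} = (\<Union>r\<in>?R. {a \<in> A. a mod p = r} \<times> {a \<in> A. a mod p = r})"
    by auto
  then have "card {(a, b) \<in> A \<times> A. a mod p = b mod p} =
      card (\<Union>r\<in>?R. {a \<in> A. a mod p = r} \<times> {a \<in> A. a mod p = r})" by (rule arg_cong)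
  also have "\<dots> = (\<Sum>r\<in>?R. card ({a \<in> A. a mod p = r} \<times> {a \<in> A. a mod p = r}))"
    using assms by (intro card_UN_disjoint) auto
  finally have pairs: "real (card {(a, b) \<in> A \<times> A. a mod p = b mod p}) = (\<Sum>r\<in>?R. (real (?c r))\<^sup>2)"
    by (simp add: card_cartesian_product power2_eq_square)
  have "card A = card (\<Union>r\<in>?R. {a \<in> A. a mod p = r})" by (intro arg_cong[of _ _ card]) auto
  also have "\<dots> = (\<Sum>r\<in>?R. ?c r)" using assms by (intro card_UN_disjoint) auto
  finally have total: "real (card A) = (\<Sum>r\<in>?R. real (?c r))" by simp
  define \<nu> where "\<nu> = real (residues_mod A p)"
  define t where "t = real (card A) / \<nu>"
  have \<nu>: "\<nu> > 0" unfolding \<nu>_def using residues_mod_pos[OF assms, of p] by simp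
  have "0 \<le> (\<Sum>r\<in>?R. (real (?c r) - t)\<^sup>2)" by (intro sum_nonneg) auto
  also have "\<dots> = (\<Sum>r\<in>?R. (real (?c r))\<^sup>2) - 2 * t * (\<Sum>r\<in>?R. real (?c r)) + \<nu> * t\<^sup>2"
    by (simp add: power2_diff sum.distrib sum_subtractf sum_distrib_left mult_ac \<nu>_def residues_mod_def)
  also have "\<dots> = (\<Sum>r\<in>?R. (real (?c r))\<^sup>2) - (real (card A))\<^sup>2 / \<nu>"
    unfolding total[symmetric] using \<nu> by (simp add: t_def field_simps power2_eq_square)
  finally show ?thesis unfolding pairs \<nu>_def by simp
qed

text \<open>Gallagher's argument counts pairs of distinct elements congruent modulo
  \<open>p\<close>, weighted by \<open>ln p\<close>. Few occupied residues force many pairs, whereas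
  for a fixed pair the primes dividing the nonzero difference have logarithms adding up to at most
  \<open>ln x\<close>.\<close>

theorem larger_sieve:
  assumes A: "finite A" "A \<noteq> {}" "\<And>a. a \<in> A \<Longrightarrow> real a \<le> x" and "x \<ge> 1"
    and P: "finite P" "\<And>p. p \<in> P \<Longrightarrow> prime p"
  shows "(\<Sum>p\<in>P. ln (real p) / real (residues_mod A p)) \<le> ln x + (\<Sum>p\<in>P. ln (real p)) / real (card A)"
proof -
  let ?X = "{(a, b) \<in> A \<times> A. a \<noteq> b}" and ?n = "real (card A)"
  let ?C = "\<lambda>p. {(a, b) \<in> A \<times> A. a mod p = b mod p}"
  have n: "?n > 0" using A by (simp add: card_gt_0_iff)
  have finX: "finite ?X" by (rule finite_subset[of _ "A \<times> A"]) (use A in auto)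
  have lnp: "ln (real p) \<ge> 0" if "p \<in> P" for p
    using prime_ge_1_nat[of p] P(2)[OF that] by simp
  have "(\<Sum>p\<in>P. ln (real p) * (?n\<^sup>2 / real (residues_mod A p) - ?n)) \<le>
      (\<Sum>p\<in>P. \<Sum>t\<in>?X. if p dvd dist_nat (fst t) (snd t) then ln (real p) else 0)"
  proof (rule sum_mono)
    fix p assume p: "p \<in> P"
    have "?C p = (\<lambda>a. (a, a)) ` A \<union> {t \<in> ?X. p dvd dist_nat (fst t) (snd t)}"
      by (auto simp: mod_eq_iff_dvd_dist_nat dist_nat_def)
    then have "card (?C p) \<le> card ((\<lambda>a. (a, a)) ` A) + card {t \<in> ?X. p dvd dist_nat (fst t) (snd t)}"
      by (metis (no_types, lifting) card_Un_le)
    also have "card ((\<lambda>a. (a, a)) ` A) = card A" by (intro card_image) (auto simp: inj_on_def)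
    finally have "real (card (?C p)) - ?n \<le> real (card {t \<in> ?X. p dvd dist_nat (fst t) (snd t)})" by linarith
    then have "?n\<^sup>2 / real (residues_mod A p) - ?n \<le> real (card {t \<in> ?X. p dvd dist_nat (fst t) (snd t)})"
      using card_congruent_pairs_ge[OF A(1,2), of p] by linarith
    then have "ln (real p) * (?n\<^sup>2 / real (residues_mod A p) - ?n) \<le>
        ln (real p) * real (card {t \<in> ?X. p dvd dist_nat (fst t) (snd t)})"
      using lnp[OF p] by (rule mult_left_mono)
    also have "\<dots> = (\<Sum>t\<in>?X. if p dvd dist_nat (fst t) (snd t) then ln (real p) else 0)"
      using finX by (simp add: sum.If_cases Int_def mult.commute)
    finally show "ln (real p) * (?n\<^sup>2 / real (residues_mod A p) - ?n) \<le> \<dots>" .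
  qed
  also have "\<dots> = (\<Sum>t\<in>?X. \<Sum>p\<in>P. if p dvd dist_nat (fst t) (snd t) then ln (real p) else 0)"
    by (rule sum.swap)
  also have "\<dots> \<le> (\<Sum>t\<in>?X. ln x)"
  proof (rule sum_mono)
    fix t assume "t \<in> ?X"
    then obtain a b where t: "t = (a, b)" "a \<in> A" "b \<in> A" "a \<noteq> b" by auto
    have "(\<Sum>p\<in>P. if p dvd dist_nat a b then ln (real p) else 0) = (\<Sum>p | p \<in> P \<and> p dvd dist_nat a b. ln (real p))"
      using P(1) by (simp add: sum.If_cases Int_def)
    also have "\<dots> \<le> ln (real (dist_nat a b))"
      using P dist_nat_pos[OF t(4)] by (intro sum_ln_prime_divisors_le) auto
    also have "\<dots> \<le> ln x"
    proof (rule ln_mono)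
      have "real (dist_nat a b) \<le> max (real a) (real b)" by (auto simp: dist_nat_def)
      then show "real (dist_nat a b) \<le> x" using A(3)[OF t(2)] A(3)[OF t(3)] by simp
    qed (use dist_nat_pos[OF t(4)] in auto)
    finally show "(\<Sum>p\<in>P. if p dvd dist_nat (fst t) (snd t) then ln (real p) else 0) \<le> ln x"
      by (simp add: t)
  qed
  also have "\<dots> \<le> ?n\<^sup>2 * ln x"
  proof -
    have "card ?X \<le> card (A \<times> A)" using A by (intro card_mono) auto
    then have "real (card ?X) \<le> real (card A * card A)"
      by (simp only: of_nat_le_iff card_cartesian_product)
    then have "real (card ?X) \<le> ?n\<^sup>2" by (simp add: power2_eq_square)
    then show ?thesis using assms(4) by (simp add: mult_right_mono)
  qed
  finally have "(\<Sum>p\<in>P. ln (real p) * (?n\<^sup>2 / real (residues_mod A p) - ?n)) \<le> ?n\<^sup>2 * ln x" .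
  moreover have "(\<Sum>p\<in>P. ln (real p) * (?n\<^sup>2 / real (residues_mod A p) - ?n)) =
      ?n\<^sup>2 * ((\<Sum>p\<in>P. ln (real p) / real (residues_mod A p)) - (\<Sum>p\<in>P. ln (real p)) / ?n)"
    using n by (simp add: sum_subtractf sum_distrib_left sum_divide_distrib power2_eq_square algebra_simps)
  ultimately have "(\<Sum>p\<in>P. ln (real p) / real (residues_mod A p)) - (\<Sum>p\<in>P. ln (real p)) / ?n \<le> ln x"
    using n by (simp add: mult_le_cancel_left_pos)
  then show ?thesis by linarith
qed

lemma card_prime_factors_le:
  assumes "m > 0"
  shows "real (card (prime_factors m)) \<le> 2 * ln (real m)"
proof -
  \<comment> \<open>The constant 2 comes from \<open>ln p >= 1 / 2\<close>, that is, from
    \<open>exp (1 / 2) <= 2\<close>.\<close>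
  have "exp (1 / 2) * exp (1 / 2) \<le> (2 * 2 :: real)"
    using exp_le by (simp flip: exp_add)
  then have "exp (1 / 2) \<le> (2::real)"
    using mult_strict_mono[of "2::real" "exp (1/2)" 2 "exp (1/2)"] by force
  have "real (card (prime_factors m)) * (1 / 2) \<le> (\<Sum>p\<in>prime_factors m. ln (real p))"
  proof (rule sum_bounded_below)
    fix p assume "p \<in> prime_factors m"
    then have "prime p" by auto
    then have "real p \<ge> 2" using prime_ge_2_nat[of p] by simp
    then have "exp (1 / 2) \<le> real p" using \<open>exp (1 / 2) \<le> 2\<close> by linarith
    then show "1 / 2 \<le> ln (real p)" using \<open>real p \<ge> 2\<close> by (subst ln_ge_iff) auto
  qed
  also have "\<dots> \<le> ln (real m)" using assms by (intro sum_ln_prime_divisors_le) auto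
  finally show ?thesis by simp
qed

definition collision_primes :: "nat set \<Rightarrow> nat set" where
  "collision_primes A = {p. prime p \<and> (\<exists>a\<in>A. \<exists>b\<in>A. a \<noteq> b \<and> a mod p = b mod p)}"

text \<open>A collision prime divides one of fewer than \<open>(card A)\<^sup>2\<close> nonzero
  differences, or none exists; each difference has at most \<open>2 * ln x\<close> prime
  factors.\<close>

lemma collision_primes_bound:
  assumes A: "finite A" "\<And>a. a \<in> A \<Longrightarrow> real a \<le> x" and "x \<ge> 1"
  shows "finite (collision_primes A)" "real (card (collision_primes A)) \<le> (real (card A))\<^sup>2 * (2 * ln x)"
proof -
  let ?X = "{(a, b) \<in> A \<times> A. a \<noteq> b}"
  let ?f = "\<lambda>t. prime_factors (dist_nat (fst t) (snd t))"
  have finX: "finite ?X" by (rule finite_subset[of _ "A \<times> A"]) (use A in auto)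
  have sub: "collision_primes A \<subseteq> (\<Union>t\<in>?X. ?f t)"
  proof
    fix p assume "p \<in> collision_primes A"
    then obtain a b where ab: "prime p" "a \<in> A" "b \<in> A" "a \<noteq> b" "a mod p = b mod p"
      by (auto simp: collision_primes_def)
    then have "p \<in> ?f (a, b)"
      using dist_nat_pos[of a b] by (auto simp: prime_factors_dvd mod_eq_iff_dvd_dist_nat)
    then show "p \<in> (\<Union>t\<in>?X. ?f t)" using ab by blast
  qed
  then show "finite (collision_primes A)" by (rule finite_subset) (use finX in auto)
  have "card (collision_primes A) \<le> card (\<Union>t\<in>?X. ?f t)" using sub finX by (intro card_mono) auto
  also have "\<dots> \<le> (\<Sum>t\<in>?X. card (?f t))" using finX by (rule card_UN_le)
  finally have "real (card (collision_primes A)) \<le> (\<Sum>t\<in>?X. real (card (?f t)))"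
    by (simp only: of_nat_sum[symmetric] of_nat_le_iff)
  also have "\<dots> \<le> (\<Sum>t\<in>?X. 2 * ln x)"
  proof (rule sum_mono)
    fix t assume "t \<in> ?X"
    then obtain a b where t: "t = (a, b)" "a \<in> A" "b \<in> A" "a \<noteq> b" by auto
    have pos: "dist_nat a b > 0" by (rule dist_nat_pos[OF t(4)])
    have "real (dist_nat a b) \<le> max (real a) (real b)" by (auto simp: dist_nat_def)
    then have "real (dist_nat a b) \<le> x" using A(2)[OF t(2)] A(2)[OF t(3)] by simp
    then have "ln (real (dist_nat a b)) \<le> ln x" using pos by (intro ln_mono) auto
    then show "real (card (?f t)) \<le> 2 * ln x" using card_prime_factors_le[OF pos] by (simp add: t)
  qed
  also have "\<dots> \<le> (real (card A))\<^sup>2 * (2 * ln x)"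
  proof -
    have "card ?X \<le> card (A \<times> A)" using A by (intro card_mono) auto
    then have "real (card ?X) \<le> real (card A * card A)"
      by (simp only: of_nat_le_iff card_cartesian_product)
    then have "real (card ?X) \<le> (real (card A))\<^sup>2" by (simp add: power2_eq_square)
    then have "real (card ?X) * (2 * ln x) \<le> (real (card A))\<^sup>2 * (2 * ln x)"
      using \<open>x \<ge> 1\<close> by (intro mult_right_mono) auto
    then show ?thesis by simp
  qed
  finally show "real (card (collision_primes A)) \<le> (real (card A))\<^sup>2 * (2 * ln x)" .
qed

section \<open>Small summands\<close>

lemma residues_mod_eq_card:
  assumes "finite A" "prime p" "p \<notin> collision_primes A"
  shows "residues_mod A p = card A"
  unfolding residues_mod_def
  using assms by (intro card_image inj_onI) (auto simp: collision_primes_def)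

text \<open>The classes sifted from \<open>B\<close> are the negatives of the residues of
  \<open>A\<close>. A nonempty \<open>B\<close> needs a class outside them, so \<open>A\<close>
  cannot fill all classes; this keeps the denominators positive.\<close>

lemma residues_mod_less_and_large_sieve:
  fixes x :: real
  assumes AB: "finite A" "A \<noteq> {}" "B \<noteq> {}"
    and bound: "\<And>a b. a \<in> A \<Longrightarrow> b \<in> B \<Longrightarrow> real (a + b) \<le> x"
    and finD: "finite D" and finT: "\<And>T. T \<in> D \<Longrightarrow> finite T"
    and primes: "\<And>T p. T \<in> D \<Longrightarrow> p \<in> T \<Longrightarrow> prime p"
    and level: "\<And>T. T \<in> D \<Longrightarrow> (real (\<Prod>T))\<^sup>2 \<le> x"
    and free: "\<And>T p a b. T \<in> D \<Longrightarrow> p \<in> T \<Longrightarrow> a \<in> A \<Longrightarrow> b \<in> B \<Longrightarrow> \<not> p dvd a + b"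
  shows "\<And>T p. T \<in> D \<Longrightarrow> p \<in> T \<Longrightarrow> residues_mod A p < p"
    and "real (card B) * (\<Sum>T\<in>D. \<Prod>p\<in>T. real (residues_mod A p) / (real p - real (residues_mod A p))) \<le> 4 * x + 2"
proof -
  \<comment> \<open>The outer \<open>mod\<close> sends the negative of the class 0 to 0 instead of
    \<open>p\<close>.\<close>
  define \<Omega> where "\<Omega> p = (\<lambda>a. (p - a mod p) mod p) ` A" for p
  have card_\<Omega>: "card (\<Omega> p) = residues_mod A p" if "p > 0" for p
  proof -
    have "\<Omega> p = (\<lambda>r. (p - r) mod p) ` ((\<lambda>a. a mod p) ` A)" by (simp add: \<Omega>_def image_image)
    moreover have "inj_on (\<lambda>r. (p - r) mod p) {..<p}"
    proof (rule inj_onI)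
      fix r r' assume "r \<in> {..<p}" "r' \<in> {..<p}" "(p - r) mod p = (p - r') mod p"
      then show "r = r'" by (cases "r = 0"; cases "r' = 0") auto
    qed
    then have "inj_on (\<lambda>r. (p - r) mod p) ((\<lambda>a. a mod p) ` A)"
      by (rule inj_on_subset) (use that in auto)
    ultimately show ?thesis by (simp add: residues_mod_def card_image)
  qed
  have \<Omega>_sub: "\<Omega> p \<subseteq> {..<p}" if "p > 0" for p using that by (auto simp: \<Omega>_def)
  have unsifted: "b mod p \<notin> \<Omega> p" if "b \<in> B" "T \<in> D" "p \<in> T" for b T p
  proof
    assume "b mod p \<in> \<Omega> p"
    then obtain a where a: "a \<in> A" "b mod p = (p - a mod p) mod p" by (auto simp: \<Omega>_def)
    have p: "p > 0" using primes that prime_gt_0_nat by blast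
    have "(a + b) mod p = (a mod p + b mod p) mod p" by (simp add: mod_add_eq)
    also have "\<dots> = (a mod p + (p - a mod p)) mod p" unfolding a(2) by (simp add: mod_add_right_eq)
    also have "\<dots> = 0" using p by (simp add: less_imp_le)
    finally have "p dvd a + b" by (simp add: mod_0_imp_dvd)
    then show False using free[OF that(2,3) a(1) that(1)] by simp
  qed
  obtain b0 where b0: "b0 \<in> B" using AB by auto
  show less: "residues_mod A p < p" if T: "T \<in> D" "p \<in> T" for T p
  proof -
    have p: "p > 0" using primes that prime_gt_0_nat by blast
    have "b0 mod p \<in> {..<p}" using p by simp
    then have "\<Omega> p \<subset> {..<p}" using \<Omega>_sub[OF p] unsifted[OF b0 T] by blast
    then have "card (\<Omega> p) < card {..<p}" by (intro psubset_card_mono) auto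
    then show ?thesis using card_\<Omega>[OF p] by simp
  qed
  define N where "N = nat \<lfloor>x\<rfloor>"
  have x: "x \<ge> 0" using AB bound by (meson ex_in_conv of_nat_0_le_iff order_trans)
  have "real (card B) * (\<Sum>T\<in>D. \<Prod>p\<in>T. sieve_ratio \<Omega> p) \<le> 4 * real N + 2"
  proof (rule large_sieve[OF finD finT primes])
    show "(\<Prod>T)\<^sup>2 \<le> N" if "T \<in> D" for T
      using level[OF that] unfolding N_def by (intro le_nat_floor) simp
    show "B \<subseteq> {..N}"
    proof
      fix b assume b: "b \<in> B"
      obtain a where "a \<in> A" using AB by auto
      then have "real b \<le> x" using bound[of a b] b by simp
      then show "b \<in> {..N}" by (simp add: N_def le_nat_floor)
    qed
    show "\<Omega> p \<subseteq> {..<p} \<and> card (\<Omega> p) < p" if T: "T \<in> D" "p \<in> T" for T p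
    proof -
      have p: "p > 0" using primes that prime_gt_0_nat by blast
      show ?thesis using \<Omega>_sub[OF p] less[OF T] card_\<Omega>[OF p] by simp
    qed
  qed (use unsifted in auto)
  moreover have "(\<Sum>T\<in>D. \<Prod>p\<in>T. sieve_ratio \<Omega> p) =
      (\<Sum>T\<in>D. \<Prod>p\<in>T. real (residues_mod A p) / (real p - real (residues_mod A p)))"
  proof (intro sum.cong prod.cong refl)
    fix T p assume "T \<in> D" "p \<in> T"
    then have "p > 0" using primes prime_gt_0_nat by blast
    then show "sieve_ratio \<Omega> p = real (residues_mod A p) / (real p - real (residues_mod A p))"
      by (simp add: sieve_ratio_def card_\<Omega>)
  qed
  moreover have "real N \<le> x" unfolding N_def using x by (rule of_nat_floor)
  ultimately show "real (card B) * (\<Sum>T\<in>D. \<Prod>p\<in>T. real (residues_mod A p) / (real p - real (residues_mod A p))) \<le> 4 * x + 2"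
    by simp
qed

text \<open>
  There are at most \<open>2 * K\<^sup>2 * ln x\<close> collision primes, and each is at least \<open>K\<^sup>3\<close>, so the moduli divisible by
  one of them contribute little.
\<close>
lemma sum_avoiding_collisions_ge:
  assumes A: "finite A" "\<And>a. a \<in> A \<Longrightarrow> real a \<le> x" and x: "x \<ge> 1" and "ln x \<ge> 1"
    and K: "real (card A) \<le> K" "K \<ge> 1000 * ln x"
    and P: "\<And>p. p \<in> P \<Longrightarrow> real p \<ge> K ^ 3"
    and c: "0 \<le> c" "c \<le> 2"
    and large: "(\<Sum>T\<in>prime_family P Q - {{}}. \<Prod>p\<in>T. c / real p) \<ge> \<tau>" "\<tau> \<ge> 10"
  shows "(\<Sum>T\<in>{T \<in> prime_family P Q. T \<inter> (collision_primes A \<inter> P) = {}} - {{}}. \<Prod>p\<in>T. c / real p) \<ge> 49 / 50 * \<tau>"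
proof -
  let ?Z = "collision_primes A \<inter> P"
  let ?s = "\<Sum>T\<in>prime_family P Q - {{}}. \<Prod>p\<in>T. c / real p"
  let ?s' = "\<Sum>T\<in>{T \<in> prime_family P Q. T \<inter> ?Z = {}} - {{}}. \<Prod>p\<in>T. c / real p"
    have Kpos: "K > 0" using K(2) assms(4) by linarith
  have finZ: "finite ?Z" using collision_primes_bound(1)[OF A x] by simp
  have "?s' \<ge> ?s - (\<Sum>p\<in>?Z. c / real p) * (1 + ?s)"
    using finite_prime_family prime_familyD(1) prime_family_down_closed finZ c
    by (intro sum_prod_avoiding_ge) auto
  \<comment> \<open>At most \<open>2 * K\<^sup>2 * ln x\<close> terms of size
    \<open>2 / K ^ 3\<close> add up to \<open>4 * ln x / K\<close>, which
    \<open>K >= 1000 * ln x\<close> makes small.\<close>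
  moreover have "(\<Sum>p\<in>?Z. c / real p) \<le> 1 / 100"
  proof -
    have "(\<Sum>p\<in>?Z. c / real p) \<le> (\<Sum>p\<in>?Z. 2 / K ^ 3)"
      using P Kpos c by (intro sum_mono frac_le) auto
    also have "\<dots> \<le> real (card (collision_primes A)) * (2 / K ^ 3)"
      using Kpos collision_primes_bound(1)[OF A x] by (simp add: mult_right_mono card_mono divide_right_mono)
    also have "\<dots> \<le> ((real (card A))\<^sup>2 * (2 * ln x)) * (2 / K ^ 3)"
      using Kpos by (intro mult_right_mono collision_primes_bound(2)[OF A x]) auto
    also have "\<dots> \<le> (K\<^sup>2 * (2 * ln x)) * (2 / K ^ 3)"
      using K Kpos assms(4) by (intro mult_right_mono power_mono) auto
    also have "\<dots> = 4 * ln x / K" using Kpos by (simp add: eval_nat_numeral)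
    also have "\<dots> \<le> 1 / 100" using K(2) Kpos assms(4) by (simp add: field_simps)
    finally show ?thesis .
  qed
  then have "(\<Sum>p\<in>?Z. c / real p) * (1 + ?s) \<le> 1 / 100 * (1 + ?s)"
    using large by (intro mult_right_mono) auto
  ultimately have "?s' \<ge> 99 / 100 * ?s - 1 / 100" by simp
  then show ?thesis using large by linarith
qed

section \<open>The case in which the sieve controls the size\<close>

text \<open>Away from collisions every prime removes \<open>k = card A\<close> classes. Since
  \<open>T\<close> is nonempty and \<open>k >= 2\<close>, \<open>(k / 2) ^ card T\<close> is at
  least \<open>k / 2\<close>, so the sieve sum gains a factor \<open>k / 2\<close> over the sum of
  products of \<open>2 / p\<close>. This is why the hypothesis has numerators 2 and omits
  \<open>q = 1\<close>.\<close>

lemma card_product_small_if_sieve_controls_size: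
  fixes x :: real
  assumes AB: "finite A" "2 \<le> card A" "B \<noteq> {}"
    and bound: "\<And>a b. a \<in> A \<Longrightarrow> b \<in> B \<Longrightarrow> real (a + b) \<le> x"
    and x: "x \<ge> 10" "ln x \<ge> 1"
    and K: "real (card A) \<le> K" "K \<ge> 1000 * ln x"
    and P: "\<And>p. p \<in> P \<Longrightarrow> real p \<ge> K ^ 3"
    and free: "\<And>p a b. p \<in> P \<Longrightarrow> a \<in> A \<Longrightarrow> b \<in> B \<Longrightarrow> \<not> p dvd a + b"
    and large: "(\<Sum>T\<in>prime_family P (sqrt x) - {{}}. \<Prod>p\<in>T. 2 / real p) \<ge> \<tau>" "\<tau> \<ge> 10"
  shows "real (card A) * real (card B) * \<tau> < 10 * x"
proof -
  define k where "k = real (card A)"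
  let ?D = "{T \<in> prime_family P (sqrt x). T \<inter> (collision_primes A \<inter> P) = {}} - {{}}"
  have k: "k \<ge> 2" using AB by (simp add: k_def)
  have "A \<noteq> {}" using AB by auto
  obtain b0 where b0: "b0 \<in> B" using AB by auto
  have A_le: "real a \<le> x" if "a \<in> A" for a using bound[OF that b0] by simp
  have D: "finite T" "\<And>p. p \<in> T \<Longrightarrow> prime p" "T \<subseteq> P" "real (\<Prod>T) \<le> sqrt x" "T \<noteq> {}" if "T \<in> ?D" for T
    using that prime_familyD[of T P "sqrt x"] by auto
  have finD: "finite ?D" using finite_prime_family by auto
  have nu: "real (residues_mod A p) = k" if "T \<in> ?D" "p \<in> T" for T p
    using residues_mod_eq_card[OF AB(1), of p] D(2,3)[OF that(1)] that by (auto simp: k_def)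
  have level: "(real (\<Prod>T))\<^sup>2 \<le> x" if "T \<in> ?D" for T
  proof -
    have "(real (\<Prod>T))\<^sup>2 \<le> (sqrt x)\<^sup>2" using D(4)[OF that] by (intro power_mono) (auto intro: prod_nonneg)
    then show ?thesis using x by simp
  qed
  have free': "\<not> p dvd a + b" if "T \<in> ?D" "p \<in> T" "a \<in> A" "b \<in> B" for T p a b
    using free[of p a b] D(3)[OF that(1)] that by auto
  have less: "residues_mod A p < p" if "T \<in> ?D" "p \<in> T" for T p
    by (rule residues_mod_less_and_large_sieve(1)[of A B x ?D])
      (fact AB(1) \<open>A \<noteq> {}\<close> AB(3) bound finD D(1) D(2) level free' that)+
  have sieve: "real (card B) * (\<Sum>T\<in>?D. \<Prod>p\<in>T. real (residues_mod A p) / (real p - real (residues_mod A p))) \<le> 4 * x + 2"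
    by (rule residues_mod_less_and_large_sieve(2)[of A B x ?D])
      (fact AB(1) \<open>A \<noteq> {}\<close> AB(3) bound finD D(1) D(2) level free')+
  have "k / 2 * (49 / 50 * \<tau>) \<le> k / 2 * (\<Sum>T\<in>?D. \<Prod>p\<in>T. 2 / real p)"
    using k A_le x K P large AB by (intro mult_left_mono sum_avoiding_collisions_ge) auto
  also have "\<dots> \<le> (\<Sum>T\<in>?D. \<Prod>p\<in>T. real (residues_mod A p) / (real p - real (residues_mod A p)))"
    unfolding sum_distrib_left
  proof (rule sum_mono)
    fix T assume T: "T \<in> ?D"
    have "k / 2 * (\<Prod>p\<in>T. 2 / real p) \<le> (k / 2) ^ card T * (\<Prod>p\<in>T. 2 / real p)"
    proof (rule mult_right_mono)
      have "card T \<ge> 1" using D(1,5)[OF T] by (simp add: Suc_le_eq card_gt_0_iff)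
      then have "(k / 2) ^ 1 \<le> (k / 2) ^ card T" using k by (intro power_increasing) auto
      then show "k / 2 \<le> (k / 2) ^ card T" by simp
    qed (intro prod_nonneg, simp)
    also have "\<dots> = (\<Prod>p\<in>T. k / 2 * (2 / real p))" by (simp only: prod.distrib prod_constant)
    also have "\<dots> \<le> (\<Prod>p\<in>T. real (residues_mod A p) / (real p - real (residues_mod A p)))"
    proof (rule prod_mono)
      fix p assume p: "p \<in> T"
      have "k < real p" using less[OF T p] nu[OF T p] by simp
      then have "k / real p \<le> k / (real p - k)" using k by (intro divide_left_mono) auto
      then show "0 \<le> k / 2 * (2 / real p) \<and>
          k / 2 * (2 / real p) \<le> real (residues_mod A p) / (real p - real (residues_mod A p))"
        using k by (simp add: nu[OF T p])
    qed
    finally show "k / 2 * (\<Prod>p\<in>T. 2 / real p) \<le>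
        (\<Prod>p\<in>T. real (residues_mod A p) / (real p - real (residues_mod A p)))" .
  qed
  finally have "real (card B) * (k / 2 * (49 / 50 * \<tau>)) \<le>
      real (card B) * (\<Sum>T\<in>?D. \<Prod>p\<in>T. real (residues_mod A p) / (real p - real (residues_mod A p)))"
    by (intro mult_left_mono) auto
  also have "\<dots> \<le> 4 * x + 2" by (rule sieve)
  finally have "49 / 100 * (k * real (card B) * \<tau>) \<le> 4 * x + 2" by (simp add: mult_ac)
  then show ?thesis using x by (simp add: k_def)
qed

section \<open>The case of good distribution in residue classes\<close>

lemma max_discrepancy_ge:
  assumes "a \<in> totatives d"
  shows "\<bar>real (card {s \<in> S. [s = a] (mod d)}) - real (card S) / real (totient d)\<bar> \<le> max_discrepancy S d"
  unfolding max_discrepancy_def using assms by (intro Max_ge) auto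

lemma max_discrepancy_nonneg:
  assumes "d > 0"
  shows "max_discrepancy S d \<ge> 0"
proof -
  have "Suc 0 \<in> totatives d" using assms by simp
  then show ?thesis using max_discrepancy_ge[of "Suc 0" d S] by linarith
qed

lemma totient_prod_primes:
  fixes T :: "nat set"
  assumes "\<And>p. p \<in> T \<Longrightarrow> prime p"
  shows "totient (\<Prod>T) = (\<Prod>p\<in>T. p - 1)"
proof -
  have "pairwise coprime ((\<lambda>p. p) ` T)" using assms by (auto simp: pairwise_def intro: primes_coprime)
  then have "totient (\<Prod>T) = (\<Prod>p\<in>T. totient p)" by (rule totient_prod_coprime) auto
  also have "\<dots> = (\<Prod>p\<in>T. p - 1)" using assms by (intro prod.cong refl totient_prime) auto
  finally show ?thesis .
qed

text \<open>Nonzero prescribed residues make the class from the Chinese remainder theorem coprime to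
  the modulus, so it is among those over which \<open>max_discrepancy\<close> is taken.\<close>

lemma ex_totative_cong:
  fixes T :: "nat set"
  assumes "finite T" and primes: "\<And>p. p \<in> T \<Longrightarrow> prime p"
    and g: "\<And>p. p \<in> T \<Longrightarrow> 0 < g p \<and> g p < p"
  shows "\<exists>a\<in>totatives (\<Prod>T). \<forall>s. [s = a] (mod \<Prod>T) \<longleftrightarrow> (\<forall>p\<in>T. s mod p = g p)"
proof -
  have cop: "\<forall>p\<in>T. \<forall>q\<in>T. p \<noteq> q \<longrightarrow> coprime p q" using primes primes_coprime by blast
  obtain a0 where a0: "\<And>p. p \<in> T \<Longrightarrow> [a0 = g p] (mod p)"
    using chinese_remainder_nat[OF assms(1) cop, of g] by auto
  have pos: "\<Prod>T > 0" using primes prime_gt_0_nat by (intro prod_pos) auto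
  \<comment> \<open>For empty \<open>T\<close> the modulus is 1, whose only totative is 1, whereas
    reduction modulo 1 would give 0.\<close>
  define a where "a = (if T = {} then 1 else a0 mod \<Prod>T)"
  have a: "[a = g p] (mod p)" if "p \<in> T" for p
  proof -
    have "p dvd \<Prod>T" using assms(1) that by (rule dvd_prodI)
    then have "[a0 mod \<Prod>T = a0] (mod p)" by (simp add: cong_def mod_mod_cancel)
    then show ?thesis using a0[OF that] that cong_trans by (auto simp: a_def)
  qed
  have char: "[s = a] (mod \<Prod>T) \<longleftrightarrow> (\<forall>p\<in>T. s mod p = g p)" for s
  proof
    assume s: "[s = a] (mod \<Prod>T)"
    show "\<forall>p\<in>T. s mod p = g p"
    proof
      fix p assume p: "p \<in> T"
      have "p dvd \<Prod>T" using assms(1) p by (rule dvd_prodI)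
      then have "[s = a] (mod p)" using s cong_dvd_modulus_nat by blast
      then have "[s = g p] (mod p)" using a[OF p] cong_trans by blast
      then show "s mod p = g p" using g[OF p] by (simp add: cong_def)
    qed
  next
    assume s: "\<forall>p\<in>T. s mod p = g p"
    show "[s = a] (mod \<Prod>T)"
    proof (rule coprime_cong_prod_nat)
      fix p assume p: "p \<in> T"
      then have "[s = g p] (mod p)" using s g[OF p] by (simp add: cong_def)
      then show "[s = a] (mod p)" using a[OF p] cong_sym cong_trans by blast
    qed (use cop in auto)
  qed
  have not_dvd: "\<not> p dvd a" if "p \<in> T" for p
    using a[OF that] g[OF that] by (auto simp: cong_def dvd_eq_mod_eq_0)
  have "coprime a (\<Prod>T)"
  proof (rule prod_coprime_right)
    fix p assume "p \<in> T"
    then have "coprime p a" using primes not_dvd by (auto intro: prime_imp_coprime)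
    then show "coprime a p" by (simp add: coprime_commute)
  qed
  moreover have "a > 0"
  proof (cases "T = {}")
    case False
    then obtain p where "p \<in> T" by auto
    then show ?thesis using not_dvd[of p] by (cases a) auto
  qed (simp add: a_def)
  moreover have "a \<le> \<Prod>T" using pos by (auto simp: a_def intro: less_imp_le)
  ultimately have "a \<in> totatives (\<Prod>T)" by (simp add: in_totatives_iff)
  then show ?thesis using char by blast
qed

text \<open>The condition splits into \<open>w ^ card T\<close> reduced classes modulo
  \<open>\<Prod>T\<close>, each expected to hold \<open>card S / totient (\<Prod>T)\<close>
  elements; hence the \<open>p - 1\<close> in the main term and the factor in the error.\<close>

lemma card_in_residue_classes_approx:
  fixes T :: "nat set" and \<Omega> :: "nat \<Rightarrow> nat set"
  assumes "finite S" "finite T" and primes: "\<And>p. p \<in> T \<Longrightarrow> prime p"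
    and \<Omega>: "\<And>p. p \<in> T \<Longrightarrow> \<Omega> p \<subseteq> {0<..<p} \<and> card (\<Omega> p) = w"
  shows "\<bar>real (card {s \<in> S. \<forall>p\<in>T. s mod p \<in> \<Omega> p}) - real (card S) * (\<Prod>p\<in>T. real w / (real p - 1))\<bar>
    \<le> real w ^ card T * max_discrepancy S (\<Prod>T)"
proof -
  let ?I = "PiE T \<Omega>"
  let ?c = "\<lambda>g. {s \<in> S. \<forall>p\<in>T. s mod p = g p}"
  have fin\<Omega>: "finite (\<Omega> p)" if "p \<in> T" for p using \<Omega>[OF that] finite_subset by blast
  have finI: "finite ?I" using assms(2) fin\<Omega> by (intro finite_PiE) auto
  have cardI: "card ?I = w ^ card T" using assms(2) \<Omega> by (simp add: card_PiE)
  have "{s \<in> S. \<forall>p\<in>T. s mod p \<in> \<Omega> p} = (\<Union>g\<in>?I. ?c g)"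
  proof (intro equalityI subsetI)
    fix s assume s: "s \<in> {s \<in> S. \<forall>p\<in>T. s mod p \<in> \<Omega> p}"
    then have "restrict (\<lambda>p. s mod p) T \<in> ?I" by auto
    moreover have "s \<in> ?c (restrict (\<lambda>p. s mod p) T)" using s by simp
    ultimately show "s \<in> (\<Union>g\<in>?I. ?c g)" by blast
  qed auto
  then have "card {s \<in> S. \<forall>p\<in>T. s mod p \<in> \<Omega> p} = card (\<Union>g\<in>?I. ?c g)" by (rule arg_cong)
  also have "\<dots> = (\<Sum>g\<in>?I. card (?c g))"
  proof (rule card_UN_disjoint[OF finI])
    show "\<forall>g\<in>?I. \<forall>g'\<in>?I. g \<noteq> g' \<longrightarrow> ?c g \<inter> ?c g' = {}"
    proof (intro ballI impI)
      fix g g' assume g: "g \<in> ?I" "g' \<in> ?I" "g \<noteq> g'"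
      then obtain p where "p \<in> T" "g p \<noteq> g' p" using PiE_ext[OF g(1,2)] by blast
      then show "?c g \<inter> ?c g' = {}" by auto
    qed
  qed (use assms(1) in auto)
  finally have count: "real (card {s \<in> S. \<forall>p\<in>T. s mod p \<in> \<Omega> p}) = (\<Sum>g\<in>?I. real (card (?c g)))" by simp
  have tot: "real (totient (\<Prod>T)) = (\<Prod>p\<in>T. real p - 1)"
  proof -
    have "real (totient (\<Prod>T)) = (\<Prod>p\<in>T. real (p - 1))" using primes by (simp add: totient_prod_primes)
    also have "\<dots> = (\<Prod>p\<in>T. real p - 1)"
      using primes prime_ge_1_nat by (intro prod.cong refl) (auto simp: of_nat_diff)
    finally show ?thesis .
  qed
  have "real (card S) * (\<Prod>p\<in>T. real w / (real p - 1)) = (\<Sum>g\<in>?I. real (card S) / real (totient (\<Prod>T)))"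
    by (simp add: prod_dividef tot cardI)
  then have "\<bar>real (card {s \<in> S. \<forall>p\<in>T. s mod p \<in> \<Omega> p}) - real (card S) * (\<Prod>p\<in>T. real w / (real p - 1))\<bar> =
      \<bar>\<Sum>g\<in>?I. real (card (?c g)) - real (card S) / real (totient (\<Prod>T))\<bar>"
    unfolding count by (simp only: sum_subtractf)
  also have "\<dots> \<le> (\<Sum>g\<in>?I. \<bar>real (card (?c g)) - real (card S) / real (totient (\<Prod>T))\<bar>)"
    by (rule sum_abs)
  also have "\<dots> \<le> (\<Sum>g\<in>?I. max_discrepancy S (\<Prod>T))"
  proof (rule sum_mono)
    fix g assume g: "g \<in> ?I"
    have "0 < g p \<and> g p < p" if "p \<in> T" for p using PiE_mem[OF g that] \<Omega>[OF that] by auto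
    then obtain a where a: "a \<in> totatives (\<Prod>T)" "\<And>s. [s = a] (mod \<Prod>T) \<longleftrightarrow> (\<forall>p\<in>T. s mod p = g p)"
      using ex_totative_cong[of T g] assms(2) primes by blast
    then have "?c g = {s \<in> S. [s = a] (mod \<Prod>T)}" by auto
    then show "\<bar>real (card (?c g)) - real (card S) / real (totient (\<Prod>T))\<bar> \<le> max_discrepancy S (\<Prod>T)"
      using max_discrepancy_ge[OF a(1), of S] by simp
  qed
  also have "\<dots> = real w ^ card T * max_discrepancy S (\<Prod>T)" by (simp add: cardI)
  finally show ?thesis .
qed

text \<open>Pairs are grouped by their union \<open>T\<close>, at most \<open>3 ^ card T\<close> for
  each; the product over a union is at most the product of the two moduli, whence the level
  \<open>Q\<^sup>2\<close>.\<close>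

lemma sum_union_pairs_le:
  fixes \<phi> :: "nat set \<Rightarrow> real"
  assumes D: "D \<subseteq> prime_family P Q" "Q \<ge> 0" and nonneg: "\<And>T. T \<in> prime_family P (Q\<^sup>2) \<Longrightarrow> \<phi> T \<ge> 0"
  shows "(\<Sum>d\<in>D. \<Sum>e\<in>D. \<phi> (d \<union> e)) \<le> (\<Sum>T\<in>prime_family P (Q\<^sup>2). 3 ^ card T * \<phi> T)"
proof -
  let ?u = "\<lambda>t. fst t \<union> snd t" and ?F = "prime_family P (Q\<^sup>2)"
  have finD: "finite D" using D finite_prime_family finite_subset by blast
  have img: "?u ` (D \<times> D) \<subseteq> ?F"
  proof clarsimp
    fix d e assume "d \<in> D" "e \<in> D"
    then have de: "d \<in> prime_family P Q" "e \<in> prime_family P Q" using D by auto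
    note d = prime_familyD[OF de(1)] and e = prime_familyD[OF de(2)]
    have "\<Prod>(d \<union> e) * \<Prod>(d \<inter> e) = \<Prod>d * \<Prod>e" using d(1) e(1) by (rule prod.union_inter)
    moreover have "\<Prod>(d \<inter> e) \<ge> 1" using d(3) prime_ge_1_nat by (intro prod_ge_1) auto
    then have "\<Prod>(d \<union> e) * 1 \<le> \<Prod>(d \<union> e) * \<Prod>(d \<inter> e)" by (rule mult_le_mono2)
    ultimately have "\<Prod>(d \<union> e) \<le> \<Prod>d * \<Prod>e" by simp
    then have "real (\<Prod>(d \<union> e)) \<le> real (\<Prod>d) * real (\<Prod>e)" by (simp only: of_nat_mult[symmetric] of_nat_le_iff)
    also have "\<dots> \<le> Q * Q" using d(4) e(4) D(2) by (intro mult_mono) (auto intro: prod_nonneg)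
    finally show "d \<union> e \<in> ?F" using d e by (auto simp: prime_family_def power2_eq_square)
  qed
  have "(\<Sum>d\<in>D. \<Sum>e\<in>D. \<phi> (d \<union> e)) = (\<Sum>t\<in>D \<times> D. \<phi> (?u t))"
    by (simp add: sum.cartesian_product split_def)
  also have "\<dots> = (\<Sum>T\<in>?F. \<Sum>t | t \<in> D \<times> D \<and> ?u t = T. \<phi> (?u t))"
    using finD finite_prime_family img by (intro sum.group[symmetric]) auto
  also have "\<dots> \<le> (\<Sum>T\<in>?F. 3 ^ card T * \<phi> T)"
  proof (rule sum_mono)
    fix T assume T: "T \<in> ?F"
    have finT: "finite T" using prime_familyD[OF T] by simp
    have "{(d, e). d \<union> e = T} \<subseteq> Pow T \<times> Pow T" by auto
    then have fin: "finite {(d, e). d \<union> e = T}" by (rule finite_subset) (use finT in auto)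
    have "card {t. t \<in> D \<times> D \<and> ?u t = T} \<le> card {(d, e). d \<union> e = T}"
      by (rule card_mono[OF fin]) auto
    also have "\<dots> \<le> 3 ^ card T" by (rule card_pairs_with_union_le[OF finT])
    finally have "real (card {t. t \<in> D \<times> D \<and> ?u t = T}) \<le> real (3 ^ card T)"
      by (simp only: of_nat_le_iff)
    then have "real (card {t. t \<in> D \<times> D \<and> ?u t = T}) \<le> 3 ^ card T" by simp
    then have "real (card {t. t \<in> D \<times> D \<and> ?u t = T}) * \<phi> T \<le> 3 ^ card T * \<phi> T"
      using nonneg[OF T] by (rule mult_right_mono)
    then show "(\<Sum>t | t \<in> D \<times> D \<and> ?u t = T. \<phi> (?u t)) \<le> 3 ^ card T * \<phi> T" by simp
  qed
  finally show ?thesis .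
qed

text \<open>The power \<open>ln K / ln 3\<close> turns \<open>3 ^ card T\<close> into
  \<open>K ^ card T\<close>. The exponent in the Bombieri-Vinogradov hypothesis thus absorbs both
  the number of pairs with a given union and the number of residue classes.\<close>

lemma tau3_powr_ge:
  assumes "finite T" "\<And>p. p \<in> T \<Longrightarrow> prime p" "K \<ge> 1"
  shows "3 ^ card T * K ^ card T \<le> real (tau3 (\<Prod>T)) powr (1 + ln K / ln 3)"
proof -
  have "3 ^ card T * K ^ card T = (3 ^ card T) powr (1 + ln K / ln 3)"
  proof -
    have "(3 ^ card T) powr (1 + ln K / ln 3) = (3::real) ^ card T * (3 ^ card T) powr (ln K / ln 3)"
      by (simp add: powr_add)
    also have "(3 ^ card T) powr (ln K / ln 3) = K ^ card T"
      using assms(3) by (simp add: powr_def ln_realpow exp_of_nat2_mult)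
    finally show ?thesis by simp
  qed
  also have "\<dots> \<le> real (tau3 (\<Prod>T)) powr (1 + ln K / ln 3)"
  proof (rule powr_mono2)
    show "0 \<le> 1 + ln K / ln 3" using assms(3) by (simp add: add_nonneg_nonneg)
    show "(3::real) ^ card T \<le> real (tau3 (\<Prod>T))"
    proof -
      have "real (3 ^ card T) \<le> real (tau3 (\<Prod>T))"
        using three_power_le_tau3[OF assms(1,2)] by (simp only: of_nat_le_iff)
      then show ?thesis by simp
    qed
  qed simp
  finally show ?thesis .
qed

text \<open>Selberg's sieve bounds the translate of \<open>B\<close> by \<open>a1\<close> inside
  \<open>S\<close>. It avoids the classes \<open>a1 - a\<close> for the other \<open>a\<close> in
  \<open>A\<close>, as otherwise \<open>p\<close> would divide some \<open>a + b\<close>. The class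
  0, coming from \<open>a = a1\<close>, is left out: all of \<open>S\<close> avoids it, and the
  distribution hypothesis concerns reduced classes.\<close>

lemma card_le_if_well_distributed:
  fixes x :: real and S :: "nat set"
  assumes "finite S" and AB: "finite A" "2 \<le> card A" "B \<noteq> {}"
    and sums: "\<And>a b. a \<in> A \<Longrightarrow> b \<in> B \<Longrightarrow> a + b \<in> S"
    and bound: "\<And>s. s \<in> S \<Longrightarrow> real s \<le> x" and x: "x \<ge> 1" "ln x \<ge> 1"
    and K: "real (card A) \<le> K" "K \<ge> 1000 * ln x"
    and P: "\<And>p. p \<in> P \<Longrightarrow> real p \<ge> K ^ 3"
    and free: "\<And>p s. p \<in> P \<Longrightarrow> s \<in> S \<Longrightarrow> \<not> p dvd s"
    and Q: "Q \<ge> 1"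
    and large: "(\<Sum>T\<in>prime_family P Q - {{}}. \<Prod>p\<in>T. 1 / real p) \<ge> \<tau>" "\<tau> \<ge> 10"
  shows "real (card B) \<le> real (card S) / ((real (card A) - 1) * (49 / 50 * \<tau>)) +
    (\<Sum>T\<in>prime_family P (Q\<^sup>2). real (tau3 (\<Prod>T)) powr (1 + ln K / ln 3) * max_discrepancy S (\<Prod>T))"
proof -
  let ?Z = "collision_primes A \<inter> P"
  define k where "k = real (card A)"
  define D where "D = {T \<in> prime_family P Q. T \<inter> ?Z = {}}"
  \<comment> \<open>Chosen so that \<open>density p\<close> is \<open>(k - 1) / (p - 1)\<close>, the
    proportion of reduced classes removed.\<close>
  define h where "h p = (k - 1) / (real p - k)" for p :: nat
  have k: "k \<ge> 2" "k \<le> K" using AB K by (auto simp: k_def)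
  obtain a1 where a1: "a1 \<in> A" using AB by fastforce
  obtain b0 where b0: "b0 \<in> B" using AB by auto
  have A_le: "real a \<le> x" if "a \<in> A" for a using bound[OF sums[OF that b0]] by simp
  have Ds: "finite T" "\<And>p. p \<in> T \<Longrightarrow> prime p" "T \<subseteq> P" "T \<inter> ?Z = {}" if "T \<in> D" for T
    using that prime_familyD[of T P Q] by (auto simp: D_def)
  have p_gt: "real p > k" if "p \<in> P" for p
  proof -
    have "K > 1" using k by simp
    then have "K ^ 1 < K ^ 3" by (intro power_strict_increasing) auto
    then show ?thesis using P[OF that] k by simp
  qed
  interpret selberg_sieve D h
  proof
    show "finite D" unfolding D_def using finite_prime_family by simp
    show "finite T" if "T \<in> D" for T using Ds[OF that] by simp
    show "T' \<in> D" if "T \<in> D" "T' \<subseteq> T" for T T'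
      using that prime_family_down_closed by (auto simp: D_def)
    show "h p > 0" if "T \<in> D" "p \<in> T" for T p
      using p_gt[of p] Ds(3)[OF that(1)] that k by (auto simp: h_def)
  qed
  define \<Omega> where "\<Omega> p = (\<lambda>a. nat ((int a1 - int a) mod int p)) ` (A - {a1})" for p
  have \<Omega>: "\<Omega> p \<subseteq> {0<..<p} \<and> card (\<Omega> p) = card A - 1"
    if p: "prime p" "p \<notin> collision_primes A" for p
  proof
    have pos: "p > 0" using prime_gt_0_nat[OF p(1)] .
    have neq: "a mod p \<noteq> b mod p" if "a \<in> A" "b \<in> A" "a \<noteq> b" for a b
      using p that by (auto simp: collision_primes_def)
    have neq_int: "int a mod int p \<noteq> int b mod int p" if "a \<in> A" "b \<in> A" "a \<noteq> b" for a b
      using neq[OF that] by (metis of_nat_eq_iff zmod_int)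
    show "\<Omega> p \<subseteq> {0<..<p}"
    proof
      fix r assume "r \<in> \<Omega> p"
      then obtain a where a: "a \<in> A" "a \<noteq> a1" "r = nat ((int a1 - int a) mod int p)" by (auto simp: \<Omega>_def)
      have "(int a1 - int a) mod int p \<noteq> 0"
        using neq_int[OF a1 a(1)] a(2) by (auto simp: mod_eq_0_iff_dvd mod_eq_dvd_iff)
      moreover have "0 \<le> (int a1 - int a) mod int p" "(int a1 - int a) mod int p < int p"
        using pos by auto
      ultimately show "r \<in> {0<..<p}" unfolding a(3) by auto
    qed
    have "inj_on (\<lambda>a. nat ((int a1 - int a) mod int p)) (A - {a1})"
    proof (rule inj_onI, rule ccontr)
      fix a b assume ab: "a \<in> A - {a1}" "b \<in> A - {a1}"
        "nat ((int a1 - int a) mod int p) = nat ((int a1 - int b) mod int p)" "a \<noteq> b"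
      have "0 \<le> (int a1 - int a) mod int p" "0 \<le> (int a1 - int b) mod int p" using pos by simp_all
      then have "(int a1 - int a) mod int p = (int a1 - int b) mod int p"
        using ab(3) by (simp only: eq_nat_nat_iff)
      then have "int p dvd (int a1 - int a) - (int a1 - int b)" by (simp only: mod_eq_dvd_iff)
      then have "int b mod int p = int a mod int p" by (simp add: mod_eq_dvd_iff)
      then show False using neq_int[of b a] ab by auto
    qed
    then show "card (\<Omega> p) = card A - 1" using AB a1 by (simp add: \<Omega>_def card_image)
  qed
  have density: "density p = real (card A - 1) / (real p - 1)" if "p \<in> P" for p
  proof -
    have "1 + h p = (real p - 1) / (real p - k)" "real p - k > 0"
      using p_gt[OF that] by (auto simp: h_def field_simps)
    moreover have "real (card A - 1) = k - 1" using AB by (simp add: k_def of_nat_diff)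
    ultimately show ?thesis by (simp add: density_def h_def)
  qed
  let ?E = "\<lambda>p. {s. s mod p \<in> \<Omega> p}"
  let ?R = "\<lambda>d. real (card {s \<in> S. \<forall>p\<in>d. s \<in> ?E p}) - real (card S) * (\<Prod>p\<in>d. density p)"
  have R: "\<bar>?R T\<bar> \<le> (k - 1) ^ card T * max_discrepancy S (\<Prod>T)"
    if "finite T" "T \<subseteq> P" "T \<inter> ?Z = {}" "\<And>p. p \<in> T \<Longrightarrow> prime p" for T
  proof -
    have "\<bar>real (card {s \<in> S. \<forall>p\<in>T. s mod p \<in> \<Omega> p}) -
        real (card S) * (\<Prod>p\<in>T. real (card A - 1) / (real p - 1))\<bar>
      \<le> real (card A - 1) ^ card T * max_discrepancy S (\<Prod>T)"
      using that by (intro card_in_residue_classes_approx assms(1) \<Omega>) auto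
    moreover have "(\<Prod>p\<in>T. density p) = (\<Prod>p\<in>T. real (card A - 1) / (real p - 1))"
      using that density by (intro prod.cong) auto
    moreover have "real (card A - 1) = k - 1" using AB by (simp add: k_def of_nat_diff)
    ultimately show ?thesis by simp
  qed
  have empty: "{} \<in> D" using Q by (simp add: D_def empty_in_prime_family)
  have "card ((+) a1 ` B) = card B" by (simp add: card_image)
  then have "real (card B) \<le> real (card S) / total + (\<Sum>d\<in>D. \<Sum>e\<in>D. \<bar>?R (d \<union> e)\<bar>)"
  proof (subst \<open>card ((+) a1 ` B) = card B\<close>[symmetric], intro card_unsifted_le assms(1) empty)
    show "(+) a1 ` B \<subseteq> S" using sums a1 by auto
    fix s T p assume s: "s \<in> (+) a1 ` B" and T: "T \<in> D" "p \<in> T"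
    then obtain b where b: "b \<in> B" "s = a1 + b" by auto
    show "s \<notin> ?E p"
    proof
      assume "s \<in> ?E p"
      then obtain a where a: "a \<in> A" "s mod p = nat ((int a1 - int a) mod int p)" by (auto simp: \<Omega>_def)
      have pos: "p > 0" using prime_gt_0_nat[OF Ds(2)[OF T]] .
      have "int s mod int p = (int a1 - int a) mod int p"
        using a(2) pos by (simp flip: zmod_int)
      then have "int p dvd int s - (int a1 - int a)" by (simp only: mod_eq_dvd_iff)
      then have "int p dvd int (a + b)" by (simp add: b algebra_simps)
      then have "p dvd a + b" by (simp only: int_dvd_int_iff)
      then show False using free[OF _ sums[OF a(1) b(1)]] Ds(3)[OF T(1)] T by auto
    qed
  qed
  also have "(\<Sum>d\<in>D. \<Sum>e\<in>D. \<bar>?R (d \<union> e)\<bar>) \<le>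
      (\<Sum>d\<in>D. \<Sum>e\<in>D. (k - 1) ^ card (d \<union> e) * max_discrepancy S (\<Prod>(d \<union> e)))"
  proof (intro sum_mono R)
    fix d e assume "d \<in> D" "e \<in> D"
    note de = Ds[OF this(1)] Ds[OF this(2)]
    show "finite (d \<union> e)" "d \<union> e \<subseteq> P" "(d \<union> e) \<inter> ?Z = {}" using de by auto
    show "prime p" if "p \<in> d \<union> e" for p using de that by auto
  qed
  also have "\<dots> \<le> (\<Sum>T\<in>prime_family P (Q\<^sup>2). 3 ^ card T * ((k - 1) ^ card T * max_discrepancy S (\<Prod>T)))"
    using Q k prime_familyD(5)
    by (intro sum_union_pairs_le mult_nonneg_nonneg zero_le_power max_discrepancy_nonneg) (auto simp: D_def)
  also have "\<dots> \<le> (\<Sum>T\<in>prime_family P (Q\<^sup>2). real (tau3 (\<Prod>T)) powr (1 + ln K / ln 3) * max_discrepancy S (\<Prod>T))"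
  proof (rule sum_mono)
    fix T assume T: "T \<in> prime_family P (Q\<^sup>2)"
    note TD = prime_familyD[OF T]
    have "3 ^ card T * (k - 1) ^ card T \<le> 3 ^ card T * K ^ card T"
      using k by (intro mult_left_mono power_mono) auto
    also have "\<dots> \<le> real (tau3 (\<Prod>T)) powr (1 + ln K / ln 3)"
      using TD k by (intro tau3_powr_ge) auto
    finally have "3 ^ card T * (k - 1) ^ card T * max_discrepancy S (\<Prod>T) \<le>
        real (tau3 (\<Prod>T)) powr (1 + ln K / ln 3) * max_discrepancy S (\<Prod>T)"
      using max_discrepancy_nonneg[OF TD(5)] by (rule mult_right_mono)
    then show "3 ^ card T * ((k - 1) ^ card T * max_discrepancy S (\<Prod>T)) \<le>
        real (tau3 (\<Prod>T)) powr (1 + ln K / ln 3) * max_discrepancy S (\<Prod>T)"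
      by (simp only: mult.assoc)
  qed
  also have "real (card S) / total \<le> real (card S) / ((real (card A) - 1) * (49 / 50 * \<tau>))"
  proof (rule divide_left_mono)
    have "(k - 1) * (49 / 50 * \<tau>) \<le> (k - 1) * (\<Sum>T\<in>D - {{}}. \<Prod>p\<in>T. 1 / real p)"
      unfolding D_def using k A_le x K P large AB
      by (intro mult_left_mono sum_avoiding_collisions_ge) auto
    also have "\<dots> \<le> (\<Sum>T\<in>D - {{}}. \<Prod>p\<in>T. h p)"
      unfolding sum_distrib_left
    proof (rule sum_mono)
      fix T assume T: "T \<in> D - {{}}"
      then have T': "T \<in> D" by simp
      \<comment> \<open>As \<open>k >= 2\<close> and \<open>T\<close> is nonempty, one factor
        \<open>k - 1\<close> can be kept and the others bounded below by 1.\<close>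
      have "(k - 1) * (\<Prod>p\<in>T. 1 / real p) \<le> (k - 1) ^ card T * (\<Prod>p\<in>T. 1 / real p)"
      proof (rule mult_right_mono)
        have "card T \<ge> 1" using Ds(1)[OF T'] T by (simp add: Suc_le_eq card_gt_0_iff)
        then have "(k - 1) ^ 1 \<le> (k - 1) ^ card T" using k by (intro power_increasing) auto
        then show "k - 1 \<le> (k - 1) ^ card T" by simp
      qed (intro prod_nonneg, simp)
      also have "\<dots> = (\<Prod>p\<in>T. (k - 1) * (1 / real p))" by (simp only: prod.distrib prod_constant)
      also have "\<dots> \<le> (\<Prod>p\<in>T. h p)"
      proof (rule prod_mono)
        fix p assume "p \<in> T"
        then have "k < real p" using p_gt[of p] Ds(3)[OF T'] by auto
        then have "(k - 1) / real p \<le> (k - 1) / (real p - k)" using k by (intro divide_left_mono) auto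
        then show "0 \<le> (k - 1) * (1 / real p) \<and> (k - 1) * (1 / real p) \<le> h p"
          using k by (simp add: h_def)
      qed
      finally show "(k - 1) * (\<Prod>p\<in>T. 1 / real p) \<le> (\<Prod>p\<in>T. h p)" .
    qed
    also have "\<dots> \<le> total"
      unfolding total_def using finite_D less_imp_le[OF prod_h_pos[OF _ subset_refl]] by (intro sum_mono2) auto
    finally show "(real (card A) - 1) * (49 / 50 * \<tau>) \<le> total" by (simp add: k_def)
    then have le: "(real (card A) - 1) * (49 / 50 * \<tau>) \<le> total" .
    have pos: "0 < (real (card A) - 1) * (49 / 50 * \<tau>)" using k large by (simp add: k_def)
    from less_le_trans[OF pos le] pos show "0 < total * ((real (card A) - 1) * (49 / 50 * \<tau>))"
      by (rule mult_pos_pos)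
  qed simp
  finally show ?thesis by simp
qed

section \<open>Exclusion of small summands under either hypothesis\<close>

lemma card_le_card_mult_if_sumset:
  fixes A B :: "nat set"
  assumes "finite A" "finite B"
  shows "card (A + B) \<le> card A * card B"
proof -
  have "card (A + B) \<le> card (A \<times> B)"
    unfolding set_plus_image using assms by (intro card_image_le) auto
  then show ?thesis by (simp add: card_cartesian_product)
qed

lemma summand_not_small_if_sieve_controls_size:
  fixes x \<sigma> \<sigma>0 :: real
  assumes "finite A" "2 \<le> card A" "B \<noteq> {}"
    and "\<And>a b. a \<in> A \<Longrightarrow> b \<in> B \<Longrightarrow> real (a + b) \<le> x"
    and "x \<ge> 10" "ln x \<ge> 1"
    and "K \<ge> 1000 * ln x"
    and "\<And>p. p \<in> P \<Longrightarrow> real p \<ge> K ^ 3"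
    and "\<And>p a b. p \<in> P \<Longrightarrow> a \<in> A \<Longrightarrow> b \<in> B \<Longrightarrow> \<not> p dvd a + b"
    and \<sigma>: "0 < \<sigma>0 * \<sigma>" "\<sigma>0 * \<sigma> \<le> 1"
    and product: "real (card A) * real (card B) \<ge> \<sigma>0 * \<sigma> * x"
    and sieve: "sieve_controls_size x P \<sigma> \<sigma>0"
  shows "real (card A) > K"
proof (rule ccontr)
  assume "\<not> real (card A) > K"
  then have small: "real (card A) \<le> K" by simp
  define \<tau> where "\<tau> = 10 * inverse (\<sigma>0 * \<sigma>)"
  have \<tau>: "\<tau> \<ge> 10" unfolding \<tau>_def using one_le_inverse[OF \<sigma>] by simp
  have "(\<Sum>T\<in>prime_family P (sqrt x) - {{}}. \<Prod>p\<in>T. 2 / real p) =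
      (\<Sum>T\<in>prime_family P (sqrt x) - {{}}. \<Prod>p\<in>prime_factors (\<Prod>T). 2 / real p)"
  proof (intro sum.cong refl)
    fix T assume "T \<in> prime_family P (sqrt x) - {{}}"
    then have "prime_factors (\<Prod>T) = T" by (intro prod_in_prime_family(2)) auto
    then show "(\<Prod>p\<in>T. 2 / real p) = (\<Prod>p\<in>prime_factors (\<Prod>T). 2 / real p)" by (simp only:)
  qed
  also have "\<dots> \<ge> \<tau>"
    using sieve unfolding sieve_controls_size_def \<tau>_def
      sum_moebius_mu_sq_gt_1[where g = "\<lambda>q. \<Prod>p\<in>prime_factors q. 2 / real p"] .
  finally have "real (card A) * real (card B) * \<tau> < 10 * x"
    using assms small \<tau> by (intro card_product_small_if_sieve_controls_size[where K = K and P = P]) auto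
  moreover have "\<sigma>0 * \<sigma> * x * \<tau> \<le> real (card A) * real (card B) * \<tau>"
    using product \<tau> by (intro mult_right_mono) auto
  moreover have "\<sigma>0 * \<sigma> * x * \<tau> = 10 * x"
  proof -
    have "\<sigma>0 * \<sigma> * inverse (\<sigma>0 * \<sigma>) = 1" using less_imp_neq[OF \<sigma>(1)] by (intro right_inverse) metis
    then have "10 * x * (\<sigma>0 * \<sigma> * inverse (\<sigma>0 * \<sigma>)) = 10 * x" by (simp only: mult_1_right)
    then show ?thesis by (simp only: \<tau>_def mult_ac)
  qed
  ultimately show False by simp
qed

lemma summand_not_small_if_bombieri_vinogradov:
  fixes x \<sigma>0 :: real
  assumes "finite S" and AB: "finite A" "2 \<le> card A" "B \<noteq> {}"
    and sums: "\<And>a b. a \<in> A \<Longrightarrow> b \<in> B \<Longrightarrow> a + b \<in> S"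
    and bound: "\<And>s. s \<in> S \<Longrightarrow> real s \<le> x" and x: "x \<ge> 1" "ln x \<ge> 1"
    and K: "K \<ge> 1000 * ln x"
    and P: "\<And>p. p \<in> P \<Longrightarrow> real p \<ge> K ^ 3"
    and free: "\<And>p s. p \<in> P \<Longrightarrow> s \<in> S \<Longrightarrow> \<not> p dvd s"
    and \<sigma>0: "0 < \<sigma>0" "\<sigma>0 \<le> 1"
    and product: "real (card A) * real (card B) \<ge> \<sigma>0 * real (card S)"
    and bv: "bombieri_vinogradov S P \<sigma>0 K"
  shows "real (card A) > K"
proof (rule ccontr)
  assume "\<not> real (card A) > K"
  define k N where "k = real (card A)" and "N = real (card S)"
  have small: "real (card A) \<le> K" "k \<le> K" using \<open>\<not> real (card A) > K\<close> by (auto simp: k_def)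
  have k: "k \<ge> 2" using AB by (simp add: k_def)
  have "S \<noteq> {}" using AB sums by fastforce
  then have N: "N > 0" using assms(1) by (simp add: N_def card_gt_0_iff)
  obtain Q :: nat where Q: "Q > 0"
    and mass: "(\<Sum>q | 1 < q \<and> q \<le> Q \<and> composed_of P q. (real_of_int (moebius_mu q))\<^sup>2 / real q) \<ge> 10 * inverse \<sigma>0"
    and disc: "(\<Sum>d | 1 \<le> d \<and> d \<le> Q\<^sup>2 \<and> composed_of P d.
        (real_of_int (moebius_mu d))\<^sup>2 * real (tau3 d) powr (1 + ln K / ln 3) * max_discrepancy S d)
      \<le> N / (2 * K * inverse \<sigma>0)"
    using bv unfolding bombieri_vinogradov_def N_def by blast
  have large: "(\<Sum>T\<in>prime_family P Q - {{}}. \<Prod>p\<in>T. 1 / real p) \<ge> 10 * inverse \<sigma>0"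
  proof -
    have "10 * inverse \<sigma>0 \<le> (\<Sum>T\<in>prime_family P Q - {{}}. 1 / real (\<Prod>T))"
      using mass sum_moebius_mu_sq_gt_1[where P = P and Q = "real Q" and g = "\<lambda>q. 1 / real q"] by simp
    also have "\<dots> = (\<Sum>T\<in>prime_family P Q - {{}}. \<Prod>p\<in>T. 1 / real p)"
      by (simp add: prod_dividef)
    finally show ?thesis .
  qed
  let ?E = "\<Sum>T\<in>prime_family P ((real Q)\<^sup>2). real (tau3 (\<Prod>T)) powr (1 + ln K / ln 3) * max_discrepancy S (\<Prod>T)"
  have E: "?E \<le> N / (2 * K * inverse \<sigma>0)"
  proof -
    have "{d. 1 \<le> d \<and> d \<le> Q\<^sup>2 \<and> composed_of P d} =
        {d. 1 \<le> d \<and> real d \<le> (real Q)\<^sup>2 \<and> composed_of P d \<and> True}"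
      by (auto simp flip: of_nat_power)
    then show ?thesis
      using disc sum_moebius_mu_sq[where P = P and Q = "(real Q)\<^sup>2" and R = "\<lambda>_. True"
          and g = "\<lambda>d. real (tau3 d) powr (1 + ln K / ln 3) * max_discrepancy S d"]
      by (simp add: mult.assoc)
  qed
  have "real (card B) \<le> real (card S) / ((real (card A) - 1) * (49 / 50 * (10 * inverse \<sigma>0))) + ?E"
    by (rule card_le_if_well_distributed[where x = x and P = P])
      (use assms small Q large in \<open>auto simp: one_le_inverse_iff\<close>)
  also have "\<dots> \<le> \<sigma>0 * N / (49 / 5 * (k - 1)) + \<sigma>0 * N / (2 * K)"
    using E \<sigma>0 by (simp add: k_def N_def field_simps)
  finally have B: "real (card B) \<le> \<sigma>0 * N / (49 / 5 * (k - 1)) + \<sigma>0 * N / (2 * K)" .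
  have "\<sigma>0 * N \<le> k * real (card B)" using product by (simp add: k_def N_def)
  also have "\<dots> \<le> k * (\<sigma>0 * N / (49 / 5 * (k - 1)) + \<sigma>0 * N / (2 * K))"
    using B k by (intro mult_left_mono) auto
  also have "\<dots> = \<sigma>0 * N * (5 / 49 * (k / (k - 1)) + 1 / 2 * (k / K))"
    using k small by (simp add: field_simps)
  \<comment> \<open>Here \<open>k / (k - 1) <= 2\<close> bounds the main term and
    \<open>k / K <= 1\<close> the discrepancy; \<open>10 / 49 + 1 / 2\<close> is below 1.\<close>
  also have "\<dots> \<le> \<sigma>0 * N * (5 / 49 * 2 + 1 / 2 * 1)"
    using \<sigma>0 N k small by (intro mult_left_mono add_mono) (auto simp: field_simps)
  also have "\<dots> < \<sigma>0 * N * 1" using \<sigma>0 N by (intro mult_strict_left_mono) auto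
  finally show False by simp
qed

section \<open>Large summands\<close>

text \<open>Cauchy-Schwarz turns the upper bound of \<open>larger_sieve\<close> for the weighted sum
  of \<open>1 / \<nu>\<close> into a lower bound for that of \<open>\<nu>\<close>, and
  \<open>\<nu> / (p - \<nu>)\<close> is at least \<open>\<nu> / p\<close>. The minimum records which
  of the two terms of the larger sieve bound dominates.\<close>

lemma sum_residue_ratio_ge:
  fixes x y L w :: real
  assumes A: "finite A" "A \<noteq> {}" "\<And>a. a \<in> A \<Longrightarrow> real a \<le> x" and x: "x \<ge> 1" "ln x > 0"
    and P: "finite P" "\<And>p. p \<in> P \<Longrightarrow> prime p \<and> real p \<le> y \<and> residues_mod A p < p"
    and y: "y > 0" "ln y \<le> L" "L > 0"
    and w: "w > 0" "(\<Sum>p\<in>P. ln (real p)) \<ge> w"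
  shows "min (w * real (card A) / (2 * y * L)) (w\<^sup>2 / (2 * y * L * ln x)) \<le>
    (\<Sum>p\<in>P. real (residues_mod A p) / (real p - real (residues_mod A p)))"
proof -
  define n W where "n = real (card A)" and "W = (\<Sum>p\<in>P. ln (real p))"
  define \<Lambda> where "\<Lambda> = ln x + W / n"
  let ?\<nu> = "\<lambda>p. real (residues_mod A p)"
  have n: "n > 0" using A by (simp add: n_def card_gt_0_iff)
  have W: "W \<ge> w" "W > 0" using w by (auto simp: W_def)
  have \<Lambda>: "\<Lambda> > 0" using x n W by (simp add: \<Lambda>_def add_pos_nonneg)
  have \<nu>: "?\<nu> p > 0" for p using residues_mod_pos[OF A(1,2), of p] by simp
  have lnp: "ln (real p) \<ge> 0" if "p \<in> P" for p
    using P(2)[OF that] prime_ge_1_nat[of p] by simp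
  have sieve: "(\<Sum>p\<in>P. ln (real p) / ?\<nu> p) \<le> \<Lambda>"
    unfolding \<Lambda>_def W_def n_def using A x P by (intro larger_sieve) auto
  have "W\<^sup>2 / \<Lambda> \<le> (\<Sum>p\<in>P. ?\<nu> p * ln (real p))"
  proof -
    \<comment> \<open>This \<open>t\<close> maximises
      \<open>2 * t * W - t\<^sup>2 * \<Lambda>\<close>; with it, Cauchy-Schwarz reduces termwise to
      \<open>(\<nu> - t)\<^sup>2 >= 0\<close>.\<close>
    define t where "t = W / \<Lambda>"
    have "W\<^sup>2 / \<Lambda> = 2 * t * W - t\<^sup>2 * \<Lambda>"
      using \<Lambda> by (simp add: t_def power2_eq_square field_simps)
    also have "\<dots> \<le> 2 * t * W - t\<^sup>2 * (\<Sum>p\<in>P. ln (real p) / ?\<nu> p)"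
      using sieve by (intro diff_left_mono mult_left_mono) auto
    also have "\<dots> = (\<Sum>p\<in>P. 2 * t * ln (real p) - t\<^sup>2 * (ln (real p) / ?\<nu> p))"
      by (simp only: W_def sum_subtractf sum_distrib_left)
    also have "\<dots> \<le> (\<Sum>p\<in>P. ?\<nu> p * ln (real p))"
    proof (rule sum_mono)
      fix p assume p: "p \<in> P"
      have "?\<nu> p * ln (real p) - (2 * t * ln (real p) - t\<^sup>2 * (ln (real p) / ?\<nu> p)) =
          ln (real p) * (?\<nu> p - t)\<^sup>2 / ?\<nu> p"
        using \<nu>[of p] by (simp add: power2_eq_square field_simps)
      also have "\<dots> \<ge> 0" using \<nu>[of p] lnp[OF p] by simp
      finally show "2 * t * ln (real p) - t\<^sup>2 * (ln (real p) / ?\<nu> p) \<le> ?\<nu> p * ln (real p)" by simp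
    qed
    finally show ?thesis .
  qed
  also have "\<dots> \<le> (\<Sum>p\<in>P. y * L * (?\<nu> p / (real p - ?\<nu> p)))"
  proof (rule sum_mono)
    fix p assume p: "p \<in> P"
    note pp = P(2)[OF p]
    have p2: "real p \<ge> 2" using prime_ge_2_nat[of p] pp by simp
    have lt: "?\<nu> p < real p" using pp by simp
    have "ln (real p) \<le> ln y" using pp p2 by (intro ln_mono) auto
    then have lnL: "ln (real p) \<le> L" using y by simp
    have "?\<nu> p * ln (real p) \<le> ?\<nu> p * L" using lnL by (intro mult_left_mono) auto
    also have "\<dots> = real p * L * (?\<nu> p / real p)" using p2 by simp
    also have "\<dots> \<le> y * L * (?\<nu> p / (real p - ?\<nu> p))"
      using pp p2 lt y \<nu>[of p] by (intro mult_mono divide_left_mono) auto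
    finally show "?\<nu> p * ln (real p) \<le> y * L * (?\<nu> p / (real p - ?\<nu> p))" .
  qed
  also have "\<dots> = y * L * (\<Sum>p\<in>P. ?\<nu> p / (real p - ?\<nu> p))" by (rule sum_distrib_left[symmetric])
  finally have V: "W\<^sup>2 / (\<Lambda> * (y * L)) \<le> (\<Sum>p\<in>P. ?\<nu> p / (real p - ?\<nu> p))"
    using y \<Lambda> by (simp add: field_simps)
  have "min (w * n / (2 * y * L)) (w\<^sup>2 / (2 * y * L * ln x)) \<le> W\<^sup>2 / (\<Lambda> * (y * L))"
  proof (cases "ln x \<le> W / n")
    case True
    have "w * n / (2 * y * L) \<le> W * n / (2 * y * L)" using W n y by (intro divide_right_mono mult_right_mono) auto
    also have "\<dots> = W\<^sup>2 / ((2 * (W / n)) * (y * L))" using W n y by (simp add: power2_eq_square field_simps)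
    also have "\<dots> \<le> W\<^sup>2 / (\<Lambda> * (y * L))"
      using True W n y \<Lambda> by (intro divide_left_mono mult_right_mono) (auto simp: \<Lambda>_def)
    finally show ?thesis by simp
  next
    case False
    have "w\<^sup>2 / (2 * y * L * ln x) \<le> W\<^sup>2 / (2 * y * L * ln x)"
      using W w y x by (intro divide_right_mono power_mono) auto
    also have "\<dots> = W\<^sup>2 / ((2 * ln x) * (y * L))" by (simp add: mult_ac)
    also have "\<dots> \<le> W\<^sup>2 / (\<Lambda> * (y * L))"
      using False x y \<Lambda> by (intro divide_left_mono mult_right_mono) (auto simp: \<Lambda>_def)
    finally show ?thesis by simp
  qed
  then show ?thesis using V unfolding n_def by linarith
qed

text \<open>A modulus takes one prime from each range. The ranges are disjoint, so the set
  \<open>{p, q}\<close> determines the pair and the sieve sum factors.\<close>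

lemma card_mult_residue_sums_le:
  fixes x y :: real
  assumes AB: "finite A" "A \<noteq> {}" "B \<noteq> {}"
    and bound: "\<And>a b. a \<in> A \<Longrightarrow> b \<in> B \<Longrightarrow> real (a + b) \<le> x"
    and P1: "finite P1" "\<And>p. p \<in> P1 \<Longrightarrow> prime p \<and> real p \<le> y"
    and P2: "finite P2" "\<And>p. p \<in> P2 \<Longrightarrow> prime p \<and> y < real p \<and> real p \<le> 2 * y"
    and y: "(2 * y\<^sup>2)\<^sup>2 \<le> x" "y \<ge> 0"
    and free: "\<And>p a b. p \<in> P1 \<union> P2 \<Longrightarrow> a \<in> A \<Longrightarrow> b \<in> B \<Longrightarrow> \<not> p dvd a + b"
  defines "V \<equiv> \<lambda>P. \<Sum>p\<in>P. real (residues_mod A p) / (real p - real (residues_mod A p))"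
  shows "real (card B) * (V P1 * V P2) \<le> 4 * x + 2"
proof -
  let ?f = "\<lambda>p. real (residues_mod A p) / (real p - real (residues_mod A p))"
  let ?m = "\<lambda>t. {fst t, snd t}"
  let ?D = "?m ` (P1 \<times> P2)"
  have lt: "p < q" if "p \<in> P1" "q \<in> P2" for p q using P1(2)[OF that(1)] P2(2)[OF that(2)] by linarith
  have inj: "inj_on ?m (P1 \<times> P2)"
  proof (rule inj_onI)
    fix s t assume s: "s \<in> P1 \<times> P2" and t: "t \<in> P1 \<times> P2" and eq: "?m s = ?m t"
    have "fst s < snd s" "fst t < snd t" using s t lt by auto
    then show "s = t" using eq by (auto simp: doubleton_eq_iff prod_eq_iff)
  qed
  have T: "finite T" "\<And>p. p \<in> T \<Longrightarrow> p \<in> P1 \<union> P2" if "T \<in> ?D" for T using that by auto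
  have level: "(real (\<Prod>T))\<^sup>2 \<le> x" if "T \<in> ?D" for T
  proof -
    obtain p q where pq: "p \<in> P1" "q \<in> P2" "T = {p, q}" using \<open>T \<in> ?D\<close> by auto
    have "real (\<Prod>T) = real p * real q" using lt[OF pq(1,2)] by (simp add: pq)
    also have "\<dots> \<le> y * (2 * y)" using P1(2)[OF pq(1)] P2(2)[OF pq(2)] y by (intro mult_mono) auto
    finally have "real (\<Prod>T) \<le> 2 * y\<^sup>2" by (simp add: power2_eq_square)
    then have "(real (\<Prod>T))\<^sup>2 \<le> (2 * y\<^sup>2)\<^sup>2" by (intro power_mono) (auto intro: prod_nonneg)
    then show ?thesis using y by simp
  qed
  have "real (card B) * (\<Sum>T\<in>?D. \<Prod>p\<in>T. ?f p) \<le> 4 * x + 2"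
  proof (rule residues_mod_less_and_large_sieve(2)[of A B x ?D])
    show "prime p" if "T \<in> ?D" "p \<in> T" for T p using T(2)[OF that] P1(2) P2(2) by auto
    show "\<not> p dvd a + b" if "T \<in> ?D" "p \<in> T" "a \<in> A" "b \<in> B" for T p a b
      using T(2)[OF that(1,2)] free that by blast
  qed (use AB P1 P2 bound T level in auto)
  also have "(\<Sum>T\<in>?D. \<Prod>p\<in>T. ?f p) = (\<Sum>t\<in>P1 \<times> P2. \<Prod>p\<in>?m t. ?f p)"
    using inj by (simp add: sum.reindex)
  also have "\<dots> = (\<Sum>t\<in>P1 \<times> P2. ?f (fst t) * ?f (snd t))"
    using lt by (intro sum.cong refl) fastforce
  also have "\<dots> = V P1 * V P2"
    by (simp add: V_def sum_product sum.cartesian_product split_def)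
  finally show ?thesis .
qed

lemma card_le_if_summand_large:
  fixes x c \<tau> :: real
  assumes AB: "finite A" "A \<noteq> {}" "B \<noteq> {}"
    and bound: "\<And>a b. a \<in> A \<Longrightarrow> b \<in> B \<Longrightarrow> real (a + b) \<le> x" and x: "x \<ge> 10 ^ 40"
    and P: "P \<subseteq> {p. prime p}"
    and free: "\<And>p a b. p \<in> P \<Longrightarrow> a \<in> A \<Longrightarrow> b \<in> B \<Longrightarrow> \<not> p dvd a + b"
    and c: "c > 0"
    and dyadic: "\<And>y. x powr (1 / 10) \<le> y \<Longrightarrow> y \<le> x powr (1 / 2) \<Longrightarrow>
        dyadic_log_sum P y \<ge> c * dyadic_log_sum UNIV y"
    and large: "real (card A) * \<tau> > 1000 * (ln x)\<^sup>2 / c\<^sup>2" "\<tau> > 0"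
    and product: "real (card A) * real (card B) \<ge> \<tau> * x"
  shows "real (card B) \<le> 10 ^ 5 * (sqrt x * (ln x) ^ 4 / c ^ 4)"
proof -
  define n where "n = real (card A)"
  \<comment> \<open>Chosen so that \<open>2 * y\<^sup>2 = sqrt x\<close>: a prime up to
    \<open>y\<close> times one up to \<open>2 * y\<close> then stays within the level of the large
    sieve.\<close>
  define y where "y = sqrt (sqrt x / 2)"
  define P1 where "P1 = {p. prime p \<and> p \<in> P \<and> y / 2 < real p \<and> real p \<le> y}"
  define P2 where "P2 = {p. prime p \<and> p \<in> P \<and> 2 * y / 2 < real p \<and> real p \<le> 2 * y}"
  define V where "V = (\<lambda>P. \<Sum>p\<in>P. real (residues_mod A p) / (real p - real (residues_mod A p)))"
  \<comment> \<open>\<open>\<alpha>\<close> and \<open>\<beta>\<close> are the entries of the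
    minimum in \<open>sum_residue_ratio_ge\<close> for a range ending at \<open>z\<close>, with
    \<open>w = c * z / 10\<close> and \<open>L = ln x / 2\<close>: \<open>z\<close> cancels in the
    first, and the second is taken at \<open>z = y\<close>.\<close>
  define \<alpha> where "\<alpha> = c * n / (10 * ln x)"
  define \<beta> where "\<beta> = c\<^sup>2 * y / (100 * (ln x)\<^sup>2)"
  have x1: "x > 0" "x \<ge> 10" using x by auto
  have n: "n > 0" using AB by (simp add: n_def card_gt_0_iff)
  have lnx: "ln x \<ge> 1"
  proof -
    have "exp 1 \<le> x" using exp_le x1 by linarith
    then show ?thesis using x1 by (simp add: ln_ge_iff)
  qed
  have sqrt_x: "sqrt x \<ge> 100000000000000000000"
    using x by (intro real_le_rsqrt) simp
  have y2: "y\<^sup>2 = sqrt x / 2" unfolding y_def using x1 by simp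
  \<comment> \<open>This is \<open>100 ^ 4\<close>, the threshold of
    \<open>dyadic_log_sum_ge\<close>, secured by \<open>x >= 10 ^ 40\<close>.\<close>
  have y_ge: "y \<ge> 100000000" unfolding y_def using sqrt_x by (intro real_le_rsqrt) simp
  have range1: "x powr (1 / 10) \<le> y"
  proof -
    have "(2::real) ^ 10 \<le> x ^ 3"
    proof -
      have "(16::real) ^ 3 \<le> x ^ 3" using x by (intro power_mono) auto
      then show ?thesis by simp
    qed
    then have "((2::real) ^ 10) powr (1 / 10) \<le> (x ^ 3) powr (1 / 10)" by (intro powr_mono2) auto
    moreover have "((2::real) ^ 10) powr (1 / 10) = 2"
      by (subst powr_realpow[symmetric]) (simp_all add: powr_powr del: powr_numeral)
    moreover have "(x ^ 3) powr (1 / 10) = x powr (3 / 10)"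
      using x1 by (simp add: powr_powr flip: powr_numeral)
    ultimately have two: "2 \<le> x powr (3 / 10)" by simp
    have "(x powr (1 / 10))\<^sup>2 * 2 = x powr (1 / 5) * 2"
      using x1 by (simp add: power2_eq_square flip: powr_add)
    also have "\<dots> \<le> x powr (1 / 5) * x powr (3 / 10)" using two by (intro mult_left_mono) auto
    also have "\<dots> = sqrt x" using x1 by (simp add: powr_half_sqrt flip: powr_add)
    finally have "(x powr (1 / 10))\<^sup>2 \<le> y\<^sup>2" using y2 by simp
    then show ?thesis by (rule power2_le_imp_le) (use y_ge in linarith)
  qed
  have range2: "2 * y \<le> x powr (1 / 2)"
  proof -
    have "(2 * y)\<^sup>2 = 2 * sqrt x" using y2 by (simp add: power_mult_distrib)
    also have "\<dots> \<le> sqrt x * sqrt x" using sqrt_x x1 by (intro mult_right_mono) auto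
    also have "\<dots> = (x powr (1 / 2))\<^sup>2" using x1 by (simp add: powr_half_sqrt power2_eq_square)
    finally show ?thesis by (rule power2_le_imp_le) simp
  qed
  have fin: "finite P1" "finite P2"
  proof -
    have "P1 \<union> P2 \<subseteq> {..nat \<lfloor>2 * y\<rfloor>}" using y_ge by (auto simp: P1_def P2_def intro!: le_nat_floor)
    then have "finite (P1 \<union> P2)" by (rule finite_subset) simp
    then show "finite P1" "finite P2" by auto
  qed
  have A_le: "real a \<le> x" if "a \<in> A" for a
  proof -
    obtain b where b: "b \<in> B" using AB by auto
    show ?thesis using bound[OF that b] by simp
  qed
  have less: "residues_mod A p < p" if "p \<in> P1 \<union> P2" for p
  proof (rule residues_mod_less_and_large_sieve(1)[of A B x "{{p}}" "{p}"])
    have "real p \<le> 2 * y" using that y_ge by (auto simp: P1_def P2_def)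
    then have "(real p)\<^sup>2 \<le> (x powr (1 / 2))\<^sup>2" using range2 by (intro power_mono) auto
    then show "(real (\<Prod>T))\<^sup>2 \<le> x" if "T \<in> {{p}}" for T
      using that x1 by (simp add: powr_half_sqrt)
    show "\<not> q dvd a + b" if "T \<in> {{p}}" "q \<in> T" "a \<in> A" "b \<in> B" for T q a b
      using that \<open>p \<in> P1 \<union> P2\<close> free by (auto simp: P1_def P2_def)
  qed (use AB bound that P1_def P2_def in auto)
  have ln_le: "ln z \<le> ln x / 2" if "z \<le> x powr (1 / 2)" "z > 0" for z
  proof -
    have "ln z \<le> ln (x powr (1 / 2))" using that by (intro ln_mono) auto
    then show ?thesis using x1 by (simp add: ln_powr)
  qed
  have V_ge: "min \<alpha> \<beta> \<le> V R"
    if R: "R = {p. prime p \<and> p \<in> P \<and> z / 2 < real p \<and> real p \<le> z}" "finite R" "R \<subseteq> P1 \<union> P2"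
      and z: "y \<le> z" "z \<le> 2 * y" for R z
  proof -
    have "z \<ge> 100000000" "z > 0" using z y_ge by auto
    have "c * (z / 10) \<le> c * dyadic_log_sum UNIV z"
      using c \<open>z \<ge> 100000000\<close> by (intro mult_left_mono dyadic_log_sum_ge) auto
    also have "\<dots> \<le> dyadic_log_sum P z" using range1 range2 z by (intro dyadic) auto
    finally have w: "c * z / 10 \<le> (\<Sum>p\<in>R. ln (real p))" by (simp add: dyadic_log_sum_def R(1))
    have "min (c * z / 10 * n / (2 * z * (ln x / 2))) ((c * z / 10)\<^sup>2 / (2 * z * (ln x / 2) * ln x)) \<le> V R"
      unfolding V_def n_def
    proof (rule sum_residue_ratio_ge)
      show "prime p \<and> real p \<le> z \<and> residues_mod A p < p" if "p \<in> R" for p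
        using that R less by auto
      show "ln z \<le> ln x / 2" using z range2 \<open>z > 0\<close> by (intro ln_le) auto
    qed (use AB A_le x1 lnx R w c \<open>z > 0\<close> in auto)
    moreover have "c * z / 10 * n / (2 * z * (ln x / 2)) = \<alpha>"
      using \<open>z > 0\<close> lnx by (simp add: \<alpha>_def)
    moreover have "(c * z / 10)\<^sup>2 / (2 * z * (ln x / 2) * ln x) = c\<^sup>2 * z / (100 * (ln x)\<^sup>2)"
      using \<open>z > 0\<close> lnx by (simp add: power2_eq_square field_simps)
    moreover have "\<beta> \<le> c\<^sup>2 * z / (100 * (ln x)\<^sup>2)"
      unfolding \<beta>_def using z by (intro divide_right_mono mult_left_mono) auto
    ultimately show ?thesis by linarith
  qed
  have "\<alpha> > 0" "\<beta> > 0" using c n lnx y_ge by (auto simp: \<alpha>_def \<beta>_def)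
  have "min \<alpha> \<beta> \<le> V P1" using fin y_ge by (intro V_ge[of P1 y]) (auto simp: P1_def)
  moreover have "min \<alpha> \<beta> \<le> V P2" using fin y_ge by (intro V_ge[of P2 "2 * y"]) (auto simp: P2_def)
  ultimately have "min \<alpha> \<beta> * min \<alpha> \<beta> \<le> V P1 * V P2"
    using \<open>\<alpha> > 0\<close> \<open>\<beta> > 0\<close> by (intro mult_mono) auto
  then have "real (card B) * (min \<alpha> \<beta>)\<^sup>2 \<le> real (card B) * (V P1 * V P2)"
    by (intro mult_left_mono) (auto simp: power2_eq_square)
  also have "\<dots> \<le> 4 * x + 2"
    unfolding V_def
  proof (rule card_mult_residue_sums_le[where y = y])
    show "(2 * y\<^sup>2)\<^sup>2 \<le> x" unfolding y2 using x1 by simp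
    show "\<not> p dvd a + b" if "p \<in> P1 \<union> P2" "a \<in> A" "b \<in> B" for p a b
      using that free by (auto simp: P1_def P2_def)
  qed (use AB bound fin y_ge in \<open>auto simp: P1_def P2_def\<close>)
  finally have main: "real (card B) * (min \<alpha> \<beta>)\<^sup>2 \<le> 5 * x" using x1 by simp
  \<comment> \<open>If the minimum were \<open>\<alpha>\<close>, multiplying by \<open>n\<close> and
    using \<open>n * card B >= \<tau> * x\<close> would give
    \<open>n * \<tau> <= 500 * (ln x)\<^sup>2 / c\<^sup>2\<close>, half of the lower bound in
    \<open>large\<close>.\<close>
  have "\<beta> < \<alpha>"
  proof (rule ccontr)
    assume "\<not> \<beta> < \<alpha>"
    then have "real (card B) * \<alpha>\<^sup>2 \<le> 5 * x" using main by (simp add: min_def)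
    then have "n * (real (card B) * \<alpha>\<^sup>2) \<le> n * (5 * x)" using n by (intro mult_left_mono) auto
    moreover have "(\<tau> * x) * \<alpha>\<^sup>2 \<le> (n * real (card B)) * \<alpha>\<^sup>2"
      using product by (intro mult_right_mono) (auto simp: n_def)
    ultimately have "x * (\<tau> * \<alpha>\<^sup>2) \<le> x * (n * 5)" by (simp add: mult_ac)
    then have "\<tau> * \<alpha>\<^sup>2 \<le> n * 5" using x1 by simp
    moreover have "\<tau> * \<alpha>\<^sup>2 = n * (n * \<tau> * (c\<^sup>2 / (100 * (ln x)\<^sup>2)))"
      by (simp add: \<alpha>_def power2_eq_square)
    ultimately have "n * (n * \<tau> * (c\<^sup>2 / (100 * (ln x)\<^sup>2))) \<le> n * 5" by (simp only:)
    then have "n * \<tau> * (c\<^sup>2 / (100 * (ln x)\<^sup>2)) \<le> 5" using n by (rule mult_left_le_imp_le)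
    then have "n * \<tau> \<le> 500 * (ln x)\<^sup>2 / c\<^sup>2" using c lnx by (simp add: field_simps)
    also have "\<dots> \<le> 1000 * (ln x)\<^sup>2 / c\<^sup>2" by (intro divide_right_mono) auto
    finally show False using large by (simp add: n_def)
  qed
  then have "real (card B) * \<beta>\<^sup>2 \<le> 5 * x" using main by simp
  \<comment> \<open>The square of 100 and the 2 in \<open>y\<^sup>2 = sqrt x / 2\<close> make 20000;
    together with \<open>5 * x\<close> this yields the constant \<open>10 ^ 5\<close>.\<close>
  moreover have "\<beta>\<^sup>2 = c ^ 4 * sqrt x / (20000 * (ln x) ^ 4)"
    unfolding \<beta>_def power_divide power_mult_distrib y2 by (simp flip: power_mult)
  moreover have "x = sqrt x * sqrt x" using x1 by simp
  ultimately have "real (card B) * (c ^ 4 * s / (20000 * (ln x) ^ 4)) \<le> 5 * (s * s)" if "s = sqrt x" for s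
    unfolding that by metis
  then obtain s where s: "s = sqrt x" "real (card B) * (c ^ 4 * s / (20000 * (ln x) ^ 4)) \<le> 5 * (s * s)"
    by blast
  have "s > 0" using s x1 by simp
  have "s * (real (card B) * c ^ 4) \<le> s * (10 ^ 5 * (s * (ln x) ^ 4))"
    using s(2) lnx by (simp add: field_simps)
  then have "real (card B) * c ^ 4 \<le> 10 ^ 5 * (s * (ln x) ^ 4)"
    using \<open>s > 0\<close> by (rule mult_left_le_imp_le)
  then show ?thesis using c by (simp add: s field_simps)
qed

section \<open>Combining the two regimes\<close>

theorem theorem4p1:
  shows "\<exists>x0 C1 C2 :: real. C1 > 0 \<and> C2 > 0 \<and>
    (\<forall>(x::real) (P0 :: nat set) (c::real) (S :: nat set) (S0 :: nat set)
        (\<sigma>::real) (\<sigma>0::real) (K::real) (P0s :: nat set).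
      x \<ge> x0 \<longrightarrow>
      P0 \<subseteq> {p. prime p} \<longrightarrow>
      x powr (- (1/10)) < c \<longrightarrow> c \<le> 1 \<longrightarrow>
      (\<forall>y::real. x powr (1/10) \<le> y \<and> y \<le> x powr (1/2) \<longrightarrow>
         dyadic_log_sum P0 y \<ge> c * dyadic_log_sum UNIV y) \<longrightarrow>
      S \<noteq> {} \<longrightarrow>
      (\<forall>s\<in>S. 1 \<le> s \<and> real s \<le> x) \<longrightarrow>
      (\<forall>s\<in>S. \<forall>p\<in>P0. \<not> p dvd s) \<longrightarrow>
      \<sigma> = real (card S) / x \<longrightarrow>
      S0 \<subseteq> S \<longrightarrow> S0 \<noteq> {} \<longrightarrow>
      \<sigma>0 = real (card S0) / real (card S) \<longrightarrow>
      K = 1000 * inverse (\<sigma>0 * \<sigma> * c\<^sup>2) * (ln x)\<^sup>2 \<longrightarrow>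
      P0s = {p \<in> P0. real p \<ge> K ^ 3} \<longrightarrow>
      sieve_controls_size x P0s \<sigma> \<sigma>0 \<or> bombieri_vinogradov S P0s \<sigma>0 K \<longrightarrow>
      (\<forall>A B :: nat set. S0 = A + B \<longrightarrow> 2 \<le> card A \<longrightarrow> card A \<le> card B \<longrightarrow>
         real (card B) \<le> C1 * (sqrt x * (ln x) ^ 4 / c ^ 4) \<and>
         real (card A) \<ge> C2 * (sqrt x * \<sigma>0 * \<sigma> * c ^ 4 / (ln x) ^ 4)))"
proof (rule exI[of _ "10 ^ 40"], rule exI[of _ "10 ^ 5"], rule exI[of _ "1 / 10 ^ 5"], intro conjI allI impI)
  fix x c \<sigma> \<sigma>0 K :: real and P0 S S0 P0s A B :: "nat set"
  assume x: "10 ^ 40 \<le> x" and P0: "P0 \<subseteq> {p. prime p}" and c: "x powr (- (1/10)) < c" "c \<le> 1"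
    and dyadic: "\<forall>y. x powr (1/10) \<le> y \<and> y \<le> x powr (1/2) \<longrightarrow> dyadic_log_sum P0 y \<ge> c * dyadic_log_sum UNIV y"
    and S: "S \<noteq> {}" "\<forall>s\<in>S. 1 \<le> s \<and> real s \<le> x" "\<forall>s\<in>S. \<forall>p\<in>P0. \<not> p dvd s"
    and \<sigma>: "\<sigma> = real (card S) / x" and S0: "S0 \<subseteq> S" "S0 \<noteq> {}"
    and \<sigma>0: "\<sigma>0 = real (card S0) / real (card S)"
    and K: "K = 1000 * inverse (\<sigma>0 * \<sigma> * c\<^sup>2) * (ln x)\<^sup>2"
    and P0s: "P0s = {p \<in> P0. real p \<ge> K ^ 3}"
    and hyp: "sieve_controls_size x P0s \<sigma> \<sigma>0 \<or> bombieri_vinogradov S P0s \<sigma>0 K"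
    and AB: "S0 = A + B" "2 \<le> card A" "card A \<le> card B"
  have x1: "x > 0" "x \<ge> 10" using x by auto
  have lnx: "ln x \<ge> 1"
  proof -
    have "exp 1 \<le> x" using exp_le x1 by linarith
    then show ?thesis using x1 by (simp add: ln_ge_iff)
  qed
  have c0: "c > 0" using c(1) by (rule le_less_trans[rotated]) simp
  have S_sub: "S \<subseteq> {1..nat \<lfloor>x\<rfloor>}" using S(2) by (auto simp: le_nat_floor)
  then have finS: "finite S" by (rule finite_subset) simp
  have finS0: "finite S0" using S0(1) finS by (rule finite_subset)
  have cards: "real (card S) > 0" "real (card S0) > 0" "card S0 \<le> card S"
    using finS finS0 S S0 by (auto simp: card_gt_0_iff card_mono)
  have "card S \<le> card {1..nat \<lfloor>x\<rfloor>}" using S_sub by (intro card_mono) auto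
  then have "real (card S) \<le> real (nat \<lfloor>x\<rfloor>)" by simp
  also have "\<dots> \<le> x" using x1 by (intro of_nat_floor) simp
  finally have S_le: "real (card S) \<le> x" .
  have \<sigma>\<sigma>0: "\<sigma>0 * \<sigma> = real (card S0) / x" using cards by (simp add: \<sigma> \<sigma>0)
  have \<sigma>0_bounds: "0 < \<sigma>0" "\<sigma>0 \<le> 1" using cards by (auto simp: \<sigma>0)
  have prod_bounds: "0 < \<sigma>0 * \<sigma>" "\<sigma>0 * \<sigma> \<le> 1" using cards S_le x1 by (auto simp: \<sigma>\<sigma>0)
  have "finite A" "finite B" using AB by (auto intro: card_ge_0_finite)
  have "A \<noteq> {}" "B \<noteq> {}" using AB by auto
  have sums: "a + b \<in> S" if "a \<in> A" "b \<in> B" for a b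
    using S0(1) that unfolding AB(1) by auto
  have bound: "real (a + b) \<le> x" if "a \<in> A" "b \<in> B" for a b using sums[OF that] S(2) by blast
  have free: "\<not> p dvd a + b" if "p \<in> P0" "a \<in> A" "b \<in> B" for p a b using sums[OF that(2,3)] S(3) that(1) by blast
  have "card S0 \<le> card A * card B"
    unfolding AB(1) by (rule card_le_card_mult_if_sumset) fact+
  then have product: "real (card S0) \<le> real (card A) * real (card B)"
    by (simp only: of_nat_mult[symmetric] of_nat_le_iff)
  have K_ge: "K \<ge> 1000 * ln x"
  proof -
    have "\<sigma>0 * \<sigma> * c\<^sup>2 \<le> 1 * 1" using prod_bounds c c0 by (intro mult_mono power_le_one) auto
    moreover have "\<sigma>0 * \<sigma> * c\<^sup>2 > 0" using prod_bounds c0 by simp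
    ultimately have "1 \<le> inverse (\<sigma>0 * \<sigma> * c\<^sup>2)" by (intro one_le_inverse) auto
    then have "1 * (ln x)\<^sup>2 \<le> inverse (\<sigma>0 * \<sigma> * c\<^sup>2) * (ln x)\<^sup>2" by (intro mult_right_mono) auto
    moreover have "ln x * 1 \<le> ln x * ln x" using lnx by (intro mult_left_mono) auto
    ultimately show ?thesis by (simp add: K power2_eq_square)
  qed
  from hyp have A_large: "real (card A) > K"
  proof
    assume sieve: "sieve_controls_size x P0s \<sigma> \<sigma>0"
    show ?thesis
    proof (rule summand_not_small_if_sieve_controls_size[OF _ _ _ bound _ _ K_ge _ _ prod_bounds _ sieve])
      show "\<sigma>0 * \<sigma> * x \<le> real (card A) * real (card B)" using product x1 by (simp add: \<sigma>\<sigma>0)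
    qed (use \<open>finite A\<close> AB(2) \<open>B \<noteq> {}\<close> x1 lnx P0s free in auto)
  next
    assume bv: "bombieri_vinogradov S P0s \<sigma>0 K"
    show ?thesis
    proof (rule summand_not_small_if_bombieri_vinogradov[OF finS _ _ _ sums _ _ _ K_ge _ _ \<sigma>0_bounds _ bv])
      show "\<sigma>0 * real (card S) \<le> real (card A) * real (card B)" using product cards by (simp add: \<sigma>0)
    qed (use \<open>finite A\<close> AB(2) \<open>B \<noteq> {}\<close> x1 lnx P0s S in auto)
  qed
  \<comment> \<open>Multiplying \<open>K\<close> by \<open>\<sigma>0 * \<sigma>\<close> leaves
    exactly the bound that \<open>card_le_if_summand_large\<close> asks for.\<close>
  have tau_large: "real (card A) * (\<sigma>0 * \<sigma>) > 1000 * (ln x)\<^sup>2 / c\<^sup>2"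
  proof -
    have "1000 * inverse (t * c\<^sup>2) * (ln x)\<^sup>2 * t = 1000 * (ln x)\<^sup>2 / c\<^sup>2" if "t > 0" for t
      using that c0 by (simp add: field_simps)
    from this[OF prod_bounds(1)] show ?thesis
      using mult_strict_right_mono[OF A_large prod_bounds(1)] by (simp only: K)
  qed
  show upper: "real (card B) \<le> 10 ^ 5 * (sqrt x * (ln x) ^ 4 / c ^ 4)"
  proof (rule card_le_if_summand_large[of A B x P0 c "\<sigma>0 * \<sigma>"])
    show "\<sigma>0 * \<sigma> * x \<le> real (card A) * real (card B)" using product x1 by (simp add: \<sigma>\<sigma>0)
    show "c * dyadic_log_sum UNIV y \<le> dyadic_log_sum P0 y"
      if "x powr (1 / 10) \<le> y" "y \<le> x powr (1 / 2)" for y using dyadic that by blast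
  qed (fact \<open>finite A\<close> \<open>A \<noteq> {}\<close> \<open>B \<noteq> {}\<close> bound x P0 free c0 tau_large prod_bounds(1))+
  \<comment> \<open>The bound for \<open>card A\<close> is the lower bound for the product divided
    by the upper bound for \<open>card B\<close>, so its constant is the reciprocal one.\<close>
  have "\<sigma>0 * \<sigma> * (sqrt x * sqrt x) \<le> real (card A) * real (card B)" using product x1 by (simp add: \<sigma>\<sigma>0)
  also have "\<dots> \<le> real (card A) * (10 ^ 5 * (sqrt x * (ln x) ^ 4 / c ^ 4))"
    using upper by (intro mult_left_mono) auto
  finally have "sqrt x * (\<sigma>0 * \<sigma> * sqrt x) \<le> sqrt x * (real (card A) * (10 ^ 5 * ((ln x) ^ 4 / c ^ 4)))"
    by (simp add: mult_ac)
  then have "\<sigma>0 * \<sigma> * sqrt x \<le> real (card A) * (10 ^ 5 * ((ln x) ^ 4 / c ^ 4))"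
    by (rule mult_left_le_imp_le) (use x1 in simp)
  then show "1 / 10 ^ 5 * (sqrt x * \<sigma>0 * \<sigma> * c ^ 4 / (ln x) ^ 4) \<le> real (card A)"
    using c0 lnx by (simp add: field_simps)
qed simp_all

end
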